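(* (Efficiency.) Assume the mesh family $\{\Omega_h\}$ satisfies the mesh regularity assumption with constant $\rho$. Let $(\mathbf u,p)\in\mathbf V\times Q$ be the solution of the continuous problem and $(\mathbf u_h,p_h)\in\mathbf V_h\times Q_h$ the solution of the discrete problem. Then there is a positive constant $C_r$, independent of $h_E$, such that for every $E\in\Omega_h$ the local estimator $$\eta_{r,E}^2=\nu^2h_E^2\|\kappa^{-1}\Pi^{0,E}\mathbf u_h\|_E^2+\frac12\sum_{e\in\mathcal F_h^0\cap\partial E}h_e\big\|[\nu\nabla\Pi^{\nabla,E}\mathbf u_h-p_h\mathbf I]\,\mathbf n_e\big\|_e^2$$ satisfies $$\eta_{r,E}^2\le C_r\sum_{e\subset\partial E}\ \sum_{E'\in\mathcal E_e}\left(\nu^2|||\mathbf u-\mathbf u_h|||_{E'}^2+\|p-p_h\|_{E'}^2+\eta_{S,E'}^2+\eta_{\mathbf f,E'}^2+\nu^2h_{E'}^2\|\kappa^{-1}\Pi^{0,E'}\mathbf u_h\|_{E'}^2\right),$$ where the outer sum runs over all edges $e$ of $E$, $\mathcal E_e$ is the set of elements of $\Omega_h$ having $e$ as an edge, and $$\eta_{\mathbf f,E}^2=h_E^2\|\mathbf f\|_E^2,\qquad \eta_{S,E}^2=\nu^2S_E^\nabla\big((I-\Pi^{\nabla,E})\mathbf u_h,(I-\Pi^{\nabla,E})\mathbf u_h\big)+\nu^2S_E^0\big((I-\Pi^{0,E})\mathbf u_h,(I-\Pi^{0,E})\mathbf u_h\big).$$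
   Context: **Continuous problem.** $\Omega\subset\mathbb R^2$ is a convex polygonal domain with Lipschitz boundary; $\|\cdot\|$, $(\cdot,\cdot)$ are the $L^2(\Omega)$ norm and inner product, subscript $E$ or $e$ means restriction to an element or edge. $\nu>0$ is the viscosity, $\mathbf f\in[L^2(\Omega)]^2$, and $\kappa$ is a symmetric positive definite permeability tensor with $\|\kappa^{-1/2}\|_\infty<\infty$. $\mathbf V=[H_0^1(\Omega)]^2$, $Q=L^2_0(\Omega)$ (zero mean), $|||\mathbf v|||_E=(\|\nabla\mathbf v\|_E^2+\|\kappa^{-1/2}\mathbf v\|_E^2)^{1/2}$. Put $a(\mathbf u,\mathbf v)=\int_\Omega\nabla\mathbf u:\nabla\mathbf v+\kappa^{-1}\mathbf u\cdot\mathbf v\,d\mathbf x$ and $b(\mathbf v,q)=\int_\Omega q\,\nabla\cdot\mathbf v\,d\mathbf x$. The continuous problem is: find $(\mathbf u,p)\in\mathbf V\times Q$ with $\nu a(\mathbf u,\mathbf v)+b(\mathbf v,p)=(\mathbf f,\mathbf v)$ for all $\mathbf v\in\mathbf V$ and $b(\mathbf u,q)=0$ for all $q\in Q$. (This is the weak form of $-\nu\Delta\mathbf u+\nu\kappa^{-1}\mathbf u-\nabla p=\mathbf f$, $\nabla\cdot\mathbf u=0$ in $\Omega$, $\mathbf u=\mathbf 0$ on $\partial\Omega$.) **Meshes.** $\{\Omega_h\}$ is a sequence of subdivisions of $\Omega$ into general polygons $E$, $h_E$ is the diameter of $E$, $h=\max_E h_E$, $h_e$ is the length of the edge $e$. Mesh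 regularity assumption: there is $\rho>0$ such that for all $h$ and all $E\in\Omega_h$, (1) the shortest edge $e_{\min}$ of $E$ satisfies $|e_{\min}|/h_E>\rho$; (2) $E$ is star-shaped with respect to a ball of radius $\rho h_E$ and center $\mathbf x_E\in E$. Each $E$ with $N$ vertices is split into $N-2$ (uniformly shape-regular) triangles $T_1,\dots,T_{N-2}$ without additional vertices, and these triangles together form a conforming simplicial submesh of $\Omega$. $\mathcal F_h^0$ is the set of interior edges (shared by two elements), $\mathbf n_e$ is a unit normal to $e$, and $[\cdot]$ is the jump across an edge of a piecewise defined function (so $[\nu\nabla\Pi^{\nabla,E}\mathbf u_h-p_h\mathbf I]$ is the difference of the values of the piecewise function $\nu\nabla\Pi^{\nabla,E}\mathbf u_h-p_h\mathbf I$ from the two elements sharing $e$; $\mathbf I$ is the $2\times2$ identity matrix). **Virtual element spaces.** $P_k(D)$ denotes polynomials of degree $\le k$ on $D$, $\mathbf P_k(D)$ the vector version. For a polygon $E$ with unit outward normal $\mathbf n_E$ and unit tangent $\mathbf t_E$: $\mathcal G_1^\perp(E)=\mathbf x^\perp P_0(E)$ with $\mathbf x^\perp=(y,-x)^T$; $\mathbf B_1(\partial E)=\{\mathbf v\in\mathbf C^0(\partial E):\mathbf v|_e\cdot\mathbf n_E\in P_2(e),\ \mathbf v|_e\cdot\mathbf t_E\in P_1(e)\ \forall e\subset\partial E\}$; $\widehat{\mathbf U}_E=\{\mathbf v\in[H^1(E)]^2:\mathbf v|_{\partial E}\in\mathbf B_1(\partial E),\ \nabla\cdot\mathbf v\in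 P_0(E),\ \Delta\mathbf v-\nabla s\in\mathcal G_1^\perp(E)\text{ for some }s\in L^2(E)\}$. The projection $\Pi^{\nabla,E}$ onto $\mathbf P_1(E)$ is given by $(\nabla(\mathbf v-\Pi^{\nabla,E}\mathbf v),\nabla\mathbf p_1)_E=0$ for all $\mathbf p_1\in\mathbf P_1(E)$ together with equality of the arithmetic means of the vertex values of $\mathbf v$ and $\Pi^{\nabla,E}\mathbf v$ over the vertices of $E$. $\mathbf V_E=\{\mathbf v\in\widehat{\mathbf U}_E:(\mathbf v-\Pi^{\nabla,E}\mathbf v,\mathbf p_1)_E=0\ \forall\mathbf p_1\in\mathcal G_1^\perp(E)\}$. $\Pi^{0,E}$ is the $L^2(E)$-orthogonal projection onto $\mathbf P_1(E)$; applied to a gradient it denotes the $L^2(E)$-projection onto constant matrices (so $\Pi^{0,E}\nabla\mathbf v=\nabla\Pi^{\nabla,E}\mathbf v$). Global spaces: $\mathbf V_h=\{\mathbf v\in[H_0^1(\Omega)]^2:\mathbf v|_E\in\mathbf V_E\ \forall E\in\Omega_h\}$, $Q_h=\{q\in L_0^2(\Omega):q|_E\in P_0(E)\ \forall E\in\Omega_h\}$. **Reconstruction operator.** $\mathcal R_h$ maps $\mathbf v\in\mathbf V$ to the function $\mathcal R_h\mathbf v\in\mathbf H(\mathrm{div},\Omega)$ that on every triangle $T_i$ of the submesh belongs to the lowest-order Raviart–Thomas space $\mathrm{RT}_0(T_i)$, has $\nabla\cdot\mathcal R_h\mathbf v$ constant on each $E\in\Omega_h$, and satisfies $\int_e\mathcal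 R_h\mathbf v\cdot\mathbf n\,ds=\int_e\mathbf v\cdot\mathbf n\,ds$ for every edge $e$ of every $E\in\Omega_h$. **Discrete problem.** $a_h=\sum_{E}a_h^E$ with $a_h^E(\mathbf w,\mathbf v)=(\Pi^{0,E}\nabla\mathbf w,\Pi^{0,E}\nabla\mathbf v)_E+S_E^\nabla((I-\Pi^{\nabla,E})\mathbf w,(I-\Pi^{\nabla,E})\mathbf v)+(\kappa^{-1}\Pi^{0,E}\mathbf w,\Pi^{0,E}\mathbf v)_E+S_E^0((I-\Pi^{0,E})\mathbf w,(I-\Pi^{0,E})\mathbf v)$, where $S_E^\nabla,S_E^0$ are symmetric bilinear forms on $\mathbf V_E$ with $C_1^\nabla\|\nabla\mathbf v\|_E^2\le S_E^\nabla(\mathbf v,\mathbf v)\le C_2^\nabla\|\nabla\mathbf v\|_E^2$ when $\Pi^{\nabla,E}\mathbf v=0$, and $C_1^0\|\kappa^{-1/2}\mathbf v\|_E^2\le S_E^0(\mathbf v,\mathbf v)\le C_2^0\|\kappa^{-1/2}\mathbf v\|_E^2$ when $\Pi^{0,E}\mathbf v=0$, the constants being positive and independent of $h_E$. The discrete problem is: find $(\mathbf u_h,p_h)\in\mathbf V_h\times Q_h$ with $\nu a_h(\mathbf u_h,\mathbf v_h)+b(\mathbf v_h,p_h)=(\mathbf f,\mathcal R_h\mathbf v_h)$ for all $\mathbf v_h\in\mathbf V_h$ and $b(\mathbf u_h,q_h)=0$ for all $q_h\in Q_h$. *)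

theory Defs
  imports "HOL-Analysis.Analysis" "HOL-Computational_Algebra.Polynomial"
begin

section \<open>Lebesgue and Sobolev spaces in the plane\<close>

text \<open>
  Elements of function spaces over a set D are represented by total functions, of which only the
  values on D up to null sets matter. The norm and inner product of \<^typ>\<open>real^2^2\<close> are those
  of Frobenius, so \<open>l2_sq D G\<close> is the usual squared norm of a matrix field.
\<close>

definition L2 :: "(real^2) set \<Rightarrow> (real^2 \<Rightarrow> 'b::euclidean_space) \<Rightarrow> bool" where
  "L2 D f \<longleftrightarrow> f \<in> borel_measurable (lebesgue_on D)
     \<and> integrable (lebesgue_on D) (\<lambda>x. (norm (f x))\<^sup>2)"

definition l2_inner :: "(real^2) set \<Rightarrow> (real^2 \<Rightarrow> 'b::euclidean_space) \<Rightarrow> (real^2 \<Rightarrow> 'b) \<Rightarrow> real" where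
  "l2_inner D f g = (LINT x|lebesgue_on D. f x \<bullet> g x)"

definition l2_sq :: "(real^2) set \<Rightarrow> (real^2 \<Rightarrow> 'b::euclidean_space) \<Rightarrow> real" where
  "l2_sq D f = (LINT x|lebesgue_on D. (norm (f x))\<^sup>2)"

definition L20 :: "(real^2) set \<Rightarrow> (real^2 \<Rightarrow> real) \<Rightarrow> bool" where
  "L20 D q \<longleftrightarrow> L2 D q \<and> (LINT x|lebesgue_on D. q x) = 0"

definition pd :: "2 \<Rightarrow> (real^2 \<Rightarrow> real) \<Rightarrow> real^2 \<Rightarrow> real" where
  "pd j f x = frechet_derivative f (at x) (axis j 1)"

primrec C_k :: "nat \<Rightarrow> (real^2 \<Rightarrow> real) \<Rightarrow> bool" where
  "C_k 0 f \<longleftrightarrow> continuous_on UNIV f"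
| "C_k (Suc k) f \<longleftrightarrow> (\<forall>x. f differentiable (at x)) \<and> (\<forall>j. C_k k (pd j f))"

definition smooth :: "(real^2 \<Rightarrow> real) \<Rightarrow> bool" where
  "smooth f \<longleftrightarrow> (\<forall>k. C_k k f)"

definition test_fun :: "(real^2) set \<Rightarrow> (real^2 \<Rightarrow> real) \<Rightarrow> bool" where
  "test_fun U \<phi> \<longleftrightarrow> smooth \<phi> \<and> (\<exists>K. compact K \<and> K \<subseteq> U \<and> (\<forall>x. x \<notin> K \<longrightarrow> \<phi> x = 0))"

definition weak_pd :: "(real^2) set \<Rightarrow> 2 \<Rightarrow> (real^2 \<Rightarrow> real) \<Rightarrow> (real^2 \<Rightarrow> real) \<Rightarrow> bool" where
  "weak_pd U j f g \<longleftrightarrow> (\<forall>\<phi>. test_fun U \<phi> \<longrightarrow>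
     (LINT x|lebesgue_on U. f x * pd j \<phi> x) = - (LINT x|lebesgue_on U. g x * \<phi> x))"

definition H1 :: "(real^2) set \<Rightarrow> (real^2 \<Rightarrow> real^2) \<Rightarrow> bool" where
  "H1 U v \<longleftrightarrow> (\<forall>i. L2 U (\<lambda>x. v x $ i)
     \<and> (\<forall>j. \<exists>g. L2 U g \<and> weak_pd U j (\<lambda>x. v x $ i) g))"

definition wpd :: "(real^2) set \<Rightarrow> 2 \<Rightarrow> (real^2 \<Rightarrow> real) \<Rightarrow> real^2 \<Rightarrow> real" where
  "wpd U j f = (SOME g. L2 U g \<and> weak_pd U j f g)"

text \<open>The weak gradient, with entry (i,j) the j-th derivative of the i-th component.\<close>

definition grad :: "(real^2) set \<Rightarrow> (real^2 \<Rightarrow> real^2) \<Rightarrow> real^2 \<Rightarrow> real^2^2" where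
  "grad U v x = (\<chi> i j. wpd U j (\<lambda>y. v y $ i) x)"

definition divg :: "(real^2) set \<Rightarrow> (real^2 \<Rightarrow> real^2) \<Rightarrow> real^2 \<Rightarrow> real" where
  "divg U v x = trace (grad U v x)"

definition h1_sq :: "(real^2) set \<Rightarrow> (real^2 \<Rightarrow> real^2) \<Rightarrow> real" where
  "h1_sq U v = l2_sq U v + l2_sq U (grad U v)"

definition H10 :: "(real^2) set \<Rightarrow> (real^2 \<Rightarrow> real^2) \<Rightarrow> bool" where
  "H10 U v \<longleftrightarrow> H1 U v \<and> (\<exists>\<phi>::nat \<Rightarrow> real^2 \<Rightarrow> real^2.
     (\<forall>n i. test_fun U (\<lambda>x. \<phi> n x $ i)) \<and> (\<lambda>n. h1_sq U (\<lambda>x. \<phi> n x - v x)) \<longlonglongrightarrow> 0)"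

definition weak_div :: "(real^2) set \<Rightarrow> (real^2 \<Rightarrow> real^2) \<Rightarrow> (real^2 \<Rightarrow> real) \<Rightarrow> bool" where
  "weak_div U w g \<longleftrightarrow> (\<forall>\<phi>. test_fun U \<phi> \<longrightarrow>
     (LINT x|lebesgue_on U. w x \<bullet> (\<chi> j. pd j \<phi> x)) = - (LINT x|lebesgue_on U. g x * \<phi> x))"


section \<open>The continuous problem\<close>

definition convex_polygonal_domain :: "(real^2) set \<Rightarrow> bool" where
  "convex_polygonal_domain \<Omega> \<longleftrightarrow> open \<Omega> \<and> \<Omega> \<noteq> {} \<and> convex \<Omega> \<and> polytope (closure \<Omega>)"

definition spd :: "real^2^2 \<Rightarrow> bool" where
  "spd A \<longleftrightarrow> transpose A = A \<and> (\<forall>x. x \<noteq> 0 \<longrightarrow> x \<bullet> (A *v x) > 0)"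

definition inv_sqrt :: "real^2^2 \<Rightarrow> real^2^2" where
  "inv_sqrt A = (THE B. spd B \<and> B ** B = matrix_inv A)"

definition permeability :: "(real^2) set \<Rightarrow> (real^2 \<Rightarrow> real^2^2) \<Rightarrow> bool" where
  "permeability \<Omega> \<kappa> \<longleftrightarrow> \<kappa> \<in> borel_measurable (lebesgue_on \<Omega>) \<and> (\<forall>x\<in>\<Omega>. spd (\<kappa> x))
     \<and> (\<exists>B. AE x in lebesgue_on \<Omega>. norm (inv_sqrt (\<kappa> x)) \<le> B)"

definition energy_sq :: "(real^2 \<Rightarrow> real^2^2) \<Rightarrow> (real^2) set \<Rightarrow> (real^2 \<Rightarrow> real^2) \<Rightarrow> real" where
  "energy_sq \<kappa> U v = l2_sq U (grad U v) + l2_sq U (\<lambda>x. inv_sqrt (\<kappa> x) *v v x)"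

definition a_form :: "(real^2) set \<Rightarrow> (real^2 \<Rightarrow> real^2^2) \<Rightarrow> (real^2 \<Rightarrow> real^2) \<Rightarrow> (real^2 \<Rightarrow> real^2) \<Rightarrow> real" where
  "a_form \<Omega> \<kappa> u v =
     (LINT x|lebesgue_on \<Omega>. grad \<Omega> u x \<bullet> grad \<Omega> v x + (matrix_inv (\<kappa> x) *v u x) \<bullet> v x)"

definition b_form :: "(real^2) set \<Rightarrow> (real^2 \<Rightarrow> real^2) \<Rightarrow> (real^2 \<Rightarrow> real) \<Rightarrow> real" where
  "b_form \<Omega> v q = (LINT x|lebesgue_on \<Omega>. q x * divg \<Omega> v x)"

definition continuous_solution ::
  "(real^2) set \<Rightarrow> (real^2 \<Rightarrow> real^2^2) \<Rightarrow> real \<Rightarrow> (real^2 \<Rightarrow> real^2) \<Rightarrow> (real^2 \<Rightarrow> real^2) \<Rightarrow> (real^2 \<Rightarrow> real) \<Rightarrow> bool" where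
  "continuous_solution \<Omega> \<kappa> \<nu> f u p \<longleftrightarrow> H10 \<Omega> u \<and> L20 \<Omega> p
     \<and> (\<forall>v. H10 \<Omega> v \<longrightarrow> \<nu> * a_form \<Omega> \<kappa> u v + b_form \<Omega> v p = l2_inner \<Omega> f v)
     \<and> (\<forall>q. L20 \<Omega> q \<longrightarrow> b_form \<Omega> u q = 0)"


section \<open>Polygons and meshes\<close>

text \<open>
  A polygon is given by the cyclic list of its vertices (straight angles are allowed), and an edge
  by the set of its two end points.
\<close>

type_synonym polygon = "(real^2) list"
type_synonym edge = "(real^2) set"

definition edges :: "polygon \<Rightarrow> edge set" where
  "edges E = {{E ! i, E ! (Suc i mod length E)} | i. i < length E}"

definition bdry :: "polygon \<Rightarrow> (real^2) set" where
  "bdry E = (\<Union>e\<in>edges E. convex hull e)"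

definition simple_polygon :: "polygon \<Rightarrow> bool" where
  "simple_polygon E \<longleftrightarrow> length E \<ge> 3 \<and> distinct E
     \<and> (\<forall>e\<in>edges E. \<forall>e'\<in>edges E. e \<noteq> e' \<longrightarrow> convex hull e \<inter> convex hull e' = e \<inter> e')"

definition cell :: "polygon \<Rightarrow> (real^2) set" where
  "cell E = inside (bdry E)"

definition closed_cell :: "polygon \<Rightarrow> (real^2) set" where
  "closed_cell E = cell E \<union> bdry E"

definition elem_diam :: "polygon \<Rightarrow> real" where
  "elem_diam E = diameter (closed_cell E)"

definition edge_len :: "edge \<Rightarrow> real" where
  "edge_len e = diameter e"

definition star_shaped_wrt :: "(real^2) set \<Rightarrow> (real^2) set \<Rightarrow> bool" where
  "star_shaped_wrt S B \<longleftrightarrow> (\<forall>y\<in>B. \<forall>z\<in>S. closed_segment y z \<subseteq> S)"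

text \<open>
  \<open>Tri E\<close> is the set of (closed) triangles into which the element E is split. Since the triangles
  of all elements form one conforming triangulation, elements meet along common vertices and edges.
\<close>

definition polygonal_mesh ::
  "(real^2) set \<Rightarrow> polygon set \<Rightarrow> (polygon \<Rightarrow> (real^2) set set) \<Rightarrow> bool" where
  "polygonal_mesh \<Omega> M Tri \<longleftrightarrow> finite M
     \<and> (\<forall>E\<in>M. simple_polygon E)
     \<and> (\<Union>E\<in>M. closed_cell E) = closure \<Omega>
     \<and> (\<forall>E\<in>M. \<forall>E'\<in>M. E \<noteq> E' \<longrightarrow> cell E \<inter> cell E' = {})
     \<and> (\<forall>E\<in>M. finite (Tri E) \<and> card (Tri E) = length E - 2 \<and> \<Union>(Tri E) = closed_cell E
          \<and> (\<forall>T\<in>Tri E. 2 simplex T \<and> {x. x extreme_point_of T} \<subseteq> set E))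
     \<and> triangulation (\<Union>E\<in>M. Tri E)"

definition mesh_regular :: "real \<Rightarrow> polygon set \<Rightarrow> bool" where
  "mesh_regular \<rho> M \<longleftrightarrow> (\<forall>E\<in>M.
     Min (edge_len ` edges E) / elem_diam E > \<rho>
     \<and> (\<exists>xE\<in>closed_cell E. star_shaped_wrt (closed_cell E) (ball xE (\<rho> * elem_diam E))))"

definition shape_regular :: "real \<Rightarrow> (real^2) set set \<Rightarrow> bool" where
  "shape_regular \<sigma> Ts \<longleftrightarrow> (\<forall>T\<in>Ts. \<exists>c. ball c (\<sigma> * diameter T) \<subseteq> T)"

definition elems_at :: "polygon set \<Rightarrow> edge \<Rightarrow> polygon set" where
  "elems_at M e = {E\<in>M. e \<in> edges E}"

definition interior_edges :: "polygon set \<Rightarrow> edge set" where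
  "interior_edges M = {e. card (elems_at M e) = 2}"


section \<open>Edge integrals and traces\<close>

definition perp :: "real^2 \<Rightarrow> real^2" where
  "perp x = vector [x $ 2, - (x $ 1)]"

text \<open>The direction of tangent and normal is chosen arbitrarily; nothing below depends on it.\<close>

definition edge_tangent :: "edge \<Rightarrow> real^2" where
  "edge_tangent e = (SOME t. norm t = 1 \<and> (\<forall>a\<in>e. \<forall>b\<in>e. \<exists>r. b - a = r *\<^sub>R t))"

definition edge_normal :: "edge \<Rightarrow> real^2" where
  "edge_normal e = perp (edge_tangent e)"

definition edge_param :: "edge \<Rightarrow> real \<Rightarrow> real^2" where
  "edge_param e = (SOME \<gamma>. \<exists>a b. e = {a, b} \<and> \<gamma> = linepath a b)"

definition edge_integral :: "edge \<Rightarrow> (real^2 \<Rightarrow> real) \<Rightarrow> real" where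
  "edge_integral e g = edge_len e * (LINT t|lebesgue_on {0..1}. g (edge_param e t))"

definition edge_sq :: "edge \<Rightarrow> (real^2 \<Rightarrow> real^2) \<Rightarrow> real" where
  "edge_sq e g = edge_integral e (\<lambda>x. (norm (g x))\<^sup>2)"

definition L2_edge :: "edge \<Rightarrow> (real^2 \<Rightarrow> real^2) \<Rightarrow> bool" where
  "L2_edge e g \<longleftrightarrow> (\<lambda>t. g (edge_param e t)) \<in> borel_measurable (lebesgue_on {0..1})
     \<and> integrable (lebesgue_on {0..1}) (\<lambda>t. (norm (g (edge_param e t)))\<^sup>2)"

text \<open>The trace operator is the extension by continuity of the restriction of smooth functions.\<close>

definition has_trace :: "polygon \<Rightarrow> (real^2 \<Rightarrow> real^2) \<Rightarrow> (real^2 \<Rightarrow> real^2) \<Rightarrow> bool" where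
  "has_trace E v g \<longleftrightarrow> (\<forall>e\<in>edges E. L2_edge e g)
     \<and> (\<exists>\<phi>::nat \<Rightarrow> real^2 \<Rightarrow> real^2. (\<forall>n i. smooth (\<lambda>x. \<phi> n x $ i))
          \<and> (\<lambda>n. h1_sq (cell E) (\<lambda>x. \<phi> n x - v x)) \<longlonglongrightarrow> 0
          \<and> (\<forall>e\<in>edges E. (\<lambda>n. edge_sq e (\<lambda>x. \<phi> n x - g x)) \<longlonglongrightarrow> 0))"

text \<open>
  The continuous representative is chosen whenever there is one, so that vertex values make sense.
\<close>

definition btrace :: "polygon \<Rightarrow> (real^2 \<Rightarrow> real^2) \<Rightarrow> real^2 \<Rightarrow> real^2" where
  "btrace E v = (SOME g. has_trace E v g \<and>
     ((\<exists>g'. has_trace E v g' \<and> continuous_on (bdry E) g') \<longrightarrow> continuous_on (bdry E) g))"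


section \<open>Virtual element spaces\<close>

definition ae_const :: "(real^2) set \<Rightarrow> (real^2 \<Rightarrow> real) \<Rightarrow> real \<Rightarrow> bool" where
  "ae_const U q c \<longleftrightarrow> (AE x in lebesgue_on U. q x = c)"

definition P1 :: "(real^2 \<Rightarrow> real^2) \<Rightarrow> bool" where
  "P1 p \<longleftrightarrow> (\<exists>c (A::real^2^2). p = (\<lambda>x. c + A *v x))"

text \<open>Polynomials on an edge are polynomials in the arc length.\<close>

definition P_edge :: "nat \<Rightarrow> edge \<Rightarrow> (real^2 \<Rightarrow> real) \<Rightarrow> bool" where
  "P_edge k e g \<longleftrightarrow> (\<exists>p::real poly. degree p \<le> k \<and>
     (\<forall>x\<in>convex hull e. g x = poly p (x \<bullet> edge_tangent e)))"

definition B1 :: "polygon \<Rightarrow> (real^2 \<Rightarrow> real^2) \<Rightarrow> bool" where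
  "B1 E g \<longleftrightarrow> continuous_on (bdry E) g \<and> (\<forall>e\<in>edges E.
     P_edge 2 e (\<lambda>x. g x \<bullet> edge_normal e) \<and> P_edge 1 e (\<lambda>x. g x \<bullet> edge_tangent e))"

text \<open>
  The condition on \<open>\<Delta>v - \<nabla>s\<close> is understood in the sense of distributions on the open polygon.
\<close>

definition U_hat :: "polygon \<Rightarrow> (real^2 \<Rightarrow> real^2) \<Rightarrow> bool" where
  "U_hat E v \<longleftrightarrow> H1 (cell E) v
     \<and> (\<exists>g. has_trace E v g \<and> B1 E g)
     \<and> (\<exists>c. ae_const (cell E) (divg (cell E) v) c)
     \<and> (\<exists>s. L2 (cell E) s \<and> (\<exists>c::real. \<forall>\<phi>. (\<forall>i. test_fun (cell E) (\<lambda>x. \<phi> x $ i)) \<longrightarrow>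
          - l2_inner (cell E) (grad (cell E) v) (\<lambda>x. jacobian \<phi> (at x))
            + l2_inner (cell E) s (\<lambda>x. trace (jacobian \<phi> (at x)))
          = l2_inner (cell E) (\<lambda>x. c *\<^sub>R perp x) \<phi>))"

definition vertex_mean :: "polygon \<Rightarrow> (real^2 \<Rightarrow> real^2) \<Rightarrow> real^2" where
  "vertex_mean E g = (1 / real (length E)) *\<^sub>R (\<Sum>x\<leftarrow>E. g x)"

definition proj_grad :: "polygon \<Rightarrow> (real^2 \<Rightarrow> real^2) \<Rightarrow> real^2 \<Rightarrow> real^2" where
  "proj_grad E v = (THE p. P1 p
     \<and> (\<forall>q. P1 q \<longrightarrow> l2_inner (cell E) (grad (cell E) (\<lambda>x. v x - p x)) (grad (cell E) q) = 0)
     \<and> vertex_mean E (btrace E v) = vertex_mean E p)"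

definition VE :: "polygon \<Rightarrow> (real^2 \<Rightarrow> real^2) \<Rightarrow> bool" where
  "VE E v \<longleftrightarrow> U_hat E v
     \<and> (\<forall>c::real. l2_inner (cell E) (\<lambda>x. v x - proj_grad E v x) (\<lambda>x. c *\<^sub>R perp x) = 0)"

definition proj_L2 :: "polygon \<Rightarrow> (real^2 \<Rightarrow> real^2) \<Rightarrow> real^2 \<Rightarrow> real^2" where
  "proj_L2 E v = (THE p. P1 p
     \<and> (\<forall>q. P1 q \<longrightarrow> l2_inner (cell E) (\<lambda>x. v x - p x) q = 0))"

definition proj_mat :: "polygon \<Rightarrow> (real^2 \<Rightarrow> real^2^2) \<Rightarrow> real^2^2" where
  "proj_mat E G = (THE A. \<forall>B. l2_inner (cell E) (\<lambda>x. G x - A) (\<lambda>x. B) = 0)"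

definition Vh :: "(real^2) set \<Rightarrow> polygon set \<Rightarrow> (real^2 \<Rightarrow> real^2) \<Rightarrow> bool" where
  "Vh \<Omega> M v \<longleftrightarrow> H10 \<Omega> v \<and> (\<forall>E\<in>M. VE E v)"

definition Qh :: "(real^2) set \<Rightarrow> polygon set \<Rightarrow> (real^2 \<Rightarrow> real) \<Rightarrow> bool" where
  "Qh \<Omega> M q \<longleftrightarrow> L20 \<Omega> q \<and> (\<forall>E\<in>M. \<exists>c. ae_const (cell E) q c)"


section \<open>Reconstruction operator\<close>

definition RT0 :: "(real^2 \<Rightarrow> real^2) \<Rightarrow> bool" where
  "RT0 r \<longleftrightarrow> (\<exists>a (c::real). r = (\<lambda>x. a + c *\<^sub>R x))"

text \<open>
  \<open>r T\<close> is the Raviart--Thomas field whose restriction to T is \<open>w\<close>. The edge values of \<open>w\<close> on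
  \<open>e\<close>, seen from E, are those of \<open>r T\<close> for the triangle T of E that has \<open>e\<close> as a side.
\<close>

definition is_reconstruction ::
  "(real^2) set \<Rightarrow> polygon set \<Rightarrow> (polygon \<Rightarrow> (real^2) set set) \<Rightarrow> (real^2 \<Rightarrow> real^2) \<Rightarrow> (real^2 \<Rightarrow> real^2) \<Rightarrow> bool" where
  "is_reconstruction \<Omega> M Tri v w \<longleftrightarrow> L2 \<Omega> w
     \<and> (\<exists>g. L2 \<Omega> g \<and> weak_div \<Omega> w g \<and> (\<forall>E\<in>M. \<exists>c. ae_const (cell E) g c))
     \<and> (\<exists>r. \<forall>E\<in>M. \<forall>T\<in>Tri E. RT0 (r T) \<and> (AE x in lebesgue_on T. w x = r T x)
          \<and> (\<forall>e\<in>edges E. e \<subseteq> T \<longrightarrow>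
               edge_integral e (\<lambda>x. r T x \<bullet> edge_normal e)
                 = edge_integral e (\<lambda>x. btrace E v x \<bullet> edge_normal e)))"

definition Rh ::
  "(real^2) set \<Rightarrow> polygon set \<Rightarrow> (polygon \<Rightarrow> (real^2) set set) \<Rightarrow> (real^2 \<Rightarrow> real^2) \<Rightarrow> real^2 \<Rightarrow> real^2" where
  "Rh \<Omega> M Tri v = (SOME w. is_reconstruction \<Omega> M Tri v w)"


section \<open>The discrete problem\<close>

type_synonym stab_form = "polygon \<Rightarrow> (real^2 \<Rightarrow> real^2) \<Rightarrow> (real^2 \<Rightarrow> real^2) \<Rightarrow> real"

definition sym_bilinear_on ::
  "((real^2 \<Rightarrow> real^2) \<Rightarrow> bool) \<Rightarrow> ((real^2 \<Rightarrow> real^2) \<Rightarrow> (real^2 \<Rightarrow> real^2) \<Rightarrow> real) \<Rightarrow> bool" where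
  "sym_bilinear_on W S \<longleftrightarrow> (\<forall>v w. W v \<longrightarrow> W w \<longrightarrow> S v w = S w v)
     \<and> (\<forall>v v' w (a::real) b. W v \<longrightarrow> W v' \<longrightarrow> W w \<longrightarrow>
          S (\<lambda>x. a *\<^sub>R v x + b *\<^sub>R v' x) w = a * S v w + b * S v' w)"

definition grad_stabilizer :: "real \<Rightarrow> real \<Rightarrow> polygon set \<Rightarrow> stab_form \<Rightarrow> bool" where
  "grad_stabilizer C1 C2 M S \<longleftrightarrow> (\<forall>E\<in>M. sym_bilinear_on (VE E) (S E)
     \<and> (\<forall>v. VE E v \<longrightarrow> proj_grad E v = (\<lambda>x. 0) \<longrightarrow>
          C1 * l2_sq (cell E) (grad (cell E) v) \<le> S E v v
          \<and> S E v v \<le> C2 * l2_sq (cell E) (grad (cell E) v)))"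

definition mass_stabilizer ::
  "(real^2 \<Rightarrow> real^2^2) \<Rightarrow> real \<Rightarrow> real \<Rightarrow> polygon set \<Rightarrow> stab_form \<Rightarrow> bool" where
  "mass_stabilizer \<kappa> C1 C2 M S \<longleftrightarrow> (\<forall>E\<in>M. sym_bilinear_on (VE E) (S E)
     \<and> (\<forall>v. VE E v \<longrightarrow> proj_L2 E v = (\<lambda>x. 0) \<longrightarrow>
          C1 * l2_sq (cell E) (\<lambda>x. inv_sqrt (\<kappa> x) *v v x) \<le> S E v v
          \<and> S E v v \<le> C2 * l2_sq (cell E) (\<lambda>x. inv_sqrt (\<kappa> x) *v v x)))"

definition ah ::
  "(real^2 \<Rightarrow> real^2^2) \<Rightarrow> polygon set \<Rightarrow> stab_form \<Rightarrow> stab_form \<Rightarrow> (real^2 \<Rightarrow> real^2) \<Rightarrow> (real^2 \<Rightarrow> real^2) \<Rightarrow> real" where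
  "ah \<kappa> M S1 S0 w v = (\<Sum>E\<in>M.
     l2_inner (cell E) (\<lambda>x. proj_mat E (grad (cell E) w)) (\<lambda>x. proj_mat E (grad (cell E) v))
     + S1 E (\<lambda>x. w x - proj_grad E w x) (\<lambda>x. v x - proj_grad E v x)
     + l2_inner (cell E) (\<lambda>x. matrix_inv (\<kappa> x) *v proj_L2 E w x) (proj_L2 E v)
     + S0 E (\<lambda>x. w x - proj_L2 E w x) (\<lambda>x. v x - proj_L2 E v x))"

definition discrete_solution ::
  "(real^2) set \<Rightarrow> (real^2 \<Rightarrow> real^2^2) \<Rightarrow> polygon set \<Rightarrow> (polygon \<Rightarrow> (real^2) set set) \<Rightarrow>
   stab_form \<Rightarrow> stab_form \<Rightarrow> real \<Rightarrow> (real^2 \<Rightarrow> real^2) \<Rightarrow> (real^2 \<Rightarrow> real^2) \<Rightarrow> (real^2 \<Rightarrow> real) \<Rightarrow> bool" where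
  "discrete_solution \<Omega> \<kappa> M Tri S1 S0 \<nu> f uh ph \<longleftrightarrow> Vh \<Omega> M uh \<and> Qh \<Omega> M ph
     \<and> (\<forall>v. Vh \<Omega> M v \<longrightarrow>
          \<nu> * ah \<kappa> M S1 S0 uh v + b_form \<Omega> v ph = l2_inner \<Omega> f (Rh \<Omega> M Tri v))
     \<and> (\<forall>q. Qh \<Omega> M q \<longrightarrow> b_form \<Omega> uh q = 0)"


section \<open>The estimator (all quantities squared)\<close>

definition cell_value :: "polygon \<Rightarrow> (real^2 \<Rightarrow> real) \<Rightarrow> real" where
  "cell_value E q = (THE c. ae_const (cell E) q c)"

definition stress ::
  "real \<Rightarrow> (real^2 \<Rightarrow> real^2) \<Rightarrow> (real^2 \<Rightarrow> real) \<Rightarrow> polygon \<Rightarrow> real^2 \<Rightarrow> real^2^2" where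
  "stress \<nu> uh ph E x = \<nu> *\<^sub>R jacobian (proj_grad E uh) (at x) - cell_value E ph *\<^sub>R mat 1"

text \<open>The sign of the jump depends on the order of the two elements, its norm does not.\<close>

definition normal_jump ::
  "polygon set \<Rightarrow> (polygon \<Rightarrow> real^2 \<Rightarrow> real^2^2) \<Rightarrow> edge \<Rightarrow> real^2 \<Rightarrow> real^2" where
  "normal_jump M F e x =
     (case (SOME (E, E'). E \<noteq> E' \<and> elems_at M e = {E, E'}) of
        (E, E') \<Rightarrow> (F E x - F E' x) *v edge_normal e)"

definition eta_kappa_sq :: "(real^2 \<Rightarrow> real^2^2) \<Rightarrow> real \<Rightarrow> (real^2 \<Rightarrow> real^2) \<Rightarrow> polygon \<Rightarrow> real" where
  "eta_kappa_sq \<kappa> \<nu> uh E =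
     \<nu>\<^sup>2 * (elem_diam E)\<^sup>2 * l2_sq (cell E) (\<lambda>x. matrix_inv (\<kappa> x) *v proj_L2 E uh x)"

definition eta_r_sq ::
  "(real^2 \<Rightarrow> real^2^2) \<Rightarrow> polygon set \<Rightarrow> real \<Rightarrow> (real^2 \<Rightarrow> real^2) \<Rightarrow> (real^2 \<Rightarrow> real) \<Rightarrow> polygon \<Rightarrow> real" where
  "eta_r_sq \<kappa> M \<nu> uh ph E = eta_kappa_sq \<kappa> \<nu> uh E
     + 1/2 * (\<Sum>e \<in> interior_edges M \<inter> edges E.
                edge_len e * edge_sq e (normal_jump M (stress \<nu> uh ph) e))"

definition eta_f_sq :: "(real^2 \<Rightarrow> real^2) \<Rightarrow> polygon \<Rightarrow> real" where
  "eta_f_sq f E = (elem_diam E)\<^sup>2 * l2_sq (cell E) f"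

definition eta_S_sq ::
  "stab_form \<Rightarrow> stab_form \<Rightarrow> real \<Rightarrow> (real^2 \<Rightarrow> real^2) \<Rightarrow> polygon \<Rightarrow> real" where
  "eta_S_sq S1 S0 \<nu> uh E =
     \<nu>\<^sup>2 * S1 E (\<lambda>x. uh x - proj_grad E uh x) (\<lambda>x. uh x - proj_grad E uh x)
     + \<nu>\<^sup>2 * S0 E (\<lambda>x. uh x - proj_L2 E uh x) (\<lambda>x. uh x - proj_L2 E uh x)"

end

theory Submission
  imports Defs
begin

text \<open>
  Let \<open>e\<close> be an interior edge with neighbours \<open>E1\<close>, \<open>E2\<close> and unit normal \<open>N\<close>, and write \<open>[c]\<close> and \<open>[A]\<close>
  for the jumps of the cellwise constants \<open>p_h\<close> and \<open>\<nabla>\<Pi>u_h\<close>. By star-shapedness and disjointness of the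
  two elements, a disc of radius \<open>r\<close> comparable to the edge length around the midpoint of \<open>e\<close> is
  cut by \<open>e\<close> into a half in \<open>E1\<close> and a half in \<open>E2\<close>. Let \<open>\<phi>\<close> be a smooth bump on that disc. The
  integral of \<open>\<nabla>\<phi>\<close> over a half disc is a multiple of \<open>N\<close> of size at least a constant times \<open>r\<close>, so
  testing with \<open>\<phi>\<close> turns jumps into volume integrals.

  Testing the momentum equation with \<open>\<phi> w\<close> bounds \<open>\<nu>[A]N + [c]N\<close>. The estimator contains
  \<open>\<nu>[A]N - [c]N\<close> instead, so \<open>[c]\<close> has to be bounded by itself, that is, \<open>N \<bullet> [A]N\<close> has to be bounded;
  it is \<open>tr[A]\<close> minus the tangential-tangential entry of \<open>[A]\<close>. The former is small because the exact
  velocity is divergence free, the latter because its weak gradient has no tangential jump.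

  The coercivity of the stabilizations then replaces \<open>\<nabla>\<Pi>u_h\<close> by \<open>\<nabla>u_h\<close>. It applies because
  \<open>u_h - \<Pi>u_h\<close> lies in the kernel of \<open>\<Pi>\<close>, which rests on the uniqueness of continuous boundary traces.
\<close>

section \<open>Smooth functions and bumps\<close>

text \<open>At this lowest order the stress is constant on each side of \<open>e\<close>, so
  \<open>h_e\<close> times its squared edge norm is the squared length of \<open>e\<close> times
  that of a single vector \<open>J\<close>; bounding one vector is enough, and no inverse estimate
  for polynomials on edges is involved. The powers of \<open>r\<close> fix the form of the bound.
  The flux is of order \<open>r\<close>, the gradient of the bump of order \<open>1 / r\<close>, and
  Cauchy-Schwarz on the disc contributes a further \<open>r\<close>; hence \<open>r^2 |J|^2\<close>
  is controlled by the squared errors of gradient and pressure and by \<open>r^2\<close> times the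
  squared norm of the source f - \<nu> \<kappa>^-1 u. That weight suits f and the projected part of
  \<kappa>^-1 u_h. On the remaining parts of \<kappa>^-1 u it is spent on the diameter of \<Omega>,
  and one factor \<kappa>^-1/2 on its supremum, which is why both enter the constant. A second
  concern is that weak gradients, traces and projections are selected by choice or description. They
  are therefore handled through characterizing relations up to null sets, and the projections are
  computed explicitly.\<close>

lemma pd_eqI: "(f has_derivative f') (at x) \<Longrightarrow> pd j f x = f' (axis j 1)"
  unfolding pd_def using frechet_derivative_at by metis

lemma C_k_imp_continuous: "C_k k f \<Longrightarrow> continuous_on UNIV f"
  by (cases k) (auto intro!: differentiable_imp_continuous_on simp: differentiable_on_def)

lemma C_k_SucD: "C_k (Suc k) f \<Longrightarrow> C_k k f"
proof (induction k arbitrary: f)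
  case 0
  then show ?case using C_k_imp_continuous[of "Suc 0" f] by simp
next
  case (Suc k)
  have "\<forall>x. f differentiable (at x)" "C_k (Suc k) (pd j f)" for j
    using Suc.prems by auto
  then have "\<forall>x. f differentiable (at x)" "C_k k (pd j f)" for j
    using Suc.IH by auto
  then show ?case by simp
qed

lemma has_derivative_frechet: "f differentiable (at x) \<Longrightarrow> (f has_derivative frechet_derivative f (at x)) (at x)"
  by (simp add: frechet_derivative_works)

lemma pd_add:
  assumes "f differentiable (at x)" "g differentiable (at x)"
  shows "pd j (\<lambda>x. f x + g x) x = pd j f x + pd j g x"
  using pd_eqI[OF has_derivative_add[OF assms[THEN has_derivative_frechet]]] by (simp add: pd_def)

lemma pd_mult:
  assumes "f differentiable (at x)" "g differentiable (at x)"
  shows "pd j (\<lambda>x. f x * g x) x = f x * pd j g x + pd j f x * g x"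
  using pd_eqI[OF has_derivative_mult[OF assms[THEN has_derivative_frechet]]] by (simp add: pd_def)

lemma pd_const: "pd j (\<lambda>x. c) x = 0"
  by (rule pd_eqI[OF has_derivative_const])

lemma pd_component: "pd j (\<lambda>x. x $ i) x = (if i = j then 1 else 0)"
  by (subst pd_eqI[where f' = "\<lambda>x. x $ i"])
    (auto intro: bounded_linear_imp_has_derivative bounded_linear_vec_nth simp: axis_def)

lemma pd_compose:
  fixes h h' :: "real \<Rightarrow> real"
  assumes "(h has_real_derivative h' (f x)) (at (f x))" "f differentiable (at x)"
  shows "pd j (\<lambda>x. h (f x)) x = h' (f x) * pd j f x"
    and "(\<lambda>x. h (f x)) differentiable (at x)"
proof -
  have *: "((\<lambda>x. h (f x)) has_derivative (\<lambda>y. h' (f x) * frechet_derivative f (at x) y)) (at x)"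
    using has_derivative_compose[OF has_derivative_frechet[OF assms(2)], of h "(*) (h' (f x))"] assms(1)
    by (simp add: has_field_derivative_def)
  show "pd j (\<lambda>x. h (f x)) x = h' (f x) * pd j f x"
    using pd_eqI[OF *] by (simp add: pd_def)
  show "(\<lambda>x. h (f x)) differentiable (at x)"
    using * by (auto simp: differentiable_def)
qed

lemma C_k_const: "C_k k (\<lambda>x. c)"
  by (induction k arbitrary: c) (auto simp: pd_const[abs_def])

lemma C_k_component: "C_k k (\<lambda>x. x $ i)"
proof (cases k)
  case (Suc l)
  have "(\<lambda>x::real^2. x $ i) differentiable (at x)" for x
    using bounded_linear_imp_has_derivative[OF bounded_linear_vec_nth] unfolding differentiable_def by blast
  then show ?thesis
    using Suc by (simp add: pd_component[abs_def] C_k_const)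
qed (auto intro: continuous_intros)

lemma C_k_add: "C_k k f \<Longrightarrow> C_k k g \<Longrightarrow> C_k k (\<lambda>x. f x + g x)"
proof (induction k arbitrary: f g)
  case (Suc k)
  have "pd j (\<lambda>x. f x + g x) = (\<lambda>x. pd j f x + pd j g x)" for j
    using Suc.prems by (intro ext pd_add) auto
  then show ?case using Suc by auto
qed (auto intro: continuous_intros)

lemma C_k_mult: "C_k k f \<Longrightarrow> C_k k g \<Longrightarrow> C_k k (\<lambda>x. f x * g x)"
proof (induction k arbitrary: f g)
  case (Suc k)
  have "pd j (\<lambda>x. f x * g x) = (\<lambda>x. f x * pd j g x + pd j f x * g x)" for j
    using Suc.prems by (intro ext pd_mult) auto
  moreover have "C_k k f" "C_k k g" using Suc.prems C_k_SucD by blast+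
  ultimately show ?case using Suc by (auto intro!: C_k_add)
qed (auto intro: continuous_intros)

text \<open>The chain rule replaces \<open>h n\<close> by \<open>h (Suc n)\<close>, so the outer
  function comes with its whole tower of derivatives and the induction on \<open>k\<close> keeps
  \<open>n\<close> arbitrary.\<close>

lemma C_k_compose:
  fixes h :: "nat \<Rightarrow> real \<Rightarrow> real"
  assumes h: "\<And>n t. (h n has_real_derivative h (Suc n) t) (at t)"
  shows "C_k k f \<Longrightarrow> C_k k (\<lambda>x. h n (f x))"
proof (induction k arbitrary: n)
  case 0
  have "continuous_on UNIV (h n)"
    using h by (meson DERIV_isCont continuous_at_imp_continuous_on)
  then show ?case using 0
    by (auto intro: continuous_on_compose2)
next
  case (Suc k)
  have d: "f differentiable (at x)" for x using Suc.prems by auto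
  have "pd j (\<lambda>x. h n (f x)) = (\<lambda>x. h (Suc n) (f x) * pd j f x)" for j
    using pd_compose(1)[of "h n" "h (Suc n)" f, OF h d] by auto
  moreover have "C_k k (\<lambda>x. h (Suc n) (f x) * pd j f x)" for j
    using Suc.IH C_k_SucD[OF Suc.prems] Suc.prems by (intro C_k_mult) auto
  moreover have "(\<lambda>x. h n (f x)) differentiable (at x)" for x
    using pd_compose(2)[of "h n" "h (Suc n)" f, OF h d] by auto
  ultimately show ?case by simp
qed

lemma smooth_const [simp]: "smooth (\<lambda>x. c)"
  and smooth_component [simp]: "smooth (\<lambda>x. x $ i)"
  by (simp_all add: smooth_def C_k_const C_k_component)

lemma smooth_add: "smooth f \<Longrightarrow> smooth g \<Longrightarrow> smooth (\<lambda>x. f x + g x)"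
  and smooth_mult: "smooth f \<Longrightarrow> smooth g \<Longrightarrow> smooth (\<lambda>x. f x * g x)"
  by (simp_all add: smooth_def C_k_add C_k_mult)

lemma smooth_diff: "smooth f \<Longrightarrow> smooth g \<Longrightarrow> smooth (\<lambda>x. f x - g x)"
  using smooth_add[OF _ smooth_mult[OF smooth_const, of g "-1"], of f] by simp

lemma smooth_compose:
  fixes h :: "nat \<Rightarrow> real \<Rightarrow> real"
  assumes "\<And>n t. (h n has_real_derivative h (Suc n) t) (at t)" "smooth f"
  shows "smooth (\<lambda>x. h n (f x))"
  using C_k_compose[of h, OF assms(1)] assms(2) by (auto simp: smooth_def)

lemma smooth_differentiable: "smooth f \<Longrightarrow> f differentiable (at x)"
  unfolding smooth_def by (metis C_k.simps(2))

lemma smooth_pd: "smooth f \<Longrightarrow> smooth (pd j f)"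
  unfolding smooth_def by (metis C_k.simps(2))

lemma smooth_continuous: "smooth f \<Longrightarrow> continuous_on S f"
  unfolding smooth_def by (meson C_k_imp_continuous continuous_on_subset subset_UNIV)

lemma smooth_affine: "smooth (\<lambda>x. (c + A *v x) $ i)"
proof -
  have "(\<lambda>x::real^2. (c + A *v x) $ i) = (\<lambda>x. c $ i + (A $ i $ 1 * x $ 1 + A $ i $ 2 * x $ 2))"
    by (auto simp: matrix_vector_mult_def sum_2)
  then show ?thesis by (auto intro!: smooth_add smooth_mult)
qed

lemma has_derivative_affine_component:
  "((\<lambda>x. (c + A *v x) $ i) has_derivative (\<lambda>h. (A *v h) $ i)) (at (x :: real^2))"
proof -
  have "bounded_linear (\<lambda>h::real^2. (A *v h) $ i)"
    by (intro bounded_linear_compose[OF bounded_linear_vec_nth] matrix_vector_mul_bounded_linear)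
  then have "((\<lambda>x. c $ i + (A *v x) $ i) has_derivative (\<lambda>h. 0 + (A *v h) $ i)) (at x)"
    by (intro has_derivative_add has_derivative_const bounded_linear_imp_has_derivative)
  then show ?thesis by simp
qed

lemma pd_affine: "pd j (\<lambda>x. (c + A *v x) $ i) x = A $ i $ j"
  by (simp only: pd_eqI[OF has_derivative_affine_component] matrix_vector_mult_basis column_def vec_lambda_beta)

text \<open>With \<open>s = 1/t\<close>, the derivative of \<open>p(s) exp(-s)\<close> with respect
  to \<open>t\<close> is \<open>s^2 (p(s) - p'(s)) exp(-s)\<close>; the factor
  \<open>[:0, 0, 1:]\<close> is the polynomial \<open>s^2\<close>.\<close>

primrec bump_poly :: "nat \<Rightarrow> real poly" where
  "bump_poly 0 = 1"
| "bump_poly (Suc n) = [:0, 0, 1:] * (bump_poly n - pderiv (bump_poly n))"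

text \<open>\<open>bump n\<close> is the \<open>n\<close>-th derivative of the function \<open>bump 0\<close>, which is $e^{-1/t}$ for $t > 0$.\<close>

definition bump :: "nat \<Rightarrow> real \<Rightarrow> real" where
  "bump n t = (if t > 0 then poly (bump_poly n) (1 / t) * exp (- (1 / t)) else 0)"

text \<open>The free power \<open>k\<close> absorbs the shift that occurs when a coefficient is
  split off: \<open>x^k (a + x p) = a x^k + x^(k+1) p\<close>.\<close>

lemma poly_over_exp_tendsto_0:
  fixes p :: "real poly"
  shows "((\<lambda>x. x ^ k * poly p x / exp x) \<longlongrightarrow> 0) at_top"
proof (induction p arbitrary: k)
  case (pCons a p)
  have "((\<lambda>x. a * (x ^ k / exp x) + x ^ Suc k * poly p x / exp x) \<longlongrightarrow> a * 0 + 0) at_top"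
    by (intro tendsto_intros tendsto_power_div_exp_0 pCons.IH)
  then show ?case by (simp add: algebra_simps add_divide_distrib)
qed simp

lemma bump_has_derivative: "(bump n has_real_derivative bump (Suc n) t) (at t)"
proof -
  consider "t > 0" | "t < 0" | "t = 0" by linarith
  then show ?thesis
  proof cases
    case 1
    have "((\<lambda>t. poly (bump_poly n) (1 / t) * exp (- (1 / t))) has_real_derivative bump (Suc n) t) (at t)"
      using 1 by (auto intro!: derivative_eq_intros poly_DERIV[THEN DERIV_chain2] simp: bump_def field_simps power2_eq_square)
    moreover have "\<forall>\<^sub>F s in nhds t. poly (bump_poly n) (1 / s) * exp (- (1 / s)) = bump n s"
      using 1 eventually_nhds_in_open[of "{0<..}" t]
      by (auto elim!: eventually_mono simp: bump_def)
    ultimately show ?thesis by (rule iffD1[OF DERIV_cong_ev[OF refl _ refl], rotated])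
  next
    case 2
    have "((\<lambda>t. 0) has_real_derivative bump (Suc n) t) (at t)"
      using 2 by (auto simp: bump_def)
    moreover have "\<forall>\<^sub>F s in nhds t. 0 = bump n s"
      using 2 eventually_nhds_in_open[of "{..<0}" t]
      by (auto elim!: eventually_mono simp: bump_def)
    ultimately show ?thesis by (rule iffD1[OF DERIV_cong_ev[OF refl _ refl], rotated])
  next
    case 3
    \<comment> \<open>At the origin the difference quotient from the right is
      \<open>s p(s) exp(-s)\<close> with \<open>s = 1/h\<close> tending to infinity; from the left
      it is identically 0.\<close>
    have "((\<lambda>h. (1/h) ^ 1 * poly (bump_poly n) (1/h) / exp (1/h)) \<longlongrightarrow> 0) (at_right (0::real))"
      by (rule filterlim_compose[OF poly_over_exp_tendsto_0])
        (simp add: divide_inverse filterlim_inverse_at_top_right)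
    moreover have "\<forall>\<^sub>F h in at_right 0. (1/h) ^ 1 * poly (bump_poly n) (1/h) / exp (1/h) = bump n h / h"
      by (intro eventually_at_rightI[of 0 1]) (simp_all add: bump_def exp_minus divide_inverse mult.commute)
    ultimately have "((\<lambda>h. bump n h / h) \<longlongrightarrow> 0) (at_right 0)"
      using tendsto_cong by fast
    moreover have "((\<lambda>h. bump n h / h) \<longlongrightarrow> 0) (at_left 0)"
      by (rule tendsto_eventually) (auto simp: bump_def intro!: eventually_at_leftI[of "-1" 0])
    ultimately have "((\<lambda>h. bump n h / h) \<longlongrightarrow> 0) (at 0)"
      by (simp add: filterlim_split_at)
    then show ?thesis using 3 by (simp add: DERIV_def bump_def)
  qed
qed

lemma smooth_bump: "smooth f \<Longrightarrow> smooth (\<lambda>x. bump n (f x))"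
  by (rule smooth_compose[of bump, OF bump_has_derivative])

lemma bump_0_eq: "bump 0 t = (if t > 0 then exp (- (1 / t)) else 0)"
  and bump_1_eq: "bump (Suc 0) t = (if t > 0 then exp (- (1 / t)) / t\<^sup>2 else 0)"
  by (auto simp: bump_def power2_eq_square)

lemma bump_0_bounds: "0 \<le> bump 0 t" "bump 0 t \<le> 1"
  by (auto simp: bump_0_eq)

lemma bump_nonpos: "t \<le> 0 \<Longrightarrow> bump n t = 0"
  by (simp add: bump_def)

lemma continuous_bump: "continuous_on S (bump n)"
  using bump_has_derivative by (meson DERIV_isCont continuous_at_imp_continuous_on)

section \<open>Test functions and the two kinds of bumps\<close>

lemma test_fun_bounded:
  assumes "test_fun U \<phi>" obtains B where "\<And>x. \<bar>\<phi> x\<bar> \<le> B" "B \<ge> 0"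
proof -
  from assms obtain K where K: "compact K" "\<And>x. x \<notin> K \<Longrightarrow> \<phi> x = 0" and s: "smooth \<phi>"
    by (auto simp: test_fun_def)
  have "bounded (\<phi> ` K)"
    using compact_continuous_image[OF smooth_continuous[OF s] K(1)] compact_imp_bounded by blast
  then obtain B where B: "\<And>x. x \<in> K \<Longrightarrow> \<bar>\<phi> x\<bar> \<le> B"
    by (auto simp: bounded_iff)
  have "\<bar>\<phi> x\<bar> \<le> max B 0" for x
    using B[of x] K(2)[of x] by (cases "x \<in> K") auto
  then show thesis using that by fastforce
qed

lemma pd_zero_outside:
  assumes "closed K" "\<And>x. x \<notin> K \<Longrightarrow> \<phi> x = 0" "x \<notin> K"
  shows "pd j \<phi> x = 0"
proof -
  have "(\<phi> has_derivative (\<lambda>_. 0)) (at x)"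
  proof (rule has_derivative_transform_within_open[of "\<lambda>_. 0"])
    show "open (-K)" using assms by auto
  qed (use assms in auto)
  then show ?thesis by (rule pd_eqI)
qed

lemma test_fun_pd: "test_fun U \<phi> \<Longrightarrow> test_fun U (pd j \<phi>)"
proof -
  assume "test_fun U \<phi>"
  then obtain K where K: "compact K" "K \<subseteq> U" "\<And>x. x \<notin> K \<Longrightarrow> \<phi> x = 0" "smooth \<phi>"
    by (auto simp: test_fun_def)
  then show ?thesis
    unfolding test_fun_def
    using smooth_pd[OF K(4)] pd_zero_outside[OF compact_imp_closed[OF K(1)] K(3)] by (intro conjI exI[of _ K]) auto
qed

lemma test_funI: "smooth \<phi> \<Longrightarrow> compact K \<Longrightarrow> K \<subseteq> U \<Longrightarrow> (\<And>x. x \<notin> K \<Longrightarrow> \<phi> x = 0) \<Longrightarrow> test_fun U \<phi>"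
  unfolding test_fun_def by blast

lemma test_funE:
  assumes "test_fun U \<phi>"
  obtains K where "smooth \<phi>" "compact K" "K \<subseteq> U" "\<And>x. x \<notin> K \<Longrightarrow> \<phi> x = 0"
  using assms unfolding test_fun_def by blast

lemma test_fun_mult:
  assumes "test_fun U \<phi>" "smooth \<psi>" shows "test_fun U (\<lambda>x. \<phi> x * \<psi> x)"
  using assms(1)
proof (rule test_funE)
  fix K assume K: "smooth \<phi>" "compact K" "K \<subseteq> U" "\<And>x. x \<notin> K \<Longrightarrow> \<phi> x = 0"
  show ?thesis
    by (rule test_funI[OF smooth_mult[OF K(1) assms(2)] K(2,3)]) (simp add: K(4))
qed

lemma test_fun_mono: "test_fun U \<phi> \<Longrightarrow> U \<subseteq> V \<Longrightarrow> test_fun V \<phi>"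
  by (erule test_funE, rule test_funI) (assumption+, blast+)

lemma test_fun_outside: "test_fun U \<phi> \<Longrightarrow> x \<notin> U \<Longrightarrow> \<phi> x = 0"
  unfolding test_fun_def by blast

text \<open>A product of one-dimensional bumps with values in [0,1] and support in the closed box.
  As \<open>k\<close> grows it tends to the indicator of the open box, so dominated convergence can
  trade test functions for indicators.\<close>

definition box_bump :: "real^2 \<Rightarrow> real^2 \<Rightarrow> real \<Rightarrow> real^2 \<Rightarrow> real" where
  "box_bump a b k x = (\<Prod>j\<in>UNIV. bump 0 (k * (x $ j - a $ j)) * bump 0 (k * (b $ j - x $ j)))"

lemma test_fun_box_bump:
  assumes "cbox a b \<subseteq> U" "k > 0" shows "test_fun U (box_bump a b k)"
proof -
  have "box_bump a b k x = 0" if x: "x \<notin> cbox a b" for x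
  proof -
    obtain j where "x $ j - a $ j \<le> 0 \<or> b $ j - x $ j \<le> 0"
      using x unfolding mem_box_cart by (metis diff_le_0_iff_le linear)
    then have "bump 0 (k * (x $ j - a $ j)) * bump 0 (k * (b $ j - x $ j)) = 0"
      using assms(2) by (auto simp: bump_nonpos mult_nonneg_nonpos)
    then show ?thesis unfolding box_bump_def by (intro prod_zero) auto
  qed
  moreover have "smooth (box_bump a b k)"
    unfolding box_bump_def[abs_def] UNIV_2
    by (auto intro!: smooth_mult smooth_bump smooth_diff)
  ultimately show ?thesis by (intro test_funI[OF _ compact_cbox assms(1)])
qed

lemma box_bump_bounds: "0 \<le> box_bump a b k x" "box_bump a b k x \<le> 1"
  unfolding box_bump_def
  by (auto intro!: prod_nonneg prod_le_1 mult_le_one mult_nonneg_nonneg bump_0_bounds)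

lemma box_bump_tendsto: "(\<lambda>n. box_bump a b (real n) x) \<longlonglongrightarrow> indicator (box a b) x"
proof -
  have *: "(\<lambda>n. bump 0 (real n * t)) \<longlonglongrightarrow> (if t > 0 then 1 else 0)" for t
  proof (cases "t > 0")
    case True
    have "(\<lambda>n. exp (- (inverse (real n) * inverse t))) \<longlonglongrightarrow> exp (- (0 * inverse t))"
      by (intro tendsto_intros lim_inverse_n)
    moreover have "\<forall>\<^sub>F n in sequentially. exp (- (inverse (real n) * inverse t)) = bump 0 (real n * t)"
      using eventually_gt_at_top[of 0] by eventually_elim (use True in \<open>auto simp: bump_0_eq divide_inverse\<close>)
    ultimately show ?thesis using True tendsto_cong by fastforce
  qed (auto simp: bump_nonpos mult_nonneg_nonpos)
  have "(\<lambda>n. box_bump a b (real n) x) \<longlonglongrightarrow>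
     (\<Prod>j\<in>UNIV. (if x $ j - a $ j > 0 then 1 else 0) * (if b $ j - x $ j > 0 then 1 else 0))"
    unfolding box_bump_def by (intro tendsto_intros *)
  moreover have "(\<Prod>j\<in>UNIV. (if x $ j - a $ j > 0 then 1 else 0) * (if b $ j - x $ j > 0 then 1 else 0)) = (indicator (box a b) x :: real)"
    by (auto simp: indicator_def mem_box_cart UNIV_2 forall_2)
  ultimately show ?thesis by simp
qed

text \<open>The standard mollifier on the disc of radius \<open>r\<close>, written through the
  squared distance so that it is smooth at the centre as well.\<close>

definition radial_bump :: "real^2 \<Rightarrow> real \<Rightarrow> real^2 \<Rightarrow> real" where
  "radial_bump m r x = bump 0 (1 - ((x - m) \<bullet> (x - m)) / r\<^sup>2)"

lemma smooth_quadratic: "smooth (\<lambda>x. c - ((x - m) \<bullet> (x - m)) / d)"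
  and pd_quadratic: "pd j (\<lambda>x. c - ((x - m) \<bullet> (x - m)) / d) x = - 2 * (x - m) $ j / d"
proof -
  have eq: "(\<lambda>x::real^2. c - ((x - m) \<bullet> (x - m)) / d) =
     (\<lambda>x. c - (1 / d) * ((x $ 1 - m $ 1) * (x $ 1 - m $ 1) + (x $ 2 - m $ 2) * (x $ 2 - m $ 2)))"
    by (auto simp: inner_vec_def sum_2)
  show "smooth (\<lambda>x. c - ((x - m) \<bullet> (x - m)) / d)"
    unfolding eq by (intro smooth_diff smooth_add smooth_mult smooth_const smooth_component)
  have "((\<lambda>x. c - ((x - m) \<bullet> (x - m)) / d) has_derivative (\<lambda>h. - (((x - m) \<bullet> h + h \<bullet> (x - m)) / d))) (at x)"
    unfolding divide_inverse by (auto intro!: derivative_eq_intros simp: algebra_simps)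
  then show "pd j (\<lambda>x. c - ((x - m) \<bullet> (x - m)) / d) x = - 2 * (x - m) $ j / d"
    by (subst pd_eqI) (auto simp: inner_axis inner_commute cart_eq_inner_axis)
qed

lemma radial_bump_outside: "x \<notin> ball m r \<Longrightarrow> r > 0 \<Longrightarrow> bump n (1 - ((x - m) \<bullet> (x - m)) / r\<^sup>2) = 0"
proof -
  assume "x \<notin> ball m r" "r > 0"
  then have "r\<^sup>2 \<le> (norm (x - m))\<^sup>2" by (intro power_mono) (auto simp: dist_norm norm_minus_commute)
  then show ?thesis using \<open>r > 0\<close> by (intro bump_nonpos) (simp add: power2_norm_eq_inner)
qed

lemma test_fun_radial_bump: "cball m r \<subseteq> U \<Longrightarrow> r > 0 \<Longrightarrow> test_fun U (radial_bump m r)"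
  unfolding radial_bump_def[abs_def]
  by (rule test_funI[OF smooth_bump[OF smooth_quadratic] compact_cball[of m r]])
    (use radial_bump_outside[of _ m r] in auto)

lemma pd_radial_bump:
  "pd j (radial_bump m r) x = bump 1 (1 - ((x - m) \<bullet> (x - m)) / r\<^sup>2) * (- 2 * (x - m) $ j / r\<^sup>2)"
  unfolding radial_bump_def[abs_def]
  by (subst pd_compose(1)[where h = "bump 0" and h' = "bump 1"])
    (use bump_has_derivative[of 0] smooth_differentiable[OF smooth_quadratic] in \<open>simp_all only: pd_quadratic One_nat_def\<close>)

text \<open>Equality of mixed derivatives is read off an explicit Hessian, which is visibly
  symmetric. It is what makes the rotated gradient of the bump divergence free.\<close>

lemma pd_radial_bump_symmetric:
  "pd i (pd j (radial_bump m r)) = pd j (pd i (radial_bump m r))"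
proof -
  have *: "pd i (pd j (radial_bump m r)) x =
     bump 1 (1 - ((x - m) \<bullet> (x - m)) / r\<^sup>2) * ((if i = j then 1 else 0) * (- 2 / r\<^sup>2))
     + bump 2 (1 - ((x - m) \<bullet> (x - m)) / r\<^sup>2) * (- 2 * (x - m) $ i / r\<^sup>2) * (- 2 * (x - m) $ j / r\<^sup>2)" for i j x
  proof -
    have eq: "pd j (radial_bump m r) = (\<lambda>x. bump 1 (1 - ((x - m) \<bullet> (x - m)) / r\<^sup>2) * (- 2 * (x - m) $ j / r\<^sup>2))"
      using pd_radial_bump by blast
    have "((\<lambda>x. - 2 * (x - m) $ j / r\<^sup>2) has_derivative (\<lambda>h. - 2 * h $ j / r\<^sup>2)) (at x)"
      unfolding divide_inverse vector_minus_component
      by (auto intro!: derivative_eq_intros bounded_linear_imp_has_derivative[OF bounded_linear_vec_nth])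
    then have d: "(\<lambda>x. - 2 * (x - m) $ j / r\<^sup>2) differentiable (at x)"
      "pd i (\<lambda>x. - 2 * (x - m) $ j / r\<^sup>2) x = (if i = j then 1 else 0) * (- 2 / r\<^sup>2)"
      using pd_eqI by (force simp: differentiable_def axis_def)+
    have p: "pd i (\<lambda>x. bump 1 (1 - ((x - m) \<bullet> (x - m)) / r\<^sup>2)) x =
        bump 2 (1 - ((x - m) \<bullet> (x - m)) / r\<^sup>2) * (- 2 * (x - m) $ i / r\<^sup>2)"
      by (subst pd_compose(1)[where h = "bump 1" and h' = "bump 2"])
        (use bump_has_derivative[of 1] smooth_differentiable[OF smooth_quadratic] in \<open>simp_all only: pd_quadratic numeral_2_eq_2 One_nat_def\<close>)
    show ?thesis
      unfolding eq pd_mult[OF smooth_differentiable[OF smooth_bump[OF smooth_quadratic]] d(1)] d(2) p ..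
  qed
  show ?thesis by (rule ext) (simp add: *)
qed

lemma radial_bump_bounds: "0 \<le> radial_bump m r x" "radial_bump m r x \<le> 1"
  by (auto simp: radial_bump_def bump_0_bounds)

text \<open>The argument \<open>1 - |x - m|^2 / r^2\<close> never exceeds 1, so one number bounds
  the slope in every disc, and gradients of bumps scale like \<open>1 / r\<close> with an absolute
  constant.\<close>

definition bump_bound :: real where
  "bump_bound = (SOME B. \<forall>t\<le>1. \<bar>bump 1 t\<bar> \<le> B)"

lemma bump_bound: "t \<le> 1 \<Longrightarrow> \<bar>bump 1 t\<bar> \<le> bump_bound" and bump_bound_nonneg: "bump_bound \<ge> 0"
proof -
  have "bounded (bump 1 ` {0..1})"
    by (intro compact_imp_bounded compact_continuous_image continuous_bump compact_Icc)
  then obtain B where "\<forall>t\<in>{0..1}. \<bar>bump 1 t\<bar> \<le> B" by (auto simp: bounded_iff)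
  then have B: "\<And>t. t \<in> {0..1} \<Longrightarrow> \<bar>bump 1 t\<bar> \<le> B" by blast
  have "\<bar>bump 1 t\<bar> \<le> B" if "t \<le> 1" for t
    using B[of t] B[of 0] that bump_nonpos[of t 1] by (cases "t \<ge> 0") auto
  then have "\<exists>B. \<forall>t\<le>1. \<bar>bump 1 t\<bar> \<le> B" by blast
  then have *: "\<forall>t\<le>1. \<bar>bump 1 t\<bar> \<le> bump_bound" unfolding bump_bound_def by (rule someI_ex)
  show "t \<le> 1 \<Longrightarrow> \<bar>bump 1 t\<bar> \<le> bump_bound" "bump_bound \<ge> 0"
    using * by (blast, metis abs_ge_zero linear order_trans)
qed

lemma grad_radial_bump: "(\<chi> j. pd j (radial_bump m r) x) = (bump 1 (1 - ((x - m) \<bullet> (x - m)) / r\<^sup>2) * (- 2 / r\<^sup>2)) *\<^sub>R (x - m)"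
  by (simp add: vec_eq_iff pd_radial_bump del: vector_minus_component)

lemma norm_grad_radial_bump:
  assumes "r > 0" shows "norm (\<chi> j. pd j (radial_bump m r) x) \<le> 2 * bump_bound / r"
proof (cases "x \<in> ball m r")
  case True
  then have "norm (x - m) \<le> r" by (auto simp: dist_norm norm_minus_commute)
  moreover have "\<bar>bump 1 (1 - ((x - m) \<bullet> (x - m)) / r\<^sup>2)\<bar> \<le> bump_bound"
    by (intro bump_bound) simp
  ultimately have "\<bar>bump 1 (1 - ((x - m) \<bullet> (x - m)) / r\<^sup>2)\<bar> * (2 / r\<^sup>2) * norm (x - m) \<le> bump_bound * (2 / r\<^sup>2) * r"
    using bump_bound_nonneg by (intro mult_mono) auto
  then show ?thesis using assms by (simp add: grad_radial_bump abs_mult power2_eq_square mult.commute)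
next
  case False
  show ?thesis
    unfolding grad_radial_bump radial_bump_outside[OF False assms] using assms bump_bound_nonneg by simp
qed

section \<open>Square integrable functions\<close>

lemma integrable_lebesgue_on_subset:
  fixes f :: "'a::euclidean_space \<Rightarrow> 'b::euclidean_space"
  assumes "integrable (lebesgue_on D) f" "V \<subseteq> D" "V \<in> sets lebesgue" "D \<in> sets lebesgue"
  shows "integrable (lebesgue_on V) f"
proof -
  have "integrable lebesgue (\<lambda>x. indicator D x *\<^sub>R f x)"
    using assms by (simp add: integrable_restrict_space)
  then have "integrable lebesgue (\<lambda>x. indicator V x *\<^sub>R (indicator D x *\<^sub>R f x))"
    by (rule integrable_mult_indicator[OF assms(3)])
  moreover have "(\<lambda>x. indicator V x *\<^sub>R (indicator D x *\<^sub>R f x)) = (\<lambda>x. indicator V x *\<^sub>R f x)"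
    using assms(2) by (auto simp: indicator_def fun_eq_iff)
  ultimately show ?thesis using assms by (simp add: integrable_restrict_space)
qed

lemma measurable_lebesgue_on_subset:
  assumes "f \<in> borel_measurable (lebesgue_on D)" "V \<subseteq> D"
  shows "f \<in> borel_measurable (lebesgue_on V)"
  using assms by (rule measurable_restrict_mono)

lemma integral_lebesgue_on_eq:
  fixes f :: "'a::euclidean_space \<Rightarrow> 'b::euclidean_space"
  assumes "V \<subseteq> D" "V \<in> sets lebesgue" "D \<in> sets lebesgue" "\<And>x. x \<notin> V \<Longrightarrow> f x = 0"
  shows "integral\<^sup>L (lebesgue_on D) f = integral\<^sup>L (lebesgue_on V) f"
proof -
  have "(\<lambda>x. indicator V x *\<^sub>R f x) = f" "(\<lambda>x. indicator D x *\<^sub>R f x) = f"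
    using assms(1,4) by (auto simp: indicator_def fun_eq_iff)
  then show ?thesis using assms by (simp add: integral_restrict_space)
qed

lemma L2D: "L2 D f \<Longrightarrow> f \<in> borel_measurable (lebesgue_on D)" "L2 D f \<Longrightarrow> integrable (lebesgue_on D) (\<lambda>x. (norm (f x))\<^sup>2)"
  by (auto simp: L2_def)

lemma L2_bound_AE:
  assumes "f \<in> borel_measurable (lebesgue_on D)" "integrable (lebesgue_on D) h"
    "AE x in lebesgue_on D. (norm (f x))\<^sup>2 \<le> h x"
  shows "L2 D f"
  unfolding L2_def
proof
  show "integrable (lebesgue_on D) (\<lambda>x. (norm (f x))\<^sup>2)"
    using assms(2)
  proof (rule Bochner_Integration.integrable_bound)
    show "AE x in lebesgue_on D. norm ((norm (f x))\<^sup>2) \<le> norm (h x)"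
      using assms(3) by eventually_elim auto
  qed (use assms(1) in measurable)
qed (rule assms(1))

lemma L2_bound:
  assumes "f \<in> borel_measurable (lebesgue_on D)" "integrable (lebesgue_on D) h"
    "\<And>x. x \<in> D \<Longrightarrow> (norm (f x))\<^sup>2 \<le> h x"
  shows "L2 D f"
  using assms(3) by (intro L2_bound_AE[OF assms(1,2)] AE_I2) (simp add: space_restrict_space)

lemma norm_add_power2_le: "(norm (x + y))\<^sup>2 \<le> 2 * (norm x)\<^sup>2 + 2 * (norm (y::'a::real_normed_vector))\<^sup>2"
proof -
  have "(norm (x + y))\<^sup>2 \<le> (norm x + norm y)\<^sup>2" by (intro power_mono norm_triangle_ineq) auto
  also have "\<dots> \<le> 2 * (norm x)\<^sup>2 + 2 * (norm y)\<^sup>2"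
    using zero_le_power2[of "norm x - norm y"] by (simp add: power2_eq_square algebra_simps)
  finally show ?thesis .
qed

lemma L2_add: assumes "L2 D f" "L2 D g" shows "L2 D (\<lambda>x. f x + g x)"
  by (rule L2_bound[where h = "\<lambda>x. 2 * (norm (f x))\<^sup>2 + 2 * (norm (g x))\<^sup>2"])
    (use assms[THEN L2D(1)] assms[THEN L2D(2)] norm_add_power2_le in auto)

lemma L2_scaleR: assumes "L2 D f" shows "L2 D (\<lambda>x. c *\<^sub>R f x)"
  by (rule L2_bound[where h = "\<lambda>x. c\<^sup>2 * (norm (f x))\<^sup>2"])
    (use L2D[OF assms] in \<open>auto simp: power_mult_distrib\<close>)

lemma L2_diff: assumes "L2 D f" "L2 D g" shows "L2 D (\<lambda>x. f x - g x)"
  using L2_add[OF assms(1) L2_scaleR[OF assms(2), of "-1"]] by simp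

lemma L2_bounded:
  assumes "D \<in> lmeasurable" "f \<in> borel_measurable (lebesgue_on D)" "\<And>x. x \<in> D \<Longrightarrow> norm (f x) \<le> B"
  shows "L2 D f"
proof (rule L2_bound[where h = "\<lambda>x. B\<^sup>2"])
  interpret finite_measure "lebesgue_on D" by (rule finite_measure_lebesgue_on[OF assms(1)])
  show "integrable (lebesgue_on D) (\<lambda>x. B\<^sup>2)" by simp
qed (use assms in \<open>auto intro!: power_mono\<close>)

lemma L2_const: "D \<in> lmeasurable \<Longrightarrow> L2 D (\<lambda>x. c)"
  by (rule L2_bounded[where B = "norm c"]) auto

lemma L2_continuous:
  assumes "bounded D" "D \<in> sets lebesgue" "continuous_on UNIV f"
  shows "L2 D f"
proof -
  have "compact (closure D)" using assms(1) by simp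
  then have "bounded (f ` closure D)"
    using assms(3) by (intro compact_imp_bounded compact_continuous_image) (auto intro: continuous_on_subset)
  then obtain B where "\<forall>y\<in>f ` closure D. norm y \<le> B" unfolding bounded_iff by blast
  then have "\<And>x. x \<in> D \<Longrightarrow> norm (f x) \<le> B" using closure_subset by blast
  then show ?thesis
    using assms by (intro L2_bounded[where B = B] bounded_set_imp_lmeasurable continuous_imp_measurable_on_sets_lebesgue)
      (auto intro: continuous_on_subset)
qed

lemma L2_subset: "L2 D f \<Longrightarrow> V \<subseteq> D \<Longrightarrow> V \<in> sets lebesgue \<Longrightarrow> D \<in> sets lebesgue \<Longrightarrow> L2 V f"
  unfolding L2_def using measurable_lebesgue_on_subset integrable_lebesgue_on_subset by blast

lemma L2_cong_AE:
  assumes "L2 D f" "AE x in lebesgue_on D. f x = g x" "g \<in> borel_measurable (lebesgue_on D)"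
  shows "L2 D g" "l2_sq D g = l2_sq D f"
proof -
  have *: "AE x in lebesgue_on D. (norm (f x))\<^sup>2 = (norm (g x))\<^sup>2"
    using assms(2) by eventually_elim simp
  show "L2 D g" unfolding L2_def
    using integrable_cong_AE[OF _ _ *] L2D[OF assms(1)] assms(3) by auto
  show "l2_sq D g = l2_sq D f" unfolding l2_sq_def
    using L2D[OF assms(1)] assms(3) * by (intro integral_cong_AE) auto
qed

lemma l2_sq_cong_AE:
  assumes "L2 D f" "L2 D g" "AE x in lebesgue_on D. f x = g x" shows "l2_sq D f = l2_sq D g"
  using L2_cong_AE(2)[OF assms(1,3) L2D(1)[OF assms(2)]] by simp

lemma L2_inner_integrable:
  assumes "L2 D f" "L2 D g" shows "integrable (lebesgue_on D) (\<lambda>x. f x \<bullet> g x)"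
proof (rule Bochner_Integration.integrable_bound[of _ "\<lambda>x. (norm (f x))\<^sup>2 + (norm (g x))\<^sup>2"])
  show "AE x in lebesgue_on D. norm (f x \<bullet> g x) \<le> norm ((norm (f x))\<^sup>2 + (norm (g x))\<^sup>2)"
  proof (intro AE_I2)
    fix x
    have "\<bar>f x \<bullet> g x\<bar> \<le> norm (f x) * norm (g x)" by (rule Cauchy_Schwarz_ineq2)
    also have "\<dots> \<le> (norm (f x))\<^sup>2 + (norm (g x))\<^sup>2"
      using zero_le_power2[of "norm (f x) - norm (g x)"] zero_le_power2[of "norm (f x)"] zero_le_power2[of "norm (g x)"]
      unfolding power2_diff by linarith
    finally show "norm (f x \<bullet> g x) \<le> norm ((norm (f x))\<^sup>2 + (norm (g x))\<^sup>2)" by simp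
  qed
qed (use L2D[OF assms(1)] L2D[OF assms(2)] in auto)

lemma L2_mult_integrable:
  fixes f g :: "real^2 \<Rightarrow> real"
  shows "L2 D f \<Longrightarrow> L2 D g \<Longrightarrow> integrable (lebesgue_on D) (\<lambda>x. f x * g x)"
  using L2_inner_integrable[of D f g] by simp

lemma L2_integrable:
  fixes f :: "real^2 \<Rightarrow> real"
  shows "L2 D f \<Longrightarrow> D \<in> lmeasurable \<Longrightarrow> integrable (lebesgue_on D) f"
  using L2_mult_integrable[of D f "\<lambda>x. 1"] L2_const by auto

lemma L2_norm: "L2 D f \<Longrightarrow> L2 D (\<lambda>x. norm (f x))"
  unfolding L2_def by auto

lemma L2_vec_component:
  fixes f :: "real^2 \<Rightarrow> 'b::euclidean_space^'n"
  assumes "L2 D f" shows "L2 D (\<lambda>x. f x $ i)"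
proof (rule L2_bound[OF _ L2D(2)[OF assms]])
  show "(\<lambda>x. f x $ i) \<in> borel_measurable (lebesgue_on D)"
    by (rule measurable_compose[OF L2D(1)[OF assms]])
      (intro borel_measurable_continuous_onI continuous_intros)
qed (auto intro!: power_mono Finite_Cartesian_Product.norm_nth_le)

lemma norm_vec_power2: "(norm (x :: 'b::real_normed_vector^'n))\<^sup>2 = (\<Sum>i\<in>UNIV. (norm (x $ i))\<^sup>2)"
  by (simp add: norm_vec_def L2_set_def sum_nonneg)

lemma L2_vecI:
  fixes f :: "real^2 \<Rightarrow> 'b::euclidean_space^'n"
  assumes "\<And>i. L2 D (\<lambda>x. f x $ i)" shows "L2 D f"
proof (rule L2_bound[where h = "\<lambda>x. \<Sum>i\<in>UNIV. (norm (f x $ i))\<^sup>2"])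
  have *: "(\<lambda>x. f x $ i) \<in> borel_measurable (lebesgue_on D)" for i by (rule L2D(1)[OF assms])
  have "(\<lambda>x. f x \<bullet> axis i b) \<in> borel_measurable (lebesgue_on D)" for i b
    using * by (simp add: inner_axis)
  then show "f \<in> borel_measurable (lebesgue_on D)"
    by (subst borel_measurable_euclidean_space) (auto simp: Basis_vec_def)
  show "integrable (lebesgue_on D) (\<lambda>x. \<Sum>i\<in>UNIV. (norm (f x $ i))\<^sup>2)"
    by (intro Bochner_Integration.integrable_sum L2D(2)[OF assms])
qed (simp add: norm_vec_power2)

lemma l2_sq_nonneg [simp]: "0 \<le> l2_sq D f"
  unfolding l2_sq_def by (rule integral_nonneg_AE) auto

lemma l2_sq_mono:
  assumes "L2 D f" "L2 D g" "AE x in lebesgue_on D. norm (f x) \<le> norm (g x)"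
  shows "l2_sq D f \<le> l2_sq D g"
  unfolding l2_sq_def
proof (rule integral_mono_AE[OF L2D(2)[OF assms(1)] L2D(2)[OF assms(2)]])
  show "AE x in lebesgue_on D. (norm (f x))\<^sup>2 \<le> (norm (g x))\<^sup>2"
    using assms(3) by eventually_elim (auto intro: power_mono)
qed

lemma l2_sq_add_le:
  assumes "L2 D f" "L2 D g"
  shows "l2_sq D (\<lambda>x. f x + g x) \<le> 2 * l2_sq D f + 2 * l2_sq D g"
proof -
  have "l2_sq D (\<lambda>x. f x + g x) \<le> (LINT x|lebesgue_on D. 2 * (norm (f x))\<^sup>2 + 2 * (norm (g x))\<^sup>2)"
    unfolding l2_sq_def
    using L2D(2)[OF L2_add[OF assms]] L2D(2)[OF assms(1)] L2D(2)[OF assms(2)]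
    by (intro integral_mono norm_add_power2_le) auto
  also have "\<dots> = 2 * l2_sq D f + 2 * l2_sq D g"
    unfolding l2_sq_def using L2D(2)[OF assms(1)] L2D(2)[OF assms(2)] by simp
  finally show ?thesis .
qed

lemma l2_sq_scaleR: "l2_sq D (\<lambda>x. c *\<^sub>R f x) = c\<^sup>2 * l2_sq D f"
  unfolding l2_sq_def by (simp add: power_mult_distrib)

text \<open>Cauchy-Schwarz against the constant 1, obtained as a variance: with area
  \<open>m\<close> and \<open>I\<close> the integral of the norm, integrating
  \<open>(m |f| - I)^2\<close> gives \<open>m (m l2_sq D f - I^2)\<close>. Area 0 is treated apart
  because \<open>m\<close> cannot be cancelled then.\<close>

lemma L1_le_L2:
  assumes "L2 D f" "D \<in> lmeasurable"
  shows "(LINT x|lebesgue_on D. norm (f x))\<^sup>2 \<le> measure lebesgue D * l2_sq D f"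
proof -
  interpret finite_measure "lebesgue_on D" by (rule finite_measure_lebesgue_on[OF assms(2)])
  have i: "integrable (lebesgue_on D) (\<lambda>x. norm (f x))"
    by (rule L2_integrable[OF L2_norm[OF assms(1)] assms(2)])
  note i2 = L2D(2)[OF assms(1)]
  define I where "I = (LINT x|lebesgue_on D. norm (f x))"
  define m where "m = measure lebesgue D"
  have m: "measure (lebesgue_on D) (space (lebesgue_on D)) = m"
    using assms(2) by (simp add: m_def measure_restrict_space fmeasurableD space_restrict_space)
  have "0 \<le> (LINT x|lebesgue_on D. (m * norm (f x) - I)\<^sup>2)"
    by (rule integral_nonneg_AE) auto
  also have "\<dots> = (LINT x|lebesgue_on D. m\<^sup>2 * (norm (f x))\<^sup>2 - (2 * m * I) * norm (f x) + I\<^sup>2)"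
    by (simp add: power2_diff power_mult_distrib algebra_simps)
  also have "\<dots> = m\<^sup>2 * l2_sq D f - (2 * m * I) * I + I\<^sup>2 * m"
    using i i2 m by (simp add: l2_sq_def I_def)
  also have "\<dots> = m * (m * l2_sq D f - I\<^sup>2)" by (simp add: power2_eq_square algebra_simps)
  finally have *: "0 \<le> m * (m * l2_sq D f - I\<^sup>2)" .
  show ?thesis
  proof (cases "m = 0")
    case True
    then have "D \<in> null_sets lebesgue"
      using assms(2) unfolding m_def by (simp add: negligible_iff_measure flip: negligible_iff_null_sets)
    then have "AE x in lebesgue_on D. norm (f x) = 0"
      by (intro AE_I'[of D]) (auto simp: null_sets_restrict_space fmeasurableD[OF assms(2)])
    then have "I = 0" unfolding I_def by (rule integral_eq_zero_AE)
    then show ?thesis using True by (simp add: I_def m_def)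
  next
    case False
    then have "m > 0" unfolding m_def by (simp add: zero_less_measure_iff)
    then have "0 \<le> m * l2_sq D f - I\<^sup>2" using * by (simp add: zero_le_mult_iff)
    then show ?thesis by (simp add: I_def m_def)
  qed
qed

lemma l2_sq_eq_0_AE: "L2 D f \<Longrightarrow> l2_sq D f = 0 \<Longrightarrow> AE x in lebesgue_on D. f x = 0"
  using integral_nonneg_eq_0_iff_AE[of "lebesgue_on D" "\<lambda>x. (norm (f x))\<^sup>2"] L2D(2)
  unfolding l2_sq_def by auto

section \<open>The fundamental lemma of the calculus of variations\<close>

lemma AE_lebesgue_on_subset:
  assumes "AE x in lebesgue_on D. P x" "V \<subseteq> D" "V \<in> sets lebesgue" "D \<in> sets lebesgue"
  shows "AE x in lebesgue_on V. P x"
  using assms by (auto simp: AE_restrict_space_iff elim: eventually_mono)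

text \<open>The positive and the negative part of \<open>g\<close> are densities of two measures
  that agree on boxes. Boxes are closed under intersection, generate the Borel sets and exhaust the
  space with finite mass, so the measures coincide, and with them the densities.\<close>

lemma box_integrals_zero_imp_AE_zero:
  fixes g :: "'a::euclidean_space \<Rightarrow> real"
  assumes g: "integrable lborel g" and z: "\<And>a b. (LINT x|lborel. indicator (box a b) x * g x) = 0"
  shows "AE x in lborel. g x = 0"
proof -
  define P N where "P = (\<lambda>x. max 0 (g x))" and "N = (\<lambda>x. max 0 (- g x))"
  have i: "integrable lborel P" "integrable lborel N" using g by (auto simp: P_def N_def)
  have PN: "g x = P x - N x" "P x \<ge> 0" "N x \<ge> 0" for x by (auto simp: P_def N_def)
  have m [measurable]: "P \<in> borel_measurable borel" "N \<in> borel_measurable borel"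
    using i borel_measurable_integrable by force+
  have eq: "density lborel (\<lambda>x. ennreal (P x)) = density lborel (\<lambda>x. ennreal (N x))"
  proof (rule measure_eqI_generator_eq[where E = "range (\<lambda>(a, b). box a b::'a set)" and \<Omega> = UNIV
        and A = "\<lambda>n. box (- (real n *\<^sub>R One)) (real n *\<^sub>R One)"])
    show "Int_stable (range (\<lambda>(a, b). box a b::'a set))"
      by (auto simp: Int_stable_def box_Int_box)
    have e: "emeasure (density lborel (\<lambda>x. ennreal (F x))) (box a b) = ennreal (LINT x|lborel. indicator (box a b) x * F x)"
      if "integrable lborel F" "\<And>x. F x \<ge> 0" for F :: "'a \<Rightarrow> real" and a b
    proof -
      have "integrable lborel (\<lambda>x. indicator (box a b) x *\<^sub>R F x)"
        by (rule integrable_mult_indicator) (use that in auto)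
      then have "(\<integral>\<^sup>+ x. ennreal (indicator (box a b) x * F x) \<partial>lborel) = ennreal (LINT x|lborel. indicator (box a b) x * F x)"
        by (intro nn_integral_eq_integral) (auto simp: that)
      moreover have "emeasure (density lborel (\<lambda>x. ennreal (F x))) (box a b) = (\<integral>\<^sup>+ x. ennreal (indicator (box a b) x * F x) \<partial>lborel)"
        using borel_measurable_integrable[OF that(1)]
        by (subst emeasure_density) (auto intro!: nn_integral_cong simp: indicator_def)
      ultimately show ?thesis by simp
    qed
    have "(LINT x|lborel. indicator (box a b) x * P x) = (LINT x|lborel. indicator (box a b) x * N x)" for a b
    proof -
      have "integrable lborel (\<lambda>x. indicator (box a b) x *\<^sub>R P x)" "integrable lborel (\<lambda>x. indicator (box a b) x *\<^sub>R N x)"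
        by (rule integrable_mult_indicator[OF _ i(1)], simp, rule integrable_mult_indicator[OF _ i(2)], simp)
      then show ?thesis using z[of a b] unfolding PN(1) by (simp add: algebra_simps)
    qed
    then show "emeasure (density lborel (\<lambda>x. ennreal (P x))) X = emeasure (density lborel (\<lambda>x. ennreal (N x))) X"
      if "X \<in> range (\<lambda>(a, b). box a b)" for X
      using that by (auto simp: e i PN)
    show "(\<Union>n. box (- (real n *\<^sub>R One)) (real n *\<^sub>R One)) = (UNIV :: 'a set)"
      by (rule UN_box_eq_UNIV)
    show "emeasure (density lborel (\<lambda>x. ennreal (P x))) (box (- (real n *\<^sub>R One)) (real n *\<^sub>R One)) \<noteq> \<infinity>" for n
      by (simp add: e i PN)
    show "sets (density lborel (\<lambda>x. ennreal (P x))) = sigma_sets UNIV (range (\<lambda>(a, b). box a b::'a set))"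
      "sets (density lborel (\<lambda>x. ennreal (N x))) = sigma_sets UNIV (range (\<lambda>(a, b). box a b::'a set))"
      by (simp_all add: borel_eq_box)
  qed auto
  have "AE x in lborel. ennreal (P x) = ennreal (N x)"
    by (rule sigma_finite_measure.density_unique[OF sigma_finite_lborel _ _ eq]) auto
  then show ?thesis by eventually_elim (use PN in auto)
qed

text \<open>Box bumps carry the hypothesis over to indicators of boxes whose closure lies in
  \<open>U\<close>. This makes \<open>f\<close> vanish almost everywhere on each such box, and
  countably many of them cover \<open>U\<close>.\<close>

lemma du_Bois_Reymond:
  fixes f :: "real^2 \<Rightarrow> real"
  assumes U: "open U" and f: "integrable (lebesgue_on U) f"
    and z: "\<And>\<phi>. test_fun U \<phi> \<Longrightarrow> (LINT x|lebesgue_on U. f x * \<phi> x) = 0"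
  shows "AE x in lebesgue_on U. f x = 0"
proof -
  have Ul: "U \<in> sets lebesgue" using U by auto
  have z2: "(LINT x|lebesgue_on U. f x * indicator (box a b) x) = 0" if "cbox a b \<subseteq> U" for a b
  proof -
    have "(\<lambda>n. LINT x|lebesgue_on U. f x * box_bump a b (real n) x) \<longlonglongrightarrow> (LINT x|lebesgue_on U. f x * indicator (box a b) x)"
    proof (rule integral_dominated_convergence[where w = "\<lambda>x. norm (f x)"])
      show "(\<lambda>x. f x * indicator (box a b) x) \<in> borel_measurable (lebesgue_on U)"
        by (intro borel_measurable_times borel_measurable_integrable[OF f]
            measurable_restrict_space1[OF borel_measurable_indicator]) auto
      have "continuous_on U (box_bump a b (real n))" for n
      \<comment> \<open>Bumps of positive scale are test functions. At scale 0 every factor is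
        \<open>bump 0\<close> at the argument 0, where it vanishes.\<close>
      proof (cases "n = 0")
        case True
        have "box_bump a b (real n) = (\<lambda>x. 0)" using True by (auto simp: box_bump_def bump_nonpos)
        then show ?thesis by simp
      next
        case False
        then show ?thesis using test_fun_box_bump[OF that, of "real n"] smooth_continuous unfolding test_fun_def by auto
      qed
      then show "(\<lambda>x. f x * box_bump a b (real n) x) \<in> borel_measurable (lebesgue_on U)" for n
        using Ul by (intro borel_measurable_times borel_measurable_integrable[OF f] continuous_imp_measurable_on_sets_lebesgue)
      show "AE x in lebesgue_on U. (\<lambda>n. f x * box_bump a b (real n) x) \<longlonglongrightarrow> f x * indicator (box a b) x"
        by (intro AE_I2 tendsto_intros box_bump_tendsto)
      show "AE x in lebesgue_on U. norm (f x * box_bump a b (real n) x) \<le> norm (f x)" for n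
        using box_bump_bounds by (intro AE_I2) (simp add: abs_mult mult_left_le)
    qed (use f in auto)
    moreover have "\<forall>\<^sub>F n in sequentially. (LINT x|lebesgue_on U. f x * box_bump a b (real n) x) = 0"
      using eventually_gt_at_top[of 0] by eventually_elim (use z test_fun_box_bump[OF that] in auto)
    then have "(\<lambda>n. LINT x|lebesgue_on U. f x * box_bump a b (real n) x) \<longlonglongrightarrow> 0"
      by (rule tendsto_eventually)
    ultimately show ?thesis by (rule LIMSEQ_unique)
  qed
  have box: "AE x in lebesgue. x \<in> box a b \<longrightarrow> f x = 0" if ab: "cbox a b \<subseteq> U" for a b
  proof -
    have boxU: "box a b \<subseteq> U" using ab box_subset_cbox by blast
    define g where "g x = indicator (box a b) x * f x" for x
    have g: "integrable lebesgue g"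
    proof -
      have "integrable (lebesgue_on (box a b)) f" using integrable_lebesgue_on_subset[OF f boxU] Ul by auto
      then show ?thesis unfolding g_def by (simp add: integrable_restrict_space)
    qed
    \<comment> \<open>\<open>f\<close> is only Lebesgue measurable, whereas the comparison of
      measures lives on Borel sets; a Borel representative bridges the two.\<close>
    obtain g' where g': "g' \<in> borel_measurable lborel" "AE x in lborel. g x = g' x"
      using completion_ex_borel_measurable_real[of g lborel] borel_measurable_integrable[OF g] by auto
    have "integrable lebesgue g'"
      using g integrable_cong_AE[of g lebesgue g'] g' borel_measurable_integrable[OF g] AE_completion[OF g'(2)]
        measurable_completion[OF g'(1)] by auto
    then have gi: "integrable lborel g'" using g'(1) by (simp add: integrable_completion)
    have "AE x in lborel. g' x = 0"
    proof (rule box_integrals_zero_imp_AE_zero[OF gi])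
      fix c d :: "real^2"
      \<comment> \<open>The test box is cut down to \<open>box a b\<close>. The cut is again a box,
        and unless it is empty its closure stays in \<open>U\<close>, as the identity for indicators
        requires.\<close>
      obtain e h where eh: "box c d \<inter> box a b = box e h" "cbox e h \<subseteq> cbox a b \<or> box c d \<inter> box a b = {}"
      proof (cases "box c d \<inter> box a b = {}")
        case True then show ?thesis by (intro that[of 0 0]) auto
      next
        case False
        have "box c d \<inter> box a b = box (\<Sum>i\<in>Basis. max (c \<bullet> i) (a \<bullet> i) *\<^sub>R i) (\<Sum>i\<in>Basis. min (d \<bullet> i) (b \<bullet> i) *\<^sub>R i)"
          by (rule box_Int_box)
        then show ?thesis by (intro that[of "\<Sum>i\<in>Basis. max (c \<bullet> i) (a \<bullet> i) *\<^sub>R i" "\<Sum>i\<in>Basis. min (d \<bullet> i) (b \<bullet> i) *\<^sub>R i"])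
          (auto simp: mem_box)
      qed
      have "(LINT x|lborel. indicator (box c d) x * g' x) = (LINT x|lebesgue. indicator (box c d) x * g' x)"
        using g'(1) by (subst integral_completion) auto
      also have "\<dots> = (LINT x|lebesgue. indicator (box c d) x * g x)"
        using AE_completion[OF g'(2)] borel_measurable_integrable[OF g] measurable_completion[OF g'(1)]
        by (intro integral_cong_AE borel_measurable_times borel_measurable_indicator) (auto elim: eventually_mono)
      also have "\<dots> = (LINT x|lebesgue. indicator U x *\<^sub>R (f x * indicator (box e h) x))"
        unfolding eh(1)[symmetric] g_def using boxU by (intro Bochner_Integration.integral_cong) (auto simp: indicator_def)
      also have "\<dots> = (LINT x|lebesgue_on U. f x * indicator (box e h) x)"
        using Ul by (simp add: integral_restrict_space)
      also have "\<dots> = 0"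
      proof (cases "box c d \<inter> box a b = {}")
        case True
        then show ?thesis using eh(1) by (simp add: indicator_def)
      next
        case False
        then show ?thesis using eh(2) ab by (intro z2) auto
      qed
      finally show "(LINT x|lborel. indicator (box c d) x * g' x) = 0" .
    qed
    then have "AE x in lborel. g x = 0" using g'(2) by eventually_elim auto
    then have "AE x in lebesgue. g x = 0" by (rule AE_completion)
    then show ?thesis by eventually_elim (auto simp: g_def)
  qed
  obtain \<D> where D: "countable \<D>" "\<D> \<subseteq> Pow U" "\<And>X. X \<in> \<D> \<Longrightarrow> \<exists>a b. X = cbox a b" "\<Union>\<D> = U"
    using open_countable_Union_open_cbox[OF U] by metis
  obtain \<E> where E: "countable \<E>" "\<And>X. X \<in> \<E> \<Longrightarrow> \<exists>a b. X = box a b" "\<And>X. X \<in> \<E> \<Longrightarrow> X \<subseteq> U" "\<Union>\<E> = U"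
    using open_countable_Union_open_box[OF U] by (metis PowD subsetD)
  have n: "AE x in lebesgue. \<forall>X\<in>\<D>. x \<in> X \<longrightarrow> f x = 0"
  proof (subst AE_ball_countable[OF D(1)], intro ballI)
    fix X assume "X \<in> \<D>"
    then obtain a b where X: "X = cbox a b" "cbox a b \<subseteq> U" using D by blast
    have "negligible (cbox a b - box a b)" by (rule negligible_frontier_interval)
    then have "AE x in lebesgue. x \<notin> cbox a b - box a b"
      by (intro AE_not_in) (simp add: negligible_iff_null_sets)
    then show "AE x in lebesgue. x \<in> X \<longrightarrow> f x = 0"
      using box[OF X(2)] by eventually_elim (use X(1) in auto)
  qed
  have "AE x in lebesgue. x \<in> U \<longrightarrow> f x = 0"
    using n by eventually_elim (use D(4) in blast)
  then show ?thesis using Ul by (subst AE_restrict_space_iff) auto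
qed

section \<open>Weak derivatives\<close>

lemma smooth_has_derivative:
  assumes "smooth \<phi>" shows "(\<phi> has_derivative (\<lambda>h. (\<chi> j. pd j \<phi> x) \<bullet> h)) (at x)"
proof -
  let ?f = "frechet_derivative \<phi> (at x)"
  have d: "(\<phi> has_derivative ?f) (at x)" by (intro has_derivative_frechet smooth_differentiable assms)
  then interpret bounded_linear ?f by (rule has_derivative_bounded_linear)
  have "?f h = (\<chi> j. pd j \<phi> x) \<bullet> h" for h
  proof -
    have "?f h = ?f (\<Sum>j\<in>UNIV. (h $ j) *\<^sub>R axis j 1)"
      by (simp add: basis_expansion flip: scalar_mult_eq_scaleR)
    also have "\<dots> = (\<Sum>j\<in>UNIV. h $ j * pd j \<phi> x)" by (simp add: sum scaleR pd_def)
    finally show ?thesis by (simp add: inner_vec_def mult.commute)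
  qed
  then have "?f = (\<lambda>h. (\<chi> j. pd j \<phi> x) \<bullet> h)" by (rule ext)
  then show ?thesis using d by simp
qed

lemma test_fun_gradient_bounded:
  assumes "test_fun U \<phi>" obtains B where "\<And>x. norm (\<chi> j. pd j \<phi> x) \<le> B"
proof -
  obtain B1 where B1: "\<And>x. \<bar>pd 1 \<phi> x\<bar> \<le> B1" using test_fun_bounded[OF test_fun_pd[OF assms]] by metis
  obtain B2 where B2: "\<And>x. \<bar>pd 2 \<phi> x\<bar> \<le> B2" using test_fun_bounded[OF test_fun_pd[OF assms]] by metis
  have "norm (\<chi> j. pd j \<phi> x) \<le> B1 + B2" for x
    using norm_le_l1_cart[of "\<chi> j. pd j \<phi> x"] B1[of x] B2[of x] by (simp add: sum_2)
  then show thesis by (rule that)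
qed

lemma lborel_integral_translate:
  fixes g :: "'a::euclidean_space \<Rightarrow> real"
  assumes "integrable lborel g"
  shows "integrable lborel (\<lambda>x. g (x + c))" "(LINT x|lborel. g (x + c)) = (LINT x|lborel. g x)"
proof -
  have g: "g \<in> borel_measurable borel" using borel_measurable_integrable[OF assms] by simp
  have "integrable (distr lborel borel ((+) c)) g" using assms by (simp only: lborel_distr_plus)
  then show "integrable lborel (\<lambda>x. g (x + c))"
    using g by (subst (asm) integrable_distr_eq) (auto simp: add.commute)
  have "(LINT x|lborel. g x) = (LINT x|distr lborel borel ((+) c). g x)" by (simp only: lborel_distr_plus)
  also have "\<dots> = (LINT x|lborel. g (x + c))"
    using g by (subst integral_distr) (auto simp: add.commute)
  finally show "(LINT x|lborel. g (x + c)) = (LINT x|lborel. g x)" by simp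
qed

lemma test_fun_integrable_lborel:
  assumes "test_fun U \<phi>" shows "integrable lborel \<phi>"
proof -
  obtain K where K: "smooth \<phi>" "compact K" "K \<subseteq> U" "\<And>x. x \<notin> K \<Longrightarrow> \<phi> x = 0"
    by (rule test_funE[OF assms(1)], rule that)
  have "integrable lborel (\<lambda>x. indicator K x *\<^sub>R \<phi> x)"
    by (rule borel_integrable_compact[OF K(2) smooth_continuous[OF K(1)]])
  moreover have "(\<lambda>x. indicator K x *\<^sub>R \<phi> x) = \<phi>"
    using K(4) by (auto simp: indicator_def fun_eq_iff)
  ultimately show ?thesis by simp
qed

text \<open>
  The difference quotients in the direction \<open>d\<close> have integral zero over any set that is invariant
  under translations along \<open>d\<close>; hence so has their limit.
\<close>

lemma integral_directional_derivative_eq_0: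
  assumes \<phi>: "test_fun U \<phi>" and S: "S \<in> sets borel" and inv: "\<And>x h. x + h *\<^sub>R d \<in> S \<longleftrightarrow> x \<in> S"
  shows "(LINT x|lebesgue. indicator S x * ((\<chi> j. pd j \<phi> x) \<bullet> d)) = 0"
proof -
  obtain K where K: "smooth \<phi>" "compact K" "K \<subseteq> U" "\<And>x. x \<notin> K \<Longrightarrow> \<phi> x = 0"
    by (rule test_funE[OF assms(1)], rule that)
  obtain R where R: "K \<subseteq> cball 0 R" 
  proof -
    from compact_imp_bounded[OF K(2)] obtain R where "\<forall>x\<in>K. norm x \<le> R" unfolding bounded_iff by blast
    then have "K \<subseteq> cball 0 R" by auto
    then show thesis by (rule that)
  qed
  obtain B where B: "\<And>x. norm (\<chi> j. pd j \<phi> x) \<le> B" by (rule test_fun_gradient_bounded[OF \<phi>], rule that)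
  have \<phi>m [measurable]: "\<phi> \<in> borel_measurable borel"
    by (rule borel_measurable_continuous_onI[OF smooth_continuous[OF K(1)]])
  have pm [measurable]: "pd j \<phi> \<in> borel_measurable borel" for j
    by (rule borel_measurable_continuous_onI[OF smooth_continuous[OF smooth_pd[OF K(1)]]])
  note [measurable] = S
  have gm: "(\<lambda>x. (\<chi> j. pd j \<phi> x) \<bullet> d) \<in> borel_measurable borel"
    by (simp add: inner_vec_def)
  define h where "h n = inverse (real (Suc n))" for n
  have h: "h n > 0" "h n \<le> 1" for n by (auto simp: h_def field_simps)
  define F where "F n x = indicator S x * ((\<phi> (x + h n *\<^sub>R d) - \<phi> x) / h n)" for n x
  have F0: "(LINT x|lborel. F n x) = 0" for n
  proof -
    have i: "integrable lborel (\<lambda>x. indicator S x * \<phi> x)"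
      using integrable_mult_indicator[OF _ test_fun_integrable_lborel[OF \<phi>], of S] S by simp
    have "indicator S x * \<phi> (x + h n *\<^sub>R d) = indicator S (x + h n *\<^sub>R d) * \<phi> (x + h n *\<^sub>R d)" for x
      using inv by (simp add: indicator_def)
    then have "F n x = (indicator S (x + h n *\<^sub>R d) * \<phi> (x + h n *\<^sub>R d) - indicator S x * \<phi> x) / h n" for x
      unfolding F_def by (metis right_diff_distrib times_divide_eq_right)
    then show ?thesis using i lborel_integral_translate[OF i, of "h n *\<^sub>R d"] by simp
  qed
  have "(\<lambda>n. LINT x|lborel. F n x) \<longlonglongrightarrow> (LINT x|lborel. indicator S x * ((\<chi> j. pd j \<phi> x) \<bullet> d))"
  \<comment> \<open>All quotients vanish off one fixed ball, since the translations have length at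
    most \<open>norm d\<close>, and the mean value inequality bounds them by
    \<open>B * norm d\<close> inside it.\<close>
  proof (rule integral_dominated_convergence[where w = "\<lambda>x. (B * norm d) * indicator (cball 0 (R + norm d)) x"])
    show "(\<lambda>x. indicator S x * ((\<chi> j. pd j \<phi> x) \<bullet> d)) \<in> borel_measurable lborel"
      using gm by measurable
    show "F n \<in> borel_measurable lborel" for n
      unfolding F_def[abs_def] by measurable
    have "emeasure lborel (cball 0 (R + norm d) :: (real^2) set) < \<infinity>"
      by (intro emeasure_bounded_finite) auto
    then show "integrable lborel (\<lambda>x::real^2. (B * norm d) * indicator (cball 0 (R + norm d)) x)"
      by (intro integrable_mult_right integrable_real_indicator) auto
    show "AE x in lborel. (\<lambda>n. F n x) \<longlonglongrightarrow> indicator S x * ((\<chi> j. pd j \<phi> x) \<bullet> d)"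
    proof (rule AE_I2)
      fix x
      have "((\<lambda>t. x + t *\<^sub>R d) has_derivative (\<lambda>t. t *\<^sub>R d)) (at 0)"
        by (auto intro!: derivative_eq_intros)
      moreover have "(\<phi> has_derivative (\<lambda>k. (\<chi> j. pd j \<phi> x) \<bullet> k)) (at (x + 0 *\<^sub>R d))"
        using smooth_has_derivative[OF K(1), of x] by simp
      ultimately have "((\<lambda>t. \<phi> (x + t *\<^sub>R d)) has_derivative (\<lambda>t. (\<chi> j. pd j \<phi> x) \<bullet> (t *\<^sub>R d))) (at 0)"
        by (rule has_derivative_compose)
      then have "((\<lambda>t. \<phi> (x + t *\<^sub>R d)) has_real_derivative (\<chi> j. pd j \<phi> x) \<bullet> d) (at 0)"
        by (simp add: has_field_derivative_def mult_commute_abs)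
      then have "((\<lambda>t. (\<phi> (x + t *\<^sub>R d) - \<phi> x) / t) \<longlongrightarrow> (\<chi> j. pd j \<phi> x) \<bullet> d) (at 0)"
        by (simp add: DERIV_def)
      moreover have "filterlim h (at 0) sequentially"
        using LIMSEQ_inverse_real_of_nat h(1) unfolding h_def[abs_def] by (auto simp: filterlim_at)
      ultimately have "(\<lambda>n. (\<phi> (x + h n *\<^sub>R d) - \<phi> x) / h n) \<longlonglongrightarrow> (\<chi> j. pd j \<phi> x) \<bullet> d"
        by (rule filterlim_compose)
      then show "(\<lambda>n. F n x) \<longlonglongrightarrow> indicator S x * ((\<chi> j. pd j \<phi> x) \<bullet> d)"
        unfolding F_def by (intro tendsto_intros)
    qed
    show "AE x in lborel. norm (F n x) \<le> (B * norm d) * indicator (cball 0 (R + norm d)) x" for n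
    proof (rule AE_I2)
      fix x
      have Bnn: "B \<ge> 0" using order_trans[OF norm_ge_zero B] .
      have le: "norm (h n *\<^sub>R d) \<le> norm d" using h[of n] by (simp add: mult_left_le_one_le)
      show "norm (F n x) \<le> (B * norm d) * indicator (cball 0 (R + norm d)) x"
      proof (cases "x \<in> cball 0 (R + norm d)")
        case True
        have "norm (\<phi> (x + h n *\<^sub>R d) - \<phi> x) \<le> B * norm (x + h n *\<^sub>R d - x)"
        proof (rule differentiable_bound[where S = UNIV and f' = "\<lambda>x k. (\<chi> j. pd j \<phi> x) \<bullet> k"])
          show "onorm (\<lambda>k. (\<chi> j. pd j \<phi> x) \<bullet> k) \<le> B" for x
            by (rule onorm_le) (simp add: order_trans[OF Cauchy_Schwarz_ineq2 mult_right_mono[OF B norm_ge_zero]])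
        qed (use smooth_has_derivative[OF K(1)] in auto)
        then have "norm ((\<phi> (x + h n *\<^sub>R d) - \<phi> x) / h n) \<le> B * norm d"
          using h(1)[of n] by (simp add: pos_divide_le_eq mult_ac)
        moreover have "norm (F n x) \<le> norm ((\<phi> (x + h n *\<^sub>R d) - \<phi> x) / h n)"
          unfolding F_def by (simp add: indicator_def)
        ultimately show ?thesis using True by simp
      next
        case False
        then have *: "norm x > R + norm d" by simp
        have "norm (x + h n *\<^sub>R d) \<ge> norm x - norm (h n *\<^sub>R d)" by (metis norm_diff_ineq)
        then have "norm (x + h n *\<^sub>R d) > R" "norm x > R" using * le norm_ge_zero[of d] by linarith+
        then have "x + h n *\<^sub>R d \<notin> K" "x \<notin> K" using R by auto
        then show ?thesis using False K(4) by (simp add: F_def)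
      qed
    qed
  qed
  then have "(LINT x|lborel. indicator S x * ((\<chi> j. pd j \<phi> x) \<bullet> d)) = 0"
    unfolding F0 using LIMSEQ_unique[OF _ tendsto_const] by auto
  moreover have "(LINT x|lebesgue. indicator S x * ((\<chi> j. pd j \<phi> x) \<bullet> d)) = (LINT x|lborel. indicator S x * ((\<chi> j. pd j \<phi> x) \<bullet> d))"
    by (rule integral_completion) (use gm in measurable)
  ultimately show ?thesis by simp
qed

lemma integral_pd_eq_0:
  assumes "test_fun U \<phi>" "U \<in> sets lebesgue"
  shows "(LINT x|lebesgue_on U. pd j \<phi> x) = 0"
proof -
  have "(LINT x|lebesgue. indicator UNIV x * ((\<chi> j. pd j \<phi> x) \<bullet> axis j 1)) = 0"
    by (rule integral_directional_derivative_eq_0[OF assms(1)]) auto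
  then have "(LINT x|lebesgue_on UNIV. pd j \<phi> x) = 0" by (simp add: inner_axis lebesgue_on_UNIV_eq)
  then show ?thesis
    using integral_lebesgue_on_eq[of U UNIV "pd j \<phi>"] assms test_fun_outside[OF test_fun_pd[OF assms(1)]] by auto
qed

lemma test_fun_L2: "test_fun V \<phi> \<Longrightarrow> bounded U \<Longrightarrow> open U \<Longrightarrow> L2 U \<phi>"
  by (intro L2_continuous) (auto simp: test_fun_def smooth_continuous)

lemma smooth_L2: "smooth \<phi> \<Longrightarrow> bounded U \<Longrightarrow> open U \<Longrightarrow> L2 U \<phi>"
  by (intro L2_continuous) (auto simp: smooth_continuous)

text \<open>The product of \<open>f\<close> with a test function is a test function, so its
  derivative integrates to 0; the product rule then gives integration by parts.\<close>

lemma weak_pd_smooth: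
  assumes "smooth f" "open U" "bounded U" shows "weak_pd U j f (pd j f)"
  unfolding weak_pd_def
proof (intro allI impI)
  fix \<phi> assume \<phi>: "test_fun U \<phi>"
  have i: "integrable (lebesgue_on U) (\<lambda>x. f x * pd j \<phi> x)" "integrable (lebesgue_on U) (\<lambda>x. pd j f x * \<phi> x)"
    using assms test_fun_L2[OF \<phi> assms(3,2)] test_fun_L2[OF test_fun_pd[OF \<phi>] assms(3,2)]
    using smooth_L2[OF assms(1,3,2)] smooth_L2[OF smooth_pd[OF assms(1)] assms(3,2)] by (auto intro: L2_mult_integrable)
  have "(LINT x|lebesgue_on U. pd j (\<lambda>x. \<phi> x * f x) x) = 0"
    using assms by (intro integral_pd_eq_0 test_fun_mult \<phi>) auto
  moreover have "pd j (\<lambda>x. \<phi> x * f x) x = f x * pd j \<phi> x + pd j f x * \<phi> x" for x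
    using \<phi> assms by (subst pd_mult) (auto intro!: smooth_differentiable simp: test_fun_def)
  ultimately show "(LINT x|lebesgue_on U. f x * pd j \<phi> x) = - (LINT x|lebesgue_on U. pd j f x * \<phi> x)"
    using i by simp
qed

lemma weak_pd_unique:
  assumes U: "open U" "bounded U" and g: "L2 U g" "L2 U g'" "weak_pd U j f g" "weak_pd U j f g'"
  shows "AE x in lebesgue_on U. g x = g' x"
proof -
  have "AE x in lebesgue_on U. g x - g' x = 0"
  proof (rule du_Bois_Reymond[OF U(1)])
    show "integrable (lebesgue_on U) (\<lambda>x. g x - g' x)"
      using U by (intro L2_integrable L2_diff g bounded_set_imp_lmeasurable) auto
    fix \<phi> assume \<phi>: "test_fun U \<phi>"
    have "integrable (lebesgue_on U) (\<lambda>x. g x * \<phi> x)" "integrable (lebesgue_on U) (\<lambda>x. g' x * \<phi> x)"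
      using \<phi> U g by (auto intro!: L2_mult_integrable test_fun_L2)
    then show "(LINT x|lebesgue_on U. (g x - g' x) * \<phi> x) = 0"
      using g(3,4) \<phi> by (simp add: weak_pd_def left_diff_distrib)
  qed
  then show ?thesis by eventually_elim simp
qed

lemma weak_pd_add:
  assumes "open U" "bounded U" "L2 U f" "L2 U f'" "L2 U g" "L2 U g'" "weak_pd U j f g" "weak_pd U j f' g'"
  shows "weak_pd U j (\<lambda>x. f x + c * f' x) (\<lambda>x. g x + c * g' x)"
  unfolding weak_pd_def
proof (intro allI impI)
  fix \<phi> assume \<phi>: "test_fun U \<phi>"
  have "integrable (lebesgue_on U) (\<lambda>x. f x * pd j \<phi> x)" "integrable (lebesgue_on U) (\<lambda>x. f' x * pd j \<phi> x)"
    "integrable (lebesgue_on U) (\<lambda>x. g x * \<phi> x)" "integrable (lebesgue_on U) (\<lambda>x. g' x * \<phi> x)"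
    using \<phi> assms by (auto intro!: L2_mult_integrable test_fun_L2 test_fun_pd)
  then show "(LINT x|lebesgue_on U. (f x + c * f' x) * pd j \<phi> x) = - (LINT x|lebesgue_on U. (g x + c * g' x) * \<phi> x)"
    using assms(7,8) \<phi> by (simp add: weak_pd_def distrib_right mult.assoc)
qed

lemma weak_pd_subset:
  assumes "open V" "V \<subseteq> U" "open U" "weak_pd U j f g" shows "weak_pd V j f g"
  unfolding weak_pd_def
proof (intro allI impI)
  fix \<phi> assume \<phi>: "test_fun V \<phi>"
  then have "test_fun U \<phi>" using assms(2) by (rule test_fun_mono)
  then have "(LINT x|lebesgue_on U. f x * pd j \<phi> x) = - (LINT x|lebesgue_on U. g x * \<phi> x)"
    using assms(4) by (simp add: weak_pd_def)
  then show "(LINT x|lebesgue_on V. f x * pd j \<phi> x) = - (LINT x|lebesgue_on V. g x * \<phi> x)"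
    using assms test_fun_outside[OF \<phi>] test_fun_outside[OF test_fun_pd[OF \<phi>]]
    by (subst (1 2) integral_lebesgue_on_eq[of V U, symmetric]) auto
qed

text \<open>\<open>grad\<close> is a choice made separately for each set and field, so it commutes
  with differences and restrictions only up to null sets. This relation allows any representative
  and is stable under both operations; \<open>grad_AE_eq\<close> returns to the chosen one.\<close>

definition has_grad :: "(real^2) set \<Rightarrow> (real^2 \<Rightarrow> real^2) \<Rightarrow> (real^2 \<Rightarrow> real^2^2) \<Rightarrow> bool" where
  "has_grad U v G \<longleftrightarrow> L2 U v \<and> L2 U G \<and> (\<forall>i j. weak_pd U j (\<lambda>x. v x $ i) (\<lambda>x. G x $ i $ j))"

lemma L2_grad_component: "L2 U G \<Longrightarrow> L2 U (\<lambda>x. (G x :: real^2^2) $ i $ j)"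
  by (intro L2_vec_component)

lemma H1_has_grad: assumes "H1 U v" shows "has_grad U v (grad U v)"
proof -
  have "L2 U (wpd U j (\<lambda>x. v x $ i)) \<and> weak_pd U j (\<lambda>x. v x $ i) (wpd U j (\<lambda>x. v x $ i))" for i j
  proof -
    have "\<exists>g. L2 U g \<and> weak_pd U j (\<lambda>x. v x $ i) g" using assms by (auto simp: H1_def)
    from someI_ex[OF this] show ?thesis unfolding wpd_def .
  qed
  then show ?thesis
    using assms unfolding has_grad_def H1_def grad_def by (auto intro!: L2_vecI)
qed

lemma has_grad_H1: "has_grad U v G \<Longrightarrow> H1 U v"
  unfolding has_grad_def H1_def by (metis L2_grad_component L2_vec_component)

lemma has_grad_AE_eq:
  assumes "open U" "bounded U" "has_grad U v G" "has_grad U v G'"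
  shows "AE x in lebesgue_on U. G x = G' x"
proof -
  have "AE x in lebesgue_on U. G x $ i $ j = G' x $ i $ j" for i j
    using assms by (intro weak_pd_unique[of U _ _ j "\<lambda>x. v x $ i"] L2_grad_component) (auto simp: has_grad_def)
  then have "AE x in lebesgue_on U. \<forall>i j. G x $ i $ j = G' x $ i $ j"
    by (simp add: forall_2)
  then show ?thesis by eventually_elim (simp add: vec_eq_iff)
qed

lemma grad_AE_eq: "open U \<Longrightarrow> bounded U \<Longrightarrow> has_grad U v G \<Longrightarrow> AE x in lebesgue_on U. grad U v x = G x"
  using has_grad_AE_eq[OF _ _ H1_has_grad[OF has_grad_H1]] by blast

lemma has_grad_diff:
  assumes "open U" "bounded U" "has_grad U v G" "has_grad U w H"
  shows "has_grad U (\<lambda>x. v x - w x) (\<lambda>x. G x - H x)"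
  unfolding has_grad_def
proof (intro conjI allI)
  show "weak_pd U j (\<lambda>x. (v x - w x) $ i) (\<lambda>x. (G x - H x) $ i $ j)" for i j
    using weak_pd_add[of U "\<lambda>x. v x $ i" "\<lambda>x. w x $ i" "\<lambda>x. G x $ i $ j" "\<lambda>x. H x $ i $ j" j "-1"] assms
    by (auto simp: has_grad_def L2_vec_component)
qed (use assms in \<open>auto simp: has_grad_def intro: L2_diff\<close>)

lemma has_grad_subset:
  assumes "has_grad U v G" "open V" "V \<subseteq> U" "open U" shows "has_grad V v G"
  using assms L2_subset[of U] weak_pd_subset[OF assms(2-4)] unfolding has_grad_def by (auto simp: L2_subset)

lemma has_grad_smooth:
  assumes "open U" "bounded U" "\<And>i. smooth (\<lambda>x. v x $ i)"
  shows "has_grad U v (\<lambda>x. \<chi> i j. pd j (\<lambda>y. v y $ i) x)"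
  unfolding has_grad_def using assms by (auto intro!: L2_vecI smooth_L2 smooth_pd weak_pd_smooth)

lemma has_grad_affine: "open U \<Longrightarrow> bounded U \<Longrightarrow> has_grad U (\<lambda>x. c + A *v x) (\<lambda>x. A)"
  using has_grad_smooth[of U "\<lambda>x. c + A *v x"] smooth_affine[of c A] pd_affine[of _ c A]
  by (simp add: vec_eq_iff del: vector_add_component)

lemma grad_zero: "open U \<Longrightarrow> bounded U \<Longrightarrow> l2_sq U (grad U (\<lambda>x. 0)) = 0"
proof -
  assume U: "open U" "bounded U"
  have "AE x in lebesgue_on U. grad U (\<lambda>x. 0) x = 0"
    using grad_AE_eq[OF U has_grad_affine[OF U, of 0 0]] by simp
  then have "AE x in lebesgue_on U. (norm (grad U (\<lambda>x. 0) x))\<^sup>2 = 0" by eventually_elim simp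
  then show ?thesis unfolding l2_sq_def by (rule integral_eq_zero_AE)
qed

lemma H10_test_fun:
  assumes "open U" "bounded U" "\<And>i. test_fun U (\<lambda>x. v x $ i)" shows "H10 U v"
  unfolding H10_def
proof (intro conjI exI[of _ "\<lambda>n. v"] allI)
  show "H1 U v" using assms by (intro has_grad_H1[OF has_grad_smooth]) (auto simp: test_fun_def)
  show "(\<lambda>n. h1_sq U (\<lambda>x. v x - v x)) \<longlonglongrightarrow> 0"
    using grad_zero[OF assms(1,2)] by (simp add: h1_sq_def) (simp add: l2_sq_def)
qed (use assms in auto)

section \<open>Divergence of fields that vanish on the boundary\<close>

lemma divg_AE_eq: "open U \<Longrightarrow> bounded U \<Longrightarrow> has_grad U v G \<Longrightarrow> AE x in lebesgue_on U. divg U v x = trace (G x)"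
proof -
  assume "open U" "bounded U" "has_grad U v G"
  then have "AE x in lebesgue_on U. grad U v x = G x" by (rule grad_AE_eq)
  then show ?thesis unfolding divg_def by eventually_elim simp
qed

lemma L2_divg: assumes "H1 U v" shows "L2 U (divg U v)"
proof -
  have "L2 U (\<lambda>x. grad U v x $ 1 $ 1 + grad U v x $ 2 $ 2)"
    using H1_has_grad[OF assms] by (intro L2_add L2_grad_component) (auto simp: has_grad_def)
  then show ?thesis by (simp add: divg_def[abs_def] trace_def sum_2)
qed

lemma abs_trace_le: "\<bar>trace A\<bar> \<le> 2 * norm (A :: real^2^2)"
proof -
  have "\<bar>A $ i $ i\<bar> \<le> norm A" for i
    by (rule order_trans[OF component_le_norm_cart Finite_Cartesian_Product.norm_nth_le])
  from this[of 1] this[of 2] show ?thesis by (simp add: trace_def sum_2)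
qed

text \<open>True for the compactly supported approximants, and the difference is controlled by the
  \<open>h1_sq\<close> distance; the 4 is the square of the 2 in \<open>abs_trace_le\<close>. It
  makes the divergence of the exact velocity admissible as a test pressure of mean zero.\<close>

lemma H10_integral_divg:
  assumes U: "open U" "bounded U" and v: "H10 U v"
  shows "(LINT x|lebesgue_on U. divg U v x) = 0"
proof -
  have Um: "U \<in> lmeasurable" using U by (intro bounded_set_imp_lmeasurable) auto
  from v obtain \<phi> :: "nat \<Rightarrow> real^2 \<Rightarrow> real^2" where
    \<phi>: "\<And>n i. test_fun U (\<lambda>x. \<phi> n x $ i)" "(\<lambda>n. h1_sq U (\<lambda>x. \<phi> n x - v x)) \<longlonglongrightarrow> 0" and "H1 U v"
    unfolding H10_def by blast
  define I where "I = (LINT x|lebesgue_on U. divg U v x)"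
  note G = H1_has_grad[OF \<open>H1 U v\<close>]
  have "I\<^sup>2 \<le> 4 * measure lebesgue U * h1_sq U (\<lambda>x. \<phi> n x - v x)" for n
  proof -
    define H where "H x = (\<chi> i j. pd j (\<lambda>y. \<phi> n y $ i) x)" for x
    have H: "has_grad U (\<phi> n) H" unfolding H_def using \<phi>(1) U by (intro has_grad_smooth) (auto simp: test_fun_def)
    note D = has_grad_diff[OF U H G]
    have L: "L2 U (grad U (\<lambda>x. \<phi> n x - v x))" using H1_has_grad[OF has_grad_H1[OF D]] by (simp add: has_grad_def)
    have iH: "integrable (lebesgue_on U) (\<lambda>x. trace (H x))"
      unfolding H_def trace_def sum_2 using \<phi>(1) U Um
      by (intro Bochner_Integration.integrable_add L2_integrable) (auto intro!: test_fun_L2 test_fun_pd)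
    have iv: "integrable (lebesgue_on U) (divg U v)" by (intro L2_integrable L2_divg \<open>H1 U v\<close> Um)
    have "(LINT x|lebesgue_on U. trace (H x)) = 0"
      unfolding H_def trace_def sum_2 using \<phi>(1) U Um
      by (subst Bochner_Integration.integral_add)
        (auto intro!: L2_integrable test_fun_L2 test_fun_pd simp: integral_pd_eq_0)
    then have "I = - (LINT x|lebesgue_on U. trace (H x) - divg U v x)"
      using iH iv by (simp add: I_def)
    also have "\<dots> = - (LINT x|lebesgue_on U. trace (grad U (\<lambda>x. \<phi> n x - v x) x))"
    proof -
      have "L2 U (\<lambda>x. trace (grad U (\<lambda>x. \<phi> n x - v x) x))"
        using L2_divg[OF has_grad_H1[OF D]] by (simp add: divg_def[abs_def])
      moreover have "AE x in lebesgue_on U. trace (H x) - divg U v x = trace (grad U (\<lambda>x. \<phi> n x - v x) x)"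
        using grad_AE_eq[OF U D] by eventually_elim (simp add: divg_def trace_def sum_2)
      ultimately show ?thesis
        using iH iv by (subst integral_cong_AE[of "\<lambda>x. trace (H x) - divg U v x"]) (auto dest: L2D(1))
    qed
    finally have "\<bar>I\<bar> = \<bar>LINT x|lebesgue_on U. trace (grad U (\<lambda>x. \<phi> n x - v x) x)\<bar>" by simp
    also have "\<dots> \<le> (LINT x|lebesgue_on U. 2 * norm (grad U (\<lambda>x. \<phi> n x - v x) x))"
    proof (rule order_trans[OF integral_abs_bound], rule integral_mono_AE)
      show "integrable (lebesgue_on U) (\<lambda>x. \<bar>trace (grad U (\<lambda>x. \<phi> n x - v x) x)\<bar>)"
        using L2_divg[OF has_grad_H1[OF D]] Um by (intro integrable_abs L2_integrable) (simp_all add: divg_def[abs_def])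
      show "integrable (lebesgue_on U) (\<lambda>x. 2 * norm (grad U (\<lambda>x. \<phi> n x - v x) x))"
        by (intro integrable_mult_right L2_integrable L2_norm L Um)
    qed (auto intro: abs_trace_le)
    finally have "\<bar>I\<bar> \<le> 2 * (LINT x|lebesgue_on U. norm (grad U (\<lambda>x. \<phi> n x - v x) x))" by simp
    then have "\<bar>I\<bar>\<^sup>2 \<le> (2 * (LINT x|lebesgue_on U. norm (grad U (\<lambda>x. \<phi> n x - v x) x)))\<^sup>2"
      by (intro power_mono) auto
    also have "\<dots> \<le> 4 * (measure lebesgue U * l2_sq U (grad U (\<lambda>x. \<phi> n x - v x)))"
      using L1_le_L2[OF L Um] by (simp add: power_mult_distrib)
    also have "\<dots> \<le> 4 * measure lebesgue U * h1_sq U (\<lambda>x. \<phi> n x - v x)"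
      unfolding h1_sq_def mult.assoc by (intro mult_left_mono) auto
    finally show ?thesis by simp
  qed
  moreover have "(\<lambda>n. 4 * measure lebesgue U * h1_sq U (\<lambda>x. \<phi> n x - v x)) \<longlonglongrightarrow> 4 * measure lebesgue U * 0"
    by (intro tendsto_intros \<phi>)
  ultimately have "I\<^sup>2 \<le> 4 * measure lebesgue U * 0" by (intro LIMSEQ_le_const) auto
  then show ?thesis by (simp flip: I_def)
qed

section \<open>Square roots of symmetric positive definite matrices\<close>

lemma matrix_inv_unique:
  fixes A B :: "real^'n^'n"
  assumes "A ** B = mat 1" "B ** A = mat 1" shows "matrix_inv A = B"
proof -
  have "A ** matrix_inv A = mat 1 \<and> matrix_inv A ** A = mat 1"
    unfolding matrix_inv_def by (rule someI) (use assms in auto)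
  then show ?thesis
    by (metis assms(2) matrix_mul_assoc matrix_mul_lid matrix_mul_rid)
qed

text \<open>Sylvester's criterion by completing the square: with first row \<open>a\<close>,
  \<open>b\<close>, the quadratic form times \<open>a\<close> equals
  \<open>(a x1 + b x2)^2 + det A * x2^2\<close>.\<close>

lemma spd2_iff:
  fixes A :: "real^2^2"
  shows "spd A \<longleftrightarrow> A$1$2 = A$2$1 \<and> A$1$1 > 0 \<and> A$1$1 * A$2$2 - A$1$2 * A$2$1 > 0"
proof -
  have q: "x \<bullet> (A *v x) = A$1$1 * x$1 * x$1 + (A$1$2 + A$2$1) * x$1 * x$2 + A$2$2 * x$2 * x$2" for x
    by (simp add: inner_vec_def matrix_vector_mult_def sum_2 algebra_simps)
  have t: "transpose A = A \<longleftrightarrow> A$1$2 = A$2$1"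
    by (auto simp: vec_eq_iff transpose_def forall_2)
  show ?thesis
  proof (cases "A$1$2 = A$2$1")
    case True
    let ?a = "A$1$1" and ?b = "A$1$2" and ?d = "A$2$2"
    have q': "?a * (x \<bullet> (A *v x)) = (?a * x$1 + ?b * x$2)\<^sup>2 + (?a * ?d - ?b * ?b) * (x$2)\<^sup>2" for x
      unfolding q True[symmetric] by (simp add: power2_eq_square algebra_simps)
    show ?thesis
    proof
      assume s: "spd A"
      have "axis 1 1 \<bullet> (A *v axis 1 1) > 0" using s by (auto simp: spd_def axis_eq_0_iff)
      then have a: "?a > 0" by (simp add: q axis_def)
      \<comment> \<open>This vector annihilates the square and isolates the determinant.\<close>
      let ?x = "vector [- ?b, ?a] :: real^2"
      have "?x \<noteq> 0" using a by (auto simp: vec_eq_iff forall_2)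
      then have "0 < ?a * (?x \<bullet> (A *v ?x))" using s a by (auto simp: spd_def)
      also have "\<dots> = (?a * ?d - ?b * ?b) * ?a\<^sup>2" unfolding q' by simp
      finally have "?a * ?d - ?b * ?b > 0" using a by (simp add: zero_less_mult_iff)
      then show "A$1$2 = A$2$1 \<and> A$1$1 > 0 \<and> A$1$1 * A$2$2 - A$1$2 * A$2$1 > 0"
        using True a by simp
    next
      assume h: "A$1$2 = A$2$1 \<and> A$1$1 > 0 \<and> A$1$1 * A$2$2 - A$1$2 * A$2$1 > 0"
      have "x \<bullet> (A *v x) > 0" if "x \<noteq> 0" for x
      proof -
        have "?a * (x \<bullet> (A *v x)) > 0"
        proof (cases "x$2 = 0")
          case True
          then have "x$1 \<noteq> 0" using that by (auto simp: vec_eq_iff forall_2)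
          then show ?thesis unfolding q' using True h by simp
        next
          case False
          then show ?thesis unfolding q' using h
            by (intro add_nonneg_pos) auto
        qed
        then show ?thesis using h by (simp add: zero_less_mult_iff)
      qed
      then show "spd A" using t h by (simp add: spd_def)
    qed
  qed (use t in \<open>auto simp: spd_def\<close>)
qed

text \<open>If \<open>B\<close> is the positive root of \<open>A\<close>, Cayley-Hamilton reads
  \<open>A + det B * I = tr B * B\<close>, where \<open>det B = sqrt (det A) = s\<close> and
  \<open>(tr B)^2 = tr A + 2 s\<close>. A closed formula in the entries also gives measurability of
  the root.\<close>

definition sqrt_matrix :: "real^2^2 \<Rightarrow> real^2^2" where
  "sqrt_matrix A = (let s = sqrt (det A) in (1 / sqrt (trace A + 2 * s)) *\<^sub>R (A + s *\<^sub>R mat 1))"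

lemma mat_1_entries: "(mat 1 :: real^2^2) $ 1 $ 1 = 1" "(mat 1 :: real^2^2) $ 1 $ 2 = 0"
   "(mat 1 :: real^2^2) $ 2 $ 1 = 0" "(mat 1 :: real^2^2) $ 2 $ 2 = 1"
  by (auto simp: mat_def)

lemma spd_pos:
  assumes "spd (A :: real^2^2)"
  shows "A$1$1 > 0" "A$2$2 > 0" "det A > 0" "trace A > 0"
proof -
  note h = assms[unfolded spd2_iff]
  show 1: "A$1$1 > 0" "det A > 0" using h by (auto simp: det_2)
  have "A$1$1 * A$2$2 > A$1$2 * A$1$2" using h by auto
  moreover have "A$1$2 * A$1$2 \<ge> 0" by simp
  ultimately have "A$1$1 * A$2$2 > 0" by linarith
  then show 2: "A$2$2 > 0" using 1 by (simp add: zero_less_mult_iff)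
  show "trace A > 0" using 1 2 by (simp add: trace_def sum_2)
qed

lemma matrix_mult_2: "((A :: real^2^2) ** B) $ i $ j = A$i$1 * B$1$j + A$i$2 * B$2$j"
  by (simp add: matrix_matrix_mult_def sum_2)

lemma sqrt_matrix:
  assumes A: "spd (A :: real^2^2)"
  shows "spd (sqrt_matrix A)" "sqrt_matrix A ** sqrt_matrix A = A"
proof -
  define s where "s = sqrt (det A)"
  define t where "t = sqrt (trace A + 2 * s)"
  note p = spd_pos[OF A]
  have s: "s > 0" "s * s = det A" using p by (auto simp: s_def)
  have t: "t > 0" "t * t = trace A + 2 * s" using p s by (auto simp: t_def)
  have sy: "A$2$1 = A$1$2" using A by (simp add: spd2_iff)
  have eq: "sqrt_matrix A = (1 / t) *\<^sub>R (A + s *\<^sub>R mat 1)"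
    by (simp add: sqrt_matrix_def s_def t_def Let_def)
  have dA: "A$1$1 * A$2$2 - A$1$2 * A$1$2 = s * s" using s by (simp add: det_2 sy)
  have "(A$1$1 + s) * (A$2$2 + s) - A$1$2 * A$1$2 > 0"
  proof -
    have "(A$1$1 + s) * (A$2$2 + s) - A$1$2 * A$1$2 = s * s + s * (A$1$1 + A$2$2) + s * s"
      using dA by (simp add: algebra_simps)
    also have "\<dots> > 0" using s p by (auto intro!: add_pos_pos mult_pos_pos)
    finally show ?thesis .
  qed
  then have "((A$1$1 + s) * (A$2$2 + s) - A$1$2 * A$1$2) / (t * t) > 0" using t(1) by simp
  then show "spd (sqrt_matrix A)"
    unfolding spd2_iff eq using s(1) t(1) p
    by (simp add: mat_1_entries sy diff_divide_distrib)
  have tr: "A$1$1 + A$2$2 + 2 * s = t * t" using t by (simp add: trace_def sum_2)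
  have "(A + s *\<^sub>R mat 1) ** (A + s *\<^sub>R mat 1) = (t * t) *\<^sub>R A"
    unfolding vec_eq_iff forall_2 tr[symmetric]
    using dA by (simp add: matrix_mult_2 mat_1_entries sy algebra_simps)
  moreover have sc: "(c *\<^sub>R X) ** (c *\<^sub>R X) = (c * c) *\<^sub>R (X ** X)" for c and X :: "real^2^2"
    by (simp add: vec_eq_iff matrix_mult_2 algebra_simps)
  ultimately show "sqrt_matrix A ** sqrt_matrix A = A"
    unfolding eq sc using t(1) by simp
qed

text \<open>By Cayley-Hamilton the root is determined by its trace and determinant, and positivity
  of these two fixes the signs of the scalar square roots.\<close>

lemma sqrt_matrix_unique:
  assumes B: "spd (B :: real^2^2)" and A: "B ** B = A"
  shows "B = sqrt_matrix A"
proof -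
  note p = spd_pos[OF B]
  have sy: "B$2$1 = B$1$2" using B by (simp add: spd2_iff)
  have "det A = det B * det B" using A det_mul by blast
  then have s: "sqrt (det A) = det B" using p by simp
  have "trace A + 2 * det B = trace B * trace B"
    by (simp add: A[symmetric] trace_def sum_2 matrix_mult_2 det_2 algebra_simps)
  then have t: "sqrt (trace A + 2 * sqrt (det A)) = trace B" using p unfolding s by simp
  have "A + det B *\<^sub>R mat 1 = trace B *\<^sub>R B"
    unfolding A[symmetric] vec_eq_iff forall_2
    by (simp add: matrix_mult_2 mat_1_entries trace_def sum_2 det_2 algebra_simps)
  then show ?thesis unfolding sqrt_matrix_def Let_def t unfolding s using p by simp
qed

text \<open>The adjugate formula. It gives entries that depend measurably on \<open>A\<close>, which
  the choice hidden in \<open>matrix_inv\<close> does not show.\<close>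

definition inv2 :: "real^2^2 \<Rightarrow> real^2^2" where
  "inv2 A = (1 / det A) *\<^sub>R vector [vector [A$2$2, - (A$1$2)], vector [- (A$2$1), A$1$1]]"

lemma inv2_entries:
  "inv2 A $ 1 $ 1 = A$2$2 / det A" "inv2 A $ 1 $ 2 = - (A$1$2) / det A"
  "inv2 A $ 2 $ 1 = - (A$2$1) / det A" "inv2 A $ 2 $ 2 = A$1$1 / det A"
  by (simp_all add: inv2_def)

lemma inv2:
  assumes "spd (A :: real^2^2)" shows "matrix_inv A = inv2 A" "spd (inv2 A)"
proof -
  note p = spd_pos[OF assms]
  have sy: "A$2$1 = A$1$2" using assms by (simp add: spd2_iff)
  have d: "A$1$1 * A$2$2 - A$1$2 * A$1$2 = det A" by (simp add: det_2 sy)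
  show "matrix_inv A = inv2 A"
  proof (rule matrix_inv_unique)
    show "A ** inv2 A = mat 1" "inv2 A ** A = mat 1"
      unfolding vec_eq_iff forall_2 using d p
      by (simp_all add: matrix_mult_2 mat_1_entries inv2_entries sy field_simps)
  qed
  have "A$2$2 / det A * (A$1$1 / det A) - A$1$2 / det A * (A$1$2 / det A) = det A / (det A * det A)"
    unfolding d[symmetric] by (simp add: field_simps diff_divide_distrib)
  then have "A$2$2 / det A * (A$1$1 / det A) - A$1$2 / det A * (A$1$2 / det A) > 0" using p by simp
  then show "spd (inv2 A)"
    unfolding spd2_iff using p by (simp add: inv2_entries sy)
qed

lemma inv_sqrt_eq:
  assumes "spd A" shows "inv_sqrt A = sqrt_matrix (inv2 A)"
  unfolding inv_sqrt_def inv2(1)[OF assms]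
proof (rule the_equality)
  show "spd (sqrt_matrix (inv2 A)) \<and> sqrt_matrix (inv2 A) ** sqrt_matrix (inv2 A) = inv2 A"
    using sqrt_matrix[OF inv2(2)[OF assms]] by blast
qed (use sqrt_matrix_unique in blast)

lemma inv_sqrt_properties:
  assumes "spd A"
  shows "inv_sqrt A ** inv_sqrt A = matrix_inv A" "transpose (inv_sqrt A) = inv_sqrt A"
  using sqrt_matrix[OF inv2(2)[OF assms]] inv2(1)[OF assms] unfolding inv_sqrt_eq[OF assms]
  by (simp_all add: spd_def)

lemma norm_matrix_vector_le: "norm ((A :: real^2^2) *v x) \<le> norm A * norm x"
proof (rule power2_le_imp_le)
  have "(norm (A *v x))\<^sup>2 = (\<Sum>i\<in>UNIV. (A $ i \<bullet> x)\<^sup>2)"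
    by (simp add: norm_vec_power2 matrix_vector_mult_def inner_vec_def)
  also have "\<dots> \<le> (\<Sum>i\<in>UNIV. (norm (A $ i))\<^sup>2 * (norm x)\<^sup>2)"
    by (rule sum_mono) (use Cauchy_Schwarz_ineq in \<open>auto simp: power2_norm_eq_inner\<close>)
  also have "\<dots> = (norm A * norm x)\<^sup>2"
    by (simp add: norm_vec_power2[of A] power_mult_distrib sum_distrib_right)
  finally show "(norm (A *v x))\<^sup>2 \<le> (norm A * norm x)\<^sup>2" .
qed simp

section \<open>Measurability of the inverse permeability and its square root\<close>

lemma borel_measurable_matrixI:
  fixes f :: "'a \<Rightarrow> real^2^2"
  assumes "\<And>i j. (\<lambda>x. f x $ i $ j) \<in> borel_measurable M" shows "f \<in> borel_measurable M"
  by (subst borel_measurable_euclidean_space)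
    (use assms in \<open>auto simp: Basis_vec_def inner_axis\<close>)

lemma borel_measurable_vecI:
  fixes f :: "'a \<Rightarrow> real^2"
  assumes "\<And>i. (\<lambda>x. f x $ i) \<in> borel_measurable M" shows "f \<in> borel_measurable M"
  by (subst borel_measurable_euclidean_space)
    (use assms in \<open>auto simp: Basis_vec_def inner_axis\<close>)

lemma borel_measurable_vec_nth:
  fixes f :: "'a \<Rightarrow> 'b::euclidean_space^'n"
  assumes "f \<in> borel_measurable M" shows "(\<lambda>x. f x $ i) \<in> borel_measurable M"
  by (rule measurable_compose[OF assms]) (intro borel_measurable_continuous_onI continuous_intros)

lemma borel_measurable_inv2:
  assumes "f \<in> borel_measurable M" shows "(\<lambda>x. inv2 (f x)) \<in> borel_measurable M"
proof (rule borel_measurable_matrixI)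
  have [measurable]: "(\<lambda>x. f x $ i $ j) \<in> borel_measurable M" for i j
    by (intro borel_measurable_vec_nth assms)
  show "(\<lambda>x. inv2 (f x) $ i $ j) \<in> borel_measurable M" for i j
    using exhaust_2[of i] exhaust_2[of j] by (auto simp: inv2_entries det_2)
qed

lemma borel_measurable_sqrt_matrix:
  assumes "f \<in> borel_measurable M" shows "(\<lambda>x. sqrt_matrix (f x)) \<in> borel_measurable M"
proof (rule borel_measurable_matrixI)
  have [measurable]: "(\<lambda>x. f x $ i $ j) \<in> borel_measurable M" for i j
    by (intro borel_measurable_vec_nth assms)
  show "(\<lambda>x. sqrt_matrix (f x) $ i $ j) \<in> borel_measurable M" for i j
    unfolding sqrt_matrix_def Let_def trace_def sum_2 det_2 by simp
qed

lemma borel_measurable_matrix_vector_mult: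
  assumes "f \<in> borel_measurable M" "g \<in> borel_measurable M"
  shows "(\<lambda>x. (f x :: real^2^2) *v g x) \<in> borel_measurable M"
proof (rule borel_measurable_vecI)
  have [measurable]: "(\<lambda>x. f x $ i $ j) \<in> borel_measurable M" "(\<lambda>x. g x $ i) \<in> borel_measurable M" for i j
    by (intro borel_measurable_vec_nth assms)+
  show "(\<lambda>x. (f x *v g x) $ i) \<in> borel_measurable M" for i
    by (simp add: matrix_vector_mult_def)
qed

text \<open>Both fields are defined pointwise by description or choice; since
  \<open>\<kappa>\<close> is positive definite everywhere on \<Omega>, they agree there with
  explicit expressions in the entries of \<open>\<kappa>\<close>.\<close>

lemma permeability_inv_sqrt:
  assumes "permeability \<Omega> \<kappa>"
  shows "(\<lambda>x. inv_sqrt (\<kappa> x)) \<in> borel_measurable (lebesgue_on \<Omega>)"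
    "(\<lambda>x. matrix_inv (\<kappa> x)) \<in> borel_measurable (lebesgue_on \<Omega>)"
proof -
  have s: "spd (\<kappa> x)" if "x \<in> space (lebesgue_on \<Omega>)" for x
    using assms that by (auto simp: permeability_def space_restrict_space)
  have m: "\<kappa> \<in> borel_measurable (lebesgue_on \<Omega>)" using assms by (simp add: permeability_def)
  show "(\<lambda>x. inv_sqrt (\<kappa> x)) \<in> borel_measurable (lebesgue_on \<Omega>)"
    by (subst measurable_cong[OF inv_sqrt_eq[OF s]]) (simp_all add: borel_measurable_sqrt_matrix[OF borel_measurable_inv2[OF m]])
  show "(\<lambda>x. matrix_inv (\<kappa> x)) \<in> borel_measurable (lebesgue_on \<Omega>)"
    by (subst measurable_cong[OF inv2(1)[OF s]]) (simp_all add: borel_measurable_inv2[OF m])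
qed

section \<open>Projections onto affine fields\<close>

lemma AE_zero_imp_zero:
  fixes f :: "real^2 \<Rightarrow> 'b::real_normed_vector"
  assumes U: "open U" and f: "continuous_on U f" and z: "AE x in lebesgue_on U. f x = 0" and x: "x \<in> U"
  shows "f x = 0"
proof (rule ccontr)
  assume "f x \<noteq> 0"
  define W where "W = U \<inter> f -` (- {0})"
  have "open W" unfolding W_def using f U by (intro continuous_open_preimage) auto
  moreover have "W \<noteq> {}" using x \<open>f x \<noteq> 0\<close> by (auto simp: W_def)
  moreover have "negligible W"
  proof -
    have "AE x in lebesgue. x \<notin> W"
      using z U by (auto simp: AE_restrict_space_iff W_def elim: eventually_mono)
    moreover have "W \<in> sets lebesgue" using \<open>open W\<close> by auto
    ultimately show ?thesis by (simp add: negligible_iff_null_sets AE_iff_null_sets)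
  qed
  ultimately show False using open_not_negligible by blast
qed

lemma affine_zero_on_open:
  fixes A :: "real^2^2"
  assumes "open U" "x \<in> U" "\<And>x. x \<in> U \<Longrightarrow> c + A *v x = 0"
  shows "c = 0" "A = 0"
proof -
  obtain e where e: "e > 0" "ball x e \<subseteq> U" using assms(1,2) openE by blast
  have "A *v axis j 1 = 0" for j
  proof -
    have "x + (e/2) *\<^sub>R axis j 1 \<in> U" using e by (intro subsetD[OF e(2)]) (simp add: dist_norm)
    then have "c + A *v (x + (e/2) *\<^sub>R axis j 1) = 0" "c + A *v x = 0" using assms(2,3) by auto
    moreover have "(e/2) *\<^sub>R (A *v axis j 1) = (c + A *v (x + (e/2) *\<^sub>R axis j 1)) - (c + A *v x)"
      by (simp add: matrix_vector_right_distrib matrix_vector_mult_scaleR)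
    ultimately have "(e/2) *\<^sub>R (A *v axis j 1) = 0" by simp
    then show ?thesis using e(1) by simp
  qed
  then show "A = 0" by (simp add: matrix_vector_mult_basis column_def vec_eq_iff)
  then show "c = 0" using assms(3)[OF assms(2)] by simp
qed

lemma P1_affine: "P1 (\<lambda>x. c + A *v x)"
  by (auto simp: P1_def)

lemma P1_L2: "P1 p \<Longrightarrow> open U \<Longrightarrow> bounded U \<Longrightarrow> L2 U p"
  by (auto simp: P1_def intro!: L2_continuous continuous_intros matrix_vector_mult_linear_continuous_on)

lemma P1_diff: "P1 p \<Longrightarrow> P1 q \<Longrightarrow> P1 (\<lambda>x. p x - q x)"
  unfolding P1_def
proof (elim exE)
  fix c c' and A A' :: "real^2^2"
  assume "p = (\<lambda>x. c + A *v x)" "q = (\<lambda>x. c' + A' *v x)"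
  then have "(\<lambda>x. p x - q x) = (\<lambda>x. (c - c') + (A - A') *v x)"
    by (simp add: fun_eq_iff matrix_vector_mult_diff_rdistrib)
  then show "\<exists>c A. (\<lambda>x. p x - q x) = (\<lambda>x. c + A *v x)" by blast
qed

lemma P1_zero: "P1 (\<lambda>x. 0)"
  unfolding P1_def by (intro exI[of _ 0] exI[of _ "0::real^2^2"]) simp

lemma l2_inner_diff_left:
  "L2 D f \<Longrightarrow> L2 D g \<Longrightarrow> L2 D h \<Longrightarrow> l2_inner D (\<lambda>x. f x - g x) h = l2_inner D f h - l2_inner D g h"
  unfolding l2_inner_def by (simp add: inner_diff_left L2_inner_integrable)

lemma l2_inner_self: "l2_inner D f f = l2_sq D f"
  by (simp add: l2_inner_def l2_sq_def power2_norm_eq_inner)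

text \<open>The six moments of a field against the coordinate basis of the affine fields, packed so
  that their inner product with coefficients \<open>(c, A)\<close> is the \<open>L2\<close> product
  with \<open>c + A x\<close>. Projecting becomes a square linear system.\<close>

definition moments :: "(real^2) set \<Rightarrow> (real^2 \<Rightarrow> real^2) \<Rightarrow> (real^2) \<times> (real^2^2)" where
  "moments U w = ((\<chi> i. LINT x|lebesgue_on U. w x $ i), (\<chi> i j. LINT x|lebesgue_on U. w x $ i * x $ j))"

context
  fixes U :: "(real^2) set"
  assumes U: "open U" "bounded U"
begin

lemma L2_coordinate: "L2 U (\<lambda>x. x $ j)"
  by (rule smooth_L2[OF smooth_component U(2,1)])

lemma moment_integrable:
  assumes "L2 U w"
  shows "integrable (lebesgue_on U) (\<lambda>x. (w x :: real^2) $ i)" "integrable (lebesgue_on U) (\<lambda>x. w x $ i * x $ j)"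
  using L2_vec_component[OF assms] L2_coordinate U
  by (auto intro!: L2_integrable L2_mult_integrable bounded_set_imp_lmeasurable)

lemma moments_inner:
  assumes "L2 U w"
  shows "(c, A) \<bullet> moments U w = l2_inner U w (\<lambda>x. c + A *v x)"
proof -
  have "l2_inner U w (\<lambda>x. c + A *v x) = (LINT x|lebesgue_on U.
      c $ 1 * w x $ 1 + c $ 2 * w x $ 2 + (A $ 1 $ 1 * (w x $ 1 * x $ 1) + A $ 1 $ 2 * (w x $ 1 * x $ 2)
      + (A $ 2 $ 1 * (w x $ 2 * x $ 1) + A $ 2 $ 2 * (w x $ 2 * x $ 2))))"
    unfolding l2_inner_def by (simp add: inner_vec_def sum_2 matrix_vector_mult_def algebra_simps)
  also have "\<dots> = (c, A) \<bullet> moments U w"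
    using moment_integrable[OF assms] by (simp add: moments_def inner_vec_def sum_2)
  finally show ?thesis ..
qed

lemma linear_moments_affine: "linear (\<lambda>(c, A). moments U (\<lambda>x. c + A *v x))"
proof (rule linearI)
  note i = moment_integrable[OF P1_L2[OF P1_affine U]]
  show "(\<lambda>(c, A). moments U (\<lambda>x. c + A *v x)) (y + z)
      = (\<lambda>(c, A). moments U (\<lambda>x. c + A *v x)) y + (\<lambda>(c, A). moments U (\<lambda>x. c + A *v x)) z" for y z
  proof -
    obtain c A where y: "y = (c, A)" by (cases y)
    obtain c' A' where z: "z = (c', A')" by (cases z)
    have eq: "(\<lambda>x. c + c' + (A + A') *v x) = (\<lambda>x. (c + A *v x) + (c' + A' *v x))"
      by (simp add: matrix_vector_mult_add_rdistrib algebra_simps)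
    have "moments U (\<lambda>x. (c + A *v x) + (c' + A' *v x)) = moments U (\<lambda>x. c + A *v x) + moments U (\<lambda>x. c' + A' *v x)"
      unfolding moments_def vector_add_component[of "c + A *v _" "c' + A' *v _"] distrib_right
      by (simp only: Bochner_Integration.integral_add[OF i(1) i(1)] Bochner_Integration.integral_add[OF i(2) i(2)])
        (simp add: vec_eq_iff)
    then show ?thesis unfolding y z eq[symmetric] by (simp add: eq)
  qed
  show "(\<lambda>(c, A). moments U (\<lambda>x. c + A *v x)) (r *\<^sub>R y) = r *\<^sub>R (\<lambda>(c, A). moments U (\<lambda>x. c + A *v x)) y" for r y
  proof -
    obtain c A where y: "y = (c, A)" by (cases y)
    have eq: "(\<lambda>x. r *\<^sub>R c + (r *\<^sub>R A) *v x) = (\<lambda>x. r *\<^sub>R (c + A *v x))"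
      by (simp add: scaleR_matrix_vector_assoc[symmetric] scaleR_right_distrib)
    have "moments U (\<lambda>x. r *\<^sub>R (c + A *v x)) = r *\<^sub>R moments U (\<lambda>x. c + A *v x)"
      unfolding moments_def vector_scaleR_component[of r "c + A *v _"] real_scaleR_def mult.assoc
      by (simp only: integral_mult_right_zero) (simp add: vec_eq_iff)
    then show ?thesis unfolding y by (simp add: eq)
  qed
qed

lemma P1_norm_zero:
  assumes "P1 p" "U \<noteq> {}" "l2_sq U p = 0" obtains "p = (\<lambda>x. 0)"
proof -
  obtain c A where p: "p = (\<lambda>x. c + A *v x)" using assms(1) by (auto simp: P1_def)
  have "AE x in lebesgue_on U. p x = 0" by (rule l2_sq_eq_0_AE[OF P1_L2[OF assms(1) U] assms(3)])
  moreover have "continuous_on U p" unfolding p by (intro continuous_intros matrix_vector_mult_linear_continuous_on)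
  ultimately have "\<And>x. x \<in> U \<Longrightarrow> c + A *v x = 0" using AE_zero_imp_zero[OF U(1)] p by blast
  moreover obtain x where "x \<in> U" using assms(2) by blast
  ultimately have "c = 0" "A = 0" using affine_zero_on_open[OF U(1)] by blast+
  then show thesis using that p by simp
qed

text \<open>The map from coefficients to moments is the Gram operator of the affine fields. A field
  in its kernel is orthogonal to itself, hence zero; so the operator is injective, in finite
  dimension surjective, and attains the moments of \<open>v\<close>.\<close>

lemma L2_projection_exists:
  assumes "U \<noteq> {}" "L2 U v"
  shows "\<exists>p. P1 p \<and> (\<forall>q. P1 q \<longrightarrow> l2_inner U (\<lambda>x. v x - p x) q = 0)"
proof -
  let ?L = "\<lambda>(c, A). moments U (\<lambda>x. c + A *v x)"
  have "inj ?L"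
  proof (subst linear_injective_0[OF linear_moments_affine], intro allI impI)
    fix y assume y: "?L y = 0"
    obtain c A where cA: "y = (c, A)" by (cases y)
    let ?p = "\<lambda>x. c + A *v x"
    have "l2_sq U ?p = (c, A) \<bullet> moments U ?p"
      using moments_inner[OF P1_L2[OF P1_affine U]] by (simp add: l2_inner_self)
    also have "\<dots> = 0" using y cA by simp
    finally have "?p = (\<lambda>x. 0)" using P1_norm_zero[OF P1_affine assms(1)] by blast
    then have "c = 0" "A = 0" using affine_zero_on_open[of UNIV 0 c A] by (auto simp: fun_eq_iff)
    then show "y = 0" by (simp add: cA zero_prod_def)
  qed
  then have "surj ?L" by (rule linear_injective_imp_surjective[OF linear_moments_affine _ refl])
  from surjD[OF this, of "moments U v"] obtain y where y: "?L y = moments U v" by (metis (no_types))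
  obtain c A where cA: "y = (c, A)" by (cases y)
  let ?p = "\<lambda>x. c + A *v x"
  have "l2_inner U (\<lambda>x. v x - ?p x) q = 0" if "P1 q" for q
  proof -
    obtain d B where q: "q = (\<lambda>x. d + B *v x)" using \<open>P1 q\<close> by (auto simp: P1_def)
    have "l2_inner U v q = l2_inner U ?p q"
      using moments_inner[OF assms(2), of d B] moments_inner[OF P1_L2[OF P1_affine U], of d B c A] y cA q by simp
    then show ?thesis
      using l2_inner_diff_left[OF assms(2) P1_L2[OF P1_affine U] P1_L2[OF \<open>P1 q\<close> U]] by simp
  qed
  then show ?thesis using P1_affine by blast
qed

lemma L2_projection_unique:
  assumes "U \<noteq> {}" "L2 U v" "P1 p" "\<And>q. P1 q \<Longrightarrow> l2_inner U (\<lambda>x. v x - p x) q = 0"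
    "P1 p'" "\<And>q. P1 q \<Longrightarrow> l2_inner U (\<lambda>x. v x - p' x) q = 0"
  shows "p = p'"
proof -
  let ?d = "\<lambda>x. p x - p' x"
  note d = P1_diff[OF assms(3,5)]
  note L = P1_L2[OF _ U]
  have "l2_inner U v ?d - l2_inner U p ?d = 0" "l2_inner U v ?d - l2_inner U p' ?d = 0"
    using assms(4)[OF d] assms(6)[OF d] l2_inner_diff_left[OF assms(2) L[OF assms(3)] L[OF d]]
      l2_inner_diff_left[OF assms(2) L[OF assms(5)] L[OF d]] by simp_all
  then have "l2_inner U ?d ?d = 0"
    using l2_inner_diff_left[OF L[OF assms(3)] L[OF assms(5)] L[OF d]] by simp
  then have "?d = (\<lambda>x. 0)" using P1_norm_zero[OF d assms(1)] by (auto simp: l2_inner_self)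
  then show ?thesis by (simp add: fun_eq_iff)
qed

end

lemma proj_L2_eqI:
  assumes "open (cell E)" "bounded (cell E)" "cell E \<noteq> {}" "L2 (cell E) v" "P1 p"
    "\<And>q. P1 q \<Longrightarrow> l2_inner (cell E) (\<lambda>x. v x - p x) q = 0"
  shows "proj_L2 E v = p"
  unfolding proj_L2_def
  by (rule the_equality) (use assms L2_projection_unique[OF assms(1-4)] in blast)+

lemma proj_L2_properties:
  assumes "open (cell E)" "bounded (cell E)" "cell E \<noteq> {}" "L2 (cell E) v"
  shows "P1 (proj_L2 E v)" "\<And>q. P1 q \<Longrightarrow> l2_inner (cell E) (\<lambda>x. v x - proj_L2 E v x) q = 0"
    "proj_L2 E (\<lambda>x. v x - proj_L2 E v x) = (\<lambda>x. 0)"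
proof -
  obtain p where p: "P1 p" "\<And>q. P1 q \<Longrightarrow> l2_inner (cell E) (\<lambda>x. v x - p x) q = 0"
    using L2_projection_exists[OF assms] by blast
  have eq: "proj_L2 E v = p" by (rule proj_L2_eqI[OF assms p])
  show "P1 (proj_L2 E v)" "\<And>q. P1 q \<Longrightarrow> l2_inner (cell E) (\<lambda>x. v x - proj_L2 E v x) q = 0"
    unfolding eq by (fact p)+
  show "proj_L2 E (\<lambda>x. v x - proj_L2 E v x) = (\<lambda>x. 0)"
    unfolding eq by (rule proj_L2_eqI[OF assms(1-3)])
      (use p P1_zero L2_diff[OF assms(4) P1_L2[OF p(1) assms(1,2)]] in auto)
qed

section \<open>The gradient projection in closed form\<close>

lemma vertex_mean_affine:
  assumes "E \<noteq> []" shows "vertex_mean E (\<lambda>x. c + A *v x) = c + A *v vertex_mean E (\<lambda>x. x)"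
proof -
  have *: "(\<Sum>x\<leftarrow>xs. c + A *v x) = real (length xs) *\<^sub>R c + A *v (\<Sum>x\<leftarrow>xs. x)" for xs
    by (induction xs) (auto simp: algebra_simps matrix_vector_right_distrib)
  show ?thesis using assms unfolding vertex_mean_def *
    by (simp add: scaleR_right_distrib matrix_vector_mult_scaleR)
qed

lemma vertex_mean_diff:
  assumes "\<And>x. x \<in> set E \<Longrightarrow> h x = f x - g x"
  shows "vertex_mean E h = vertex_mean E f - vertex_mean E g"
proof -
  have "(\<Sum>x\<leftarrow>xs. h x) = (\<Sum>x\<leftarrow>xs. f x) - (\<Sum>x\<leftarrow>xs. g x)" if "set xs \<subseteq> set E" for xs
    using that assms by (induction xs) (auto simp: algebra_simps)
  then show ?thesis unfolding vertex_mean_def by (simp add: scaleR_right_diff_distrib)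
qed

definition mean_matrix :: "(real^2) set \<Rightarrow> (real^2 \<Rightarrow> real^2^2) \<Rightarrow> real^2^2" where
  "mean_matrix U G = (\<chi> i j. (LINT x|lebesgue_on U. G x $ i $ j) / measure lebesgue U)"

text \<open>Gradients of affine fields are constant, so the orthogonality condition sees
  \<open>v\<close> only through its mean gradient: it forces the slope to be that mean, and the
  vertex average then fixes the constant term.\<close>

lemma proj_grad_eq:
  assumes U: "open (cell E)" "bounded (cell E)" "cell E \<noteq> {}" and G: "has_grad (cell E) v G" and E: "E \<noteq> []"
  defines "A \<equiv> mean_matrix (cell E) G"
  shows "proj_grad E v = (\<lambda>x. vertex_mean E (btrace E v) - A *v vertex_mean E (\<lambda>x. x) + A *v x)"
proof -
  let ?U = "cell E"
  have Um: "?U \<in> lmeasurable" using U by (intro bounded_set_imp_lmeasurable) auto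
  have pos: "measure lebesgue ?U > 0"
    using open_not_negligible[OF U(1,3)] Um negligible_iff_measure0[OF Um]
    by (metis less_eq_real_def measure_nonneg)
  interpret finite_measure "lebesgue_on ?U" by (rule finite_measure_lebesgue_on[OF Um])
  have m: "measure (lebesgue_on ?U) (space (lebesgue_on ?U)) = measure lebesgue ?U"
    using U by (simp add: measure_restrict_space space_restrict_space)
  have i: "integrable (lebesgue_on ?U) (\<lambda>x. G x $ i $ j)" for i j
    using G Um by (intro L2_integrable L2_grad_component) (auto simp: has_grad_def)
  have orth: "l2_inner ?U (grad ?U (\<lambda>x. v x - (c + B *v x))) (grad ?U (\<lambda>x. d + D *v x))
      = measure lebesgue ?U * ((A - B) \<bullet> D)" for c d B D
  proof -
    note g = has_grad_diff[OF U(1,2) G has_grad_affine[OF U(1,2), of c B]]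
    note h = has_grad_affine[OF U(1,2), of d D]
    have "l2_inner ?U (grad ?U (\<lambda>x. v x - (c + B *v x))) (grad ?U (\<lambda>x. d + D *v x))
        = (LINT x|lebesgue_on ?U. (G x - B) \<bullet> D)"
      unfolding l2_inner_def
    proof (rule integral_cong_AE)
      show "(\<lambda>x. grad ?U (\<lambda>x. v x - (c + B *v x)) x \<bullet> grad ?U (\<lambda>x. d + D *v x) x) \<in> borel_measurable (lebesgue_on ?U)"
        using H1_has_grad[OF has_grad_H1[OF g]] H1_has_grad[OF has_grad_H1[OF h]]
        by (intro borel_measurable_integrable L2_inner_integrable) (auto simp: has_grad_def)
      show "(\<lambda>x. (G x - B) \<bullet> D) \<in> borel_measurable (lebesgue_on ?U)"
        using g h by (intro borel_measurable_integrable L2_inner_integrable) (auto simp: has_grad_def)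
      show "AE x in lebesgue_on ?U. grad ?U (\<lambda>x. v x - (c + B *v x)) x \<bullet> grad ?U (\<lambda>x. d + D *v x) x = (G x - B) \<bullet> D"
        using grad_AE_eq[OF U(1,2) g] grad_AE_eq[OF U(1,2) h] by eventually_elim simp
    qed
    also have "\<dots> = measure lebesgue ?U * ((A - B) \<bullet> D)"
      using i m pos by (simp add: inner_vec_def sum_2 A_def mean_matrix_def algebra_simps)
    finally show ?thesis .
  qed
  show ?thesis unfolding proj_grad_def
  proof (rule the_equality, intro conjI allI impI)
    let ?c = "vertex_mean E (btrace E v) - A *v vertex_mean E (\<lambda>x. x)"
    show "P1 (\<lambda>x. ?c + A *v x)" by (rule P1_affine)
    show "l2_inner ?U (grad ?U (\<lambda>x. v x - (?c + A *v x))) (grad ?U q) = 0" if "P1 q" for q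
      using that orth unfolding P1_def by auto
    show "vertex_mean E (btrace E v) = vertex_mean E (\<lambda>x. ?c + A *v x)"
      by (simp add: vertex_mean_affine[OF E])
    fix p assume p: "P1 p \<and> (\<forall>q. P1 q \<longrightarrow> l2_inner ?U (grad ?U (\<lambda>x. v x - p x)) (grad ?U q) = 0)
      \<and> vertex_mean E (btrace E v) = vertex_mean E p"
    then obtain c B where cB: "p = (\<lambda>x. c + B *v x)" by (auto simp: P1_def)
    \<comment> \<open>Testing with the slope \<open>A - B\<close> itself turns orthogonality into
      the vanishing of its squared norm.\<close>
    have "l2_inner ?U (grad ?U (\<lambda>x. v x - (c + B *v x))) (grad ?U (\<lambda>x. 0 + (A - B) *v x)) = 0"
      using p P1_affine unfolding cB by blast
    then have "A = B" unfolding orth using pos by simp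
    moreover have "c = ?c" using p \<open>A = B\<close> unfolding cB by (simp add: vertex_mean_affine[OF E])
    ultimately show "p = (\<lambda>x. ?c + A *v x)" unfolding cB by simp
  qed
qed

lemma mean_matrix_diff:
  assumes "U \<in> lmeasurable" "measure lebesgue U \<noteq> 0" "L2 U G"
  shows "mean_matrix U (\<lambda>x. G x - B) = mean_matrix U G - B"
proof -
  interpret finite_measure "lebesgue_on U" by (rule finite_measure_lebesgue_on[OF assms(1)])
  have m: "measure (lebesgue_on U) (space (lebesgue_on U)) = measure lebesgue U"
    using assms(1) by (simp add: measure_restrict_space space_restrict_space fmeasurableD)
  have i: "integrable (lebesgue_on U) (\<lambda>x. G x $ i $ j)" for i j
    using assms by (intro L2_integrable L2_grad_component)
  show ?thesis using i m assms(2) by (simp add: mean_matrix_def vec_eq_iff diff_divide_distrib)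
qed

section \<open>Traces on polygons\<close>

lemma edgeE:
  assumes "e \<in> edges E"
  obtains a b where "e = {a, b}" "a \<in> set E" "b \<in> set E" "simple_polygon E \<Longrightarrow> a \<noteq> b"
proof -
  obtain i where i: "i < length E" "e = {E ! i, E ! (Suc i mod length E)}" using assms by (auto simp: edges_def)
  have j: "Suc i mod length E < length E" using i by (intro mod_less_divisor) auto
  have "E ! i \<noteq> E ! (Suc i mod length E)" if "simple_polygon E"
  proof -
    have "distinct E" "length E \<ge> 3" using that by (auto simp: simple_polygon_def)
    moreover have "i \<noteq> Suc i mod length E"
      using i(1) \<open>length E \<ge> 3\<close> by (cases "Suc i = length E") auto
    ultimately show ?thesis using i(1) j by (simp add: nth_eq_iff_index_eq)
  qed
  then show thesis using that[OF i(2)] i(1) j by simp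
qed

lemma finite_edges: "finite (edges E)"
proof -
  have "edges E = (\<lambda>i. {E ! i, E ! (Suc i mod length E)}) ` {..<length E}" by (auto simp: edges_def)
  then show ?thesis by simp
qed

lemma vertex_in_edge: "x \<in> set E \<Longrightarrow> \<exists>e\<in>edges E. x \<in> e"
  by (auto simp: edges_def in_set_conv_nth)

lemma compact_bdry: "compact (bdry E)"
  unfolding bdry_def by (intro compact_UN finite_edges) (auto elim!: edgeE intro: finite_imp_compact_convex_hull)

lemma negligible_segment: "negligible (convex hull {a, b :: real^2})"
  by (subst negligible_convex_interior) (auto intro!: empty_interior_convex_hull simp: card_insert_if)

lemma negligible_bdry: "negligible (bdry E)"
  unfolding bdry_def by (intro negligible_Union[of "(\<lambda>e. convex hull e) ` edges E"] finite_imageI finite_edges)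
    (auto elim!: edgeE intro: negligible_segment)

lemma open_cell: "open (cell E)" and bounded_cell: "bounded (cell E)"
  unfolding cell_def using compact_bdry by (auto intro: open_inside bounded_inside compact_imp_closed compact_imp_bounded)

lemma cell_lmeasurable: "cell E \<in> lmeasurable"
  using open_cell bounded_cell by (intro bounded_set_imp_lmeasurable) auto

lemma bounded_closed_cell: "bounded (closed_cell E)"
  unfolding closed_cell_def using bounded_cell compact_imp_bounded[OF compact_bdry] by simp

lemma closed_cell_borel: "closed_cell E \<in> sets borel"
  unfolding closed_cell_def using open_cell compact_imp_closed[OF compact_bdry] by (intro sets.Un) auto

lemma AE_closed_cell: "AE x in lebesgue. x \<in> closed_cell E \<longleftrightarrow> x \<in> cell E"
proof -
  have "AE x in lebesgue. x \<notin> bdry E"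
    using negligible_bdry by (intro AE_not_in) (simp add: negligible_iff_null_sets)
  then show ?thesis by eventually_elim (auto simp: closed_cell_def)
qed

lemma edge_subset_bdry: "e \<in> edges E \<Longrightarrow> convex hull e \<subseteq> bdry E"
  by (auto simp: bdry_def)

lemma edge_paramE:
  assumes "simple_polygon E" "e \<in> edges E"
  obtains a b where "e = {a, b}" "a \<noteq> b" "edge_param e = linepath a b"
proof -
  obtain a b where ab: "e = {a, b}" "a \<noteq> b" using edgeE[OF assms(2)] assms(1) by metis
  then have "\<exists>\<gamma> a b. e = {a, b} \<and> \<gamma> = linepath a b" by blast
  from someI_ex[OF this] obtain a' b' where "e = {a', b'}" "edge_param e = linepath a' b'"
    unfolding edge_param_def by blast
  then show thesis using that ab by (metis doubleton_eq_iff)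
qed

lemma edge_len_eq: "edge_len {a, b} = dist a b"
proof (rule antisym)
  have b: "bounded {a, b}" by simp
  show "edge_len {a, b} \<le> dist a b"
    unfolding edge_len_def by (intro diameter_le) (auto simp: dist_norm norm_minus_commute)
  show "dist a b \<le> edge_len {a, b}"
    unfolding edge_len_def using diameter_bounded_bound[OF b, of a b] by simp
qed

section \<open>Planar integrals in skew coordinates\<close>

lemma Basis_real2: "(Basis :: (real^2) set) = {axis 1 1, axis 2 1}"
  by (auto simp: Basis_vec_def UNIV_2)

lemma borel_measurable_vector2:
  "(\<lambda>p. vector [fst p, snd p] :: real^2) \<in> borel_measurable (borel \<Otimes>\<^sub>M borel)"
proof (rule borel_measurable_vecI)
  show "(\<lambda>p. (vector [fst p, snd p] :: real^2) $ i) \<in> borel_measurable (borel \<Otimes>\<^sub>M borel)" for i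
    using exhaust_2[of i] by auto
qed

text \<open>Identifies the planar measure with a product measure by comparing the two on boxes,
  which opens the way to iterated integrals along lines.\<close>

lemma lborel_real2: "distr (lborel \<Otimes>\<^sub>M lborel) borel (\<lambda>p. vector [fst p, snd p]) = (lborel :: (real^2) measure)"
proof (rule lborel_eqI[symmetric])
  fix l u :: "real^2" assume le: "\<And>b. b \<in> Basis \<Longrightarrow> l \<bullet> b \<le> u \<bullet> b"
  have le': "l $ 1 \<le> u $ 1" "l $ 2 \<le> u $ 2" using le[of "axis 1 1"] le[of "axis 2 1"] by (simp_all add: Basis_real2 inner_axis)
  have m: "(\<lambda>p. vector [fst p, snd p] :: real^2) \<in> borel_measurable (lborel \<Otimes>\<^sub>M lborel)"
    using borel_measurable_vector2 by (simp cong: measurable_cong_sets sets_pair_measure_cong)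
  have v: "(\<lambda>p. vector [fst p, snd p]) -` box l u \<inter> space (lborel \<Otimes>\<^sub>M lborel) = {l$1<..<u$1} \<times> {l$2<..<u$2}"
    by (auto simp: mem_box_cart forall_2 space_pair_measure)
  have "emeasure (distr (lborel \<Otimes>\<^sub>M lborel) borel (\<lambda>p. vector [fst p, snd p])) (box l u)
      = emeasure (lborel \<Otimes>\<^sub>M lborel) ({l$1<..<u$1} \<times> {l$2<..<u$2})"
    by (subst emeasure_distr[OF m]) (auto simp: v)
  also have "\<dots> = ennreal (u$1 - l$1) * ennreal (u$2 - l$2)"
    using le' by (subst sigma_finite_measure.emeasure_pair_measure_Times[OF sigma_finite_lborel]) auto
  also have "\<dots> = (\<Prod>b\<in>Basis. (u - l) \<bullet> b)"
    using le' by (simp add: Basis_real2 inner_axis ennreal_mult axis_eq_axis)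
  finally show "emeasure (distr (lborel \<Otimes>\<^sub>M lborel) borel (\<lambda>p. vector [fst p, snd p])) (box l u) = (\<Prod>b\<in>Basis. (u - l) \<bullet> b)" .
qed simp

lemma nn_integral_real2:
  assumes [measurable]: "F \<in> borel_measurable borel"
  shows "(\<integral>\<^sup>+z. F z \<partial>lborel) = (\<integral>\<^sup>+x. \<integral>\<^sup>+y. F (vector [x, y] :: real^2) \<partial>lborel \<partial>lborel)"
proof -
  have m: "(\<lambda>p. vector [fst p, snd p] :: real^2) \<in> borel_measurable (lborel \<Otimes>\<^sub>M lborel)"
    using borel_measurable_vector2 by (simp cong: measurable_cong_sets sets_pair_measure_cong)
  have "(\<integral>\<^sup>+z. F z \<partial>lborel) = (\<integral>\<^sup>+p. F (vector [fst p, snd p]) \<partial>(lborel \<Otimes>\<^sub>M lborel))"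
    by (subst lborel_real2[symmetric], subst nn_integral_distr[OF m]) auto
  also have "\<dots> = (\<integral>\<^sup>+x. \<integral>\<^sup>+y. F (vector [x, y] :: real^2) \<partial>lborel \<partial>lborel)"
    using measurable_compose[OF m assms]
    by (subst sigma_finite_measure.nn_integral_fst[OF sigma_finite_lborel, symmetric]) auto
  finally show ?thesis .
qed

text \<open>The substitution is done one variable at a time: for fixed \<open>t\<close> put
  \<open>x = s u1 + t d1\<close>, exchange the integrals, and for fixed \<open>x\<close> put
  \<open>y = x u2 / u1 + D t\<close>. The Jacobian is \<open>u1 * D\<close>, the determinant of the
  two directions.\<close>

lemma nn_integral_skew_aux:
  fixes K :: "real \<times> real \<Rightarrow> ennreal"
  assumes [measurable]: "K \<in> borel_measurable (borel \<Otimes>\<^sub>M borel)"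
    and u: "u1 \<noteq> 0" and D: "D = d2 - d1 * u2 / u1" "D \<noteq> 0"
  shows "(\<integral>\<^sup>+s. \<integral>\<^sup>+t. K (s * u1 + t * d1, s * u2 + t * d2) \<partial>lborel \<partial>lborel)
    = ennreal (1 / (\<bar>u1\<bar> * \<bar>D\<bar>)) * (\<integral>\<^sup>+x. \<integral>\<^sup>+y. K (x, y) \<partial>lborel \<partial>lborel)"
proof -
  have "(\<integral>\<^sup>+s. \<integral>\<^sup>+t. K (s * u1 + t * d1, s * u2 + t * d2) \<partial>lborel \<partial>lborel)
      = (\<integral>\<^sup>+t. \<integral>\<^sup>+s. K (s * u1 + t * d1, s * u2 + t * d2) \<partial>lborel \<partial>lborel)"
    by (rule lborel_pair.Fubini') measurable
  also have "\<dots> = (\<integral>\<^sup>+t. ennreal (1 / \<bar>u1\<bar>) * (\<integral>\<^sup>+x. K (x, (x - t * d1) / u1 * u2 + t * d2) \<partial>lborel) \<partial>lborel)"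
  proof (rule nn_integral_cong)
    fix t
    have "(\<integral>\<^sup>+x. K (x, (x - t * d1) / u1 * u2 + t * d2) \<partial>lborel)
        = ennreal \<bar>u1\<bar> * (\<integral>\<^sup>+s. K (t * d1 + u1 * s, (t * d1 + u1 * s - t * d1) / u1 * u2 + t * d2) \<partial>lborel)"
      by (rule nn_integral_real_affine) (use u in measurable)
    also have "(\<lambda>s. K (t * d1 + u1 * s, (t * d1 + u1 * s - t * d1) / u1 * u2 + t * d2)) = (\<lambda>s. K (s * u1 + t * d1, s * u2 + t * d2))"
      using u by (simp add: algebra_simps)
    finally show "(\<integral>\<^sup>+s. K (s * u1 + t * d1, s * u2 + t * d2) \<partial>lborel)
      = ennreal (1 / \<bar>u1\<bar>) * (\<integral>\<^sup>+x. K (x, (x - t * d1) / u1 * u2 + t * d2) \<partial>lborel)"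
      using u by (simp add: mult.assoc[symmetric] ennreal_mult[symmetric])
  qed
  also have "\<dots> = ennreal (1 / \<bar>u1\<bar>) * (\<integral>\<^sup>+t. \<integral>\<^sup>+x. K (x, (x - t * d1) / u1 * u2 + t * d2) \<partial>lborel \<partial>lborel)"
    by (rule nn_integral_cmult) measurable
  also have "(\<integral>\<^sup>+t. \<integral>\<^sup>+x. K (x, (x - t * d1) / u1 * u2 + t * d2) \<partial>lborel \<partial>lborel)
      = (\<integral>\<^sup>+x. \<integral>\<^sup>+t. K (x, (x - t * d1) / u1 * u2 + t * d2) \<partial>lborel \<partial>lborel)"
    by (rule lborel_pair.Fubini') measurable
  also have "\<dots> = (\<integral>\<^sup>+x. ennreal (1 / \<bar>D\<bar>) * (\<integral>\<^sup>+y. K (x, y) \<partial>lborel) \<partial>lborel)"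
  proof (rule nn_integral_cong)
    fix x
    have "(\<integral>\<^sup>+y. K (x, y) \<partial>lborel) = ennreal \<bar>D\<bar> * (\<integral>\<^sup>+t. K (x, x / u1 * u2 + D * t) \<partial>lborel)"
      by (rule nn_integral_real_affine) (use D in measurable)
    also have "(\<lambda>t. K (x, x / u1 * u2 + D * t)) = (\<lambda>t. K (x, (x - t * d1) / u1 * u2 + t * d2))"
      using u by (simp add: D(1) field_simps)
    finally show "(\<integral>\<^sup>+t. K (x, (x - t * d1) / u1 * u2 + t * d2) \<partial>lborel) = ennreal (1 / \<bar>D\<bar>) * (\<integral>\<^sup>+y. K (x, y) \<partial>lborel)"
      using D(2) by (simp add: mult.assoc[symmetric] ennreal_mult[symmetric])
  qed
  also have "\<dots> = ennreal (1 / \<bar>D\<bar>) * (\<integral>\<^sup>+x. \<integral>\<^sup>+y. K (x, y) \<partial>lborel \<partial>lborel)"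
    by (rule nn_integral_cmult) measurable
  finally show ?thesis by (simp add: mult.assoc[symmetric] ennreal_mult[symmetric])
qed

lemma nn_integral_skew:
  fixes u d :: "real^2"
  assumes "u$1 * d$2 - u$2 * d$1 \<noteq> 0"
  obtains c where "c \<ge> 0" "\<And>F. F \<in> borel_measurable borel \<Longrightarrow>
    (\<integral>\<^sup>+s. \<integral>\<^sup>+t. F (s *\<^sub>R u + t *\<^sub>R d) \<partial>lborel \<partial>lborel) = ennreal c * (\<integral>\<^sup>+z. F z \<partial>lborel)"
proof -
  have v: "s *\<^sub>R u + t *\<^sub>R d = vector [s * u$1 + t * d$1, s * u$2 + t * d$2]" for s t
    by (simp add: vec_eq_iff forall_2)
  have m: "(\<lambda>p. F (vector [fst p, snd p])) \<in> borel_measurable (borel \<Otimes>\<^sub>M borel)"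
    if "F \<in> borel_measurable borel" for F :: "real^2 \<Rightarrow> ennreal"
    by (rule measurable_compose[OF borel_measurable_vector2 that])
  show thesis
  proof (cases "u$1 = 0")
    case False
    define D where "D = d$2 - d$1 * u$2 / u$1"
    have "D \<noteq> 0" using assms False by (auto simp: D_def field_simps)
    show thesis
    proof (rule that[of "1 / (\<bar>u$1\<bar> * \<bar>D\<bar>)"])
      fix F :: "real^2 \<Rightarrow> ennreal" assume F: "F \<in> borel_measurable borel"
      show "(\<integral>\<^sup>+s. \<integral>\<^sup>+t. F (s *\<^sub>R u + t *\<^sub>R d) \<partial>lborel \<partial>lborel) = ennreal (1 / (\<bar>u$1\<bar> * \<bar>D\<bar>)) * (\<integral>\<^sup>+z. F z \<partial>lborel)"
        unfolding v nn_integral_real2[OF F]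
        using nn_integral_skew_aux[OF m[OF F] False D_def \<open>D \<noteq> 0\<close>] by simp
    qed simp
  next
    case True
    then have u2: "u$2 \<noteq> 0" "d$1 \<noteq> 0" using assms by auto
    define D where "D = d$1 - d$2 * u$1 / u$2"
    have D: "D \<noteq> 0" using u2 True by (simp add: D_def)
    show thesis
    proof (rule that[of "1 / (\<bar>u$2\<bar> * \<bar>D\<bar>)"])
      fix F :: "real^2 \<Rightarrow> ennreal" assume F: "F \<in> borel_measurable borel"
      \<comment> \<open>The first coordinate of \<open>u\<close> vanishes here, so the two
        coordinates exchange their roles before the substitution.\<close>
      have m': "(\<lambda>p. F (vector [snd p, fst p])) \<in> borel_measurable (borel \<Otimes>\<^sub>M borel)"
        using measurable_compose[OF _ m[OF F], of "\<lambda>p. (snd p, fst p)" "borel \<Otimes>\<^sub>M borel"] by simp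
      have "(\<integral>\<^sup>+z. F z \<partial>lborel) = (\<integral>\<^sup>+y. \<integral>\<^sup>+x. F (vector [x, y]) \<partial>lborel \<partial>lborel)"
        unfolding nn_integral_real2[OF F] using m[OF F]
        by (intro lborel_pair.Fubini'[symmetric]) (simp add: case_prod_unfold cong: measurable_cong_sets sets_pair_measure_cong)
      then show "(\<integral>\<^sup>+s. \<integral>\<^sup>+t. F (s *\<^sub>R u + t *\<^sub>R d) \<partial>lborel \<partial>lborel) = ennreal (1 / (\<bar>u$2\<bar> * \<bar>D\<bar>)) * (\<integral>\<^sup>+z. F z \<partial>lborel)"
        unfolding v using nn_integral_skew_aux[OF m' u2(1) D_def D] by simp
    qed simp
  qed
qed

text \<open>Integrate the derivative of \<open>(t - 1) k(t)^2\<close> over [0,1]. The weight removes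
  the boundary term at 1 and leaves exactly \<open>k(0)^2\<close>; the mixed term is absorbed by the
  two squares.\<close>

lemma trace_inequality_1d:
  assumes k: "\<And>t. (k has_real_derivative k' t) (at t)" and c: "continuous_on UNIV k'"
  shows "ennreal ((k 0)\<^sup>2) \<le> (\<integral>\<^sup>+t. indicator {0..1} t * ennreal (2 * (k t)\<^sup>2 + (k' t)\<^sup>2) \<partial>lborel)"
proof -
  have ck: "continuous_on UNIV k" using k by (meson DERIV_isCont continuous_at_imp_continuous_on)
  let ?h = "\<lambda>t. 2 * (k t)\<^sup>2 + (k' t)\<^sup>2"
  let ?f = "\<lambda>t. (k t)\<^sup>2 + (t - 1) * (2 * k t * k' t)"
  have ch: "continuous_on UNIV ?h" by (intro continuous_intros ck c)
  have f: "(?f has_integral (1 - 1) * (k 1)\<^sup>2 - (0 - 1) * (k 0)\<^sup>2) {0..1}"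
  proof (rule fundamental_theorem_of_calculus)
    show "((\<lambda>t. (t - 1) * (k t)\<^sup>2) has_vector_derivative ?f t) (at t within {0..1})" for t
      unfolding has_real_derivative_iff_has_vector_derivative[symmetric]
      by (rule has_field_derivative_at_within) (auto intro!: derivative_eq_intros k simp: algebra_simps)
  qed simp
  have h: "(?h has_integral integral {0..1} ?h) {0..1}"
    using ch by (intro integrable_integral integrable_continuous_real) (auto intro: continuous_on_subset)
  have "(k 0)\<^sup>2 \<le> integral {0..1} ?h"
  proof -
    have "?f t \<le> ?h t" if "t \<in> {0..1}" for t
    proof -
      have "\<bar>(t - 1) * (2 * k t * k' t)\<bar> \<le> 1 * \<bar>2 * k t * k' t\<bar>"
        using that unfolding abs_mult by (intro mult_right_mono) auto
      also have "\<dots> \<le> (k t)\<^sup>2 + (k' t)\<^sup>2"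
        using zero_le_power2[of "\<bar>k t\<bar> - \<bar>k' t\<bar>"] by (simp add: power2_diff abs_mult)
      finally show ?thesis by linarith
    qed
    then show ?thesis using has_integral_le[OF f h] by simp
  qed
  moreover have "(\<integral>\<^sup>+t. indicator {0..1} t * ennreal (?h t) \<partial>lborel) = ennreal (integral {0..1} ?h)"
  proof -
    have eq: "(\<lambda>t. indicator {0..1} t * ?h t) = (\<lambda>t. if t \<in> {0..1} then ?h t else 0)" by auto
    have "((\<lambda>t. indicator {0..1} t * ?h t) has_integral integral {0..1} ?h) UNIV"
      unfolding eq has_integral_restrict_UNIV by (rule h)
    moreover have "?h \<in> borel_measurable borel" by (rule borel_measurable_continuous_onI[OF ch])
    ultimately have "(\<integral>\<^sup>+t. ennreal (indicator {0..1} t * ?h t) \<partial>lborel) = ennreal (integral {0..1} ?h)"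
      by (intro nn_integral_has_integral_lborel) (auto intro: borel_measurable_times)
    then show ?thesis by (simp add: ennreal_mult' ennreal_indicator)
  qed
  ultimately show ?thesis by (simp add: ennreal_leI)
qed

text \<open>On each segment that starts at a base point \<open>a + t u\<close> and runs along
  \<open>d\<close> the one-dimensional inequality holds. Integrating over the base gives an integral
  over a parallelogram in the closed cell. The constant may depend on the parallelogram: it only
  multiplies quantities that tend to 0.\<close>

lemma trace_inequality:
  fixes u d a :: "real^2"
  assumes det: "u$1 * d$2 - u$2 * d$1 \<noteq> 0"
    and P: "\<And>t s. 0 \<le> t \<Longrightarrow> t \<le> l \<Longrightarrow> 0 \<le> s \<Longrightarrow> s \<le> 1 \<Longrightarrow> a + t *\<^sub>R u + s *\<^sub>R d \<in> closed_cell E"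
  obtains c where "c \<ge> 0" "\<And>\<psi>. smooth \<psi> \<Longrightarrow>
    (LINT t|lebesgue_on {0..l}. (\<psi> (a + t *\<^sub>R u))\<^sup>2) \<le> c * (l2_sq (cell E) \<psi> + l2_sq (cell E) (\<lambda>x. \<chi> j. pd j \<psi> x))"
proof -
  obtain c0 where c0: "c0 \<ge> 0" "\<And>F. F \<in> borel_measurable borel \<Longrightarrow>
    (\<integral>\<^sup>+s. \<integral>\<^sup>+t. F (s *\<^sub>R u + t *\<^sub>R d) \<partial>lborel \<partial>lborel) = ennreal c0 * (\<integral>\<^sup>+z. F z \<partial>lborel)"
    by (rule nn_integral_skew[OF det], rule that)
  let ?c = "c0 * (2 + (norm d)\<^sup>2)"
  show thesis
  proof (rule that[of ?c])
    show "?c \<ge> 0" using c0(1) by simp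
    fix \<psi> assume \<psi>: "smooth \<psi>"
    let ?g = "\<lambda>x. \<chi> j. pd j \<psi> x"
    have c\<psi>: "continuous_on UNIV \<psi>" by (rule smooth_continuous[OF \<psi>])
    have cg: "continuous_on UNIV ?g" by (intro continuous_intros smooth_continuous smooth_pd \<psi>)
    define H where "H x = 2 * (\<psi> x)\<^sup>2 + (?g x \<bullet> d)\<^sup>2" for x
    have cH: "continuous_on UNIV H" unfolding H_def by (intro continuous_intros c\<psi> cg)
    have Hm: "H \<in> borel_measurable borel" by (rule borel_measurable_continuous_onI[OF cH])
    have H0: "H x \<ge> 0" for x by (simp add: H_def)
    \<comment> \<open>Extension by zero off the closed cell lets both integrals run over the whole
      line; by \<open>P\<close> nothing is lost on the parallelogram.\<close>
    define F where "F z = indicator (closed_cell E) (a + z) * ennreal (H (a + z))" for z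
    have ind: "(\<lambda>x. indicator (closed_cell E) x * ennreal (H x)) \<in> borel_measurable borel"
      using closed_cell_borel Hm by measurable
    have Fm: "F \<in> borel_measurable borel"
      unfolding F_def using measurable_compose[OF _ ind, of "\<lambda>z. a + z"] by simp
    have "(\<integral>\<^sup>+t. indicator {0..l} t * ennreal ((\<psi> (a + t *\<^sub>R u))\<^sup>2) \<partial>lborel)
        \<le> (\<integral>\<^sup>+t. \<integral>\<^sup>+s. F (t *\<^sub>R u + s *\<^sub>R d) \<partial>lborel \<partial>lborel)"
    proof (rule nn_integral_mono)
      fix t :: real
      show "indicator {0..l} t * ennreal ((\<psi> (a + t *\<^sub>R u))\<^sup>2) \<le> (\<integral>\<^sup>+s. F (t *\<^sub>R u + s *\<^sub>R d) \<partial>lborel)"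
      proof (cases "t \<in> {0..l}")
        case True
        let ?k = "\<lambda>s. \<psi> (a + t *\<^sub>R u + s *\<^sub>R d)" and ?k' = "\<lambda>s. ?g (a + t *\<^sub>R u + s *\<^sub>R d) \<bullet> d"
        have "(?k has_real_derivative ?k' s) (at s)" for s
        proof -
          have "((\<lambda>s. a + t *\<^sub>R u + s *\<^sub>R d) has_derivative (\<lambda>h. h *\<^sub>R d)) (at s)"
            by (auto intro!: derivative_eq_intros)
          from has_derivative_compose[OF this smooth_has_derivative[OF \<psi>]]
          show ?thesis by (simp add: has_field_derivative_def mult_commute_abs)
        qed
        moreover have "continuous_on UNIV ?k'"
          by (intro continuous_intros continuous_on_compose2[OF cg]) auto
        ultimately have "ennreal ((?k 0)\<^sup>2) \<le> (\<integral>\<^sup>+s. indicator {0..1} s * ennreal (2 * (?k s)\<^sup>2 + (?k' s)\<^sup>2) \<partial>lborel)"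
          by (rule trace_inequality_1d)
        also have "\<dots> \<le> (\<integral>\<^sup>+s. F (t *\<^sub>R u + s *\<^sub>R d) \<partial>lborel)"
        proof (rule nn_integral_mono)
          fix s :: real
          show "indicator {0..1} s * ennreal (2 * (?k s)\<^sup>2 + (?k' s)\<^sup>2) \<le> F (t *\<^sub>R u + s *\<^sub>R d)"
            using P[of t s] True by (cases "s \<in> {0..1}") (auto simp: F_def H_def add.assoc)
        qed
        finally show ?thesis using True by simp
      qed simp
    qed
    also have "\<dots> = ennreal c0 * (\<integral>\<^sup>+z. F z \<partial>lborel)" by (rule c0(2)[OF Fm])
    also have "(\<integral>\<^sup>+z. F z \<partial>lborel) = (\<integral>\<^sup>+x. indicator (closed_cell E) x * ennreal (H x) \<partial>lborel)"
    proof -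
      have "(\<integral>\<^sup>+x. indicator (closed_cell E) x * ennreal (H x) \<partial>distr lborel borel ((+) a)) = (\<integral>\<^sup>+z. F z \<partial>lborel)"
        using ind by (subst nn_integral_distr) (auto simp: F_def[abs_def])
      then show ?thesis by (simp add: lborel_distr_plus)
    qed
    also have "\<dots> = (\<integral>\<^sup>+x. indicator (closed_cell E) x * ennreal (H x) \<partial>lebesgue)"
      using ind by (simp add: nn_integral_completion)
    also have "\<dots> = (\<integral>\<^sup>+x. ennreal (H x) * indicator (cell E) x \<partial>lebesgue)"
      by (rule nn_integral_cong_AE) (use AE_closed_cell[of E] in \<open>eventually_elim, auto simp: indicator_def\<close>)
    also have "\<dots> = (\<integral>\<^sup>+x. ennreal (H x) \<partial>lebesgue_on (cell E))"
      using open_cell by (subst nn_integral_restrict_space) auto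
    also have "\<dots> = ennreal (LINT x|lebesgue_on (cell E). H x)"
    proof (rule nn_integral_eq_integral)
      have "L2 (cell E) H" by (rule L2_continuous[OF bounded_cell _ cH]) (use open_cell in auto)
      then show "integrable (lebesgue_on (cell E)) H" using cell_lmeasurable by (rule L2_integrable)
    qed (use H0 in auto)
    finally have 1: "(\<integral>\<^sup>+t. indicator {0..l} t * ennreal ((\<psi> (a + t *\<^sub>R u))\<^sup>2) \<partial>lborel)
        \<le> ennreal (c0 * (LINT x|lebesgue_on (cell E). H x))"
      using c0(1) by (simp add: ennreal_mult')
    have L\<psi>: "L2 (cell E) \<psi>" by (rule L2_continuous[OF bounded_cell _ c\<psi>]) (use open_cell in auto)
    have Lg: "L2 (cell E) ?g" by (rule L2_continuous[OF bounded_cell _ cg]) (use open_cell in auto)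
    have 2: "(LINT x|lebesgue_on (cell E). H x) \<le> (2 + (norm d)\<^sup>2) * (l2_sq (cell E) \<psi> + l2_sq (cell E) ?g)"
    proof -
      have "(LINT x|lebesgue_on (cell E). H x) \<le> (LINT x|lebesgue_on (cell E). 2 * (norm (\<psi> x))\<^sup>2 + (norm d)\<^sup>2 * (norm (?g x))\<^sup>2)"
      proof (rule integral_mono)
        have "L2 (cell E) H" by (rule L2_continuous[OF bounded_cell _ cH]) (use open_cell in auto)
        then show "integrable (lebesgue_on (cell E)) H" using cell_lmeasurable by (rule L2_integrable)
        show "integrable (lebesgue_on (cell E)) (\<lambda>x. 2 * (norm (\<psi> x))\<^sup>2 + (norm d)\<^sup>2 * (norm (?g x))\<^sup>2)"
          using L2D(2)[OF L\<psi>] L2D(2)[OF Lg] by auto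
        fix x
        have "(?g x \<bullet> d)\<^sup>2 \<le> (norm (?g x))\<^sup>2 * (norm d)\<^sup>2"
          using Cauchy_Schwarz_ineq[of "?g x" d] by (simp add: power2_norm_eq_inner)
        then show "H x \<le> 2 * (norm (\<psi> x))\<^sup>2 + (norm d)\<^sup>2 * (norm (?g x))\<^sup>2"
          by (simp add: H_def mult.commute)
      qed
      also have "\<dots> = 2 * l2_sq (cell E) \<psi> + (norm d)\<^sup>2 * l2_sq (cell E) ?g"
        using L2D(2)[OF L\<psi>] L2D(2)[OF Lg] by (simp add: l2_sq_def)
      also have "\<dots> \<le> (2 + (norm d)\<^sup>2) * (l2_sq (cell E) \<psi> + l2_sq (cell E) ?g)"
        by (simp add: algebra_simps)
      finally show ?thesis .
    qed
    have k: "continuous_on {0..l} (\<lambda>t. (\<psi> (a + t *\<^sub>R u))\<^sup>2)"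
      by (intro continuous_intros continuous_on_compose2[OF c\<psi>]) auto
    have "ennreal (LINT t|lebesgue_on {0..l}. (\<psi> (a + t *\<^sub>R u))\<^sup>2) = (\<integral>\<^sup>+t. indicator {0..l} t * ennreal ((\<psi> (a + t *\<^sub>R u))\<^sup>2) \<partial>lborel)"
    proof -
      have m: "(\<lambda>t. (\<psi> (a + t *\<^sub>R u))\<^sup>2) \<in> borel_measurable borel"
        by (intro borel_measurable_continuous_onI continuous_intros continuous_on_compose2[OF c\<psi>]) auto
      have "ennreal (LINT t|lebesgue_on {0..l}. (\<psi> (a + t *\<^sub>R u))\<^sup>2) = (\<integral>\<^sup>+t. ennreal ((\<psi> (a + t *\<^sub>R u))\<^sup>2) \<partial>lebesgue_on {0..l})"
        using k by (intro nn_integral_eq_integral[symmetric] continuous_imp_integrable_real) auto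
      also have "\<dots> = (\<integral>\<^sup>+t. ennreal ((\<psi> (a + t *\<^sub>R u))\<^sup>2) * indicator {0..l} t \<partial>lebesgue)"
        by (subst nn_integral_restrict_space) auto
      also have "\<dots> = (\<integral>\<^sup>+t. ennreal ((\<psi> (a + t *\<^sub>R u))\<^sup>2) * indicator {0..l} t \<partial>lborel)"
        using m by (intro nn_integral_completion)
      finally show ?thesis by (simp add: mult.commute)
    qed
    moreover have "0 \<le> c0 * (LINT x|lebesgue_on (cell E). H x)"
      using c0(1) H0 by (intro mult_nonneg_nonneg integral_nonneg_AE) auto
    ultimately have "(LINT t|lebesgue_on {0..l}. (\<psi> (a + t *\<^sub>R u))\<^sup>2) \<le> c0 * (LINT x|lebesgue_on (cell E). H x)"
      using 1 by (metis ennreal_le_iff)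
    also have "\<dots> \<le> c0 * ((2 + (norm d)\<^sup>2) * (l2_sq (cell E) \<psi> + l2_sq (cell E) ?g))"
      using 2 c0(1) by (rule mult_left_mono)
    finally show "(LINT t|lebesgue_on {0..l}. (\<psi> (a + t *\<^sub>R u))\<^sup>2) \<le> ?c * (l2_sq (cell E) \<psi> + l2_sq (cell E) ?g)"
      by (simp add: mult.assoc)
  qed
qed

section \<open>Uniqueness of continuous boundary traces\<close>

lemma norm_add3_power2_le:
  "(norm (x + y + z))\<^sup>2 \<le> 4 * (norm x)\<^sup>2 + 4 * (norm y)\<^sup>2 + 2 * (norm (z::'a::real_normed_vector))\<^sup>2"
  using norm_add_power2_le[of "x + y" z] norm_add_power2_le[of x y] by linarith

text \<open>Traces are defined by smooth fields that approach \<open>v\<close> in terms of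
  \<open>grad\<close>, whereas the trace inequality asks for classical derivatives of the difference
  of two such fields. Both are compared with \<open>v\<close>, which cancels.\<close>

lemma has_grad_approximation:
  assumes v: "H1 (cell E) v" and s: "\<And>i. smooth (\<lambda>x. \<phi> x $ i)" "\<And>i. smooth (\<lambda>x. \<phi>' x $ i)"
  shows "l2_sq (cell E) (\<lambda>x. (\<phi> x - \<phi>' x) $ i) + l2_sq (cell E) (\<lambda>x. \<chi> j. pd j (\<lambda>x. (\<phi> x - \<phi>' x) $ i) x)
    \<le> 2 * h1_sq (cell E) (\<lambda>x. \<phi> x - v x) + 2 * h1_sq (cell E) (\<lambda>x. \<phi>' x - v x)"
proof -
  let ?U = "cell E"
  note U = open_cell[of E] bounded_cell[of E]
  note G = H1_has_grad[OF v]
  note J = has_grad_smooth[OF U, of \<phi>, OF s(1)] and J' = has_grad_smooth[OF U, of \<phi>', OF s(2)]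
  note D = has_grad_diff[OF U J G] and D' = has_grad_diff[OF U J' G]
  note JJ = has_grad_diff[OF U J J']
  note g = H1_has_grad[OF has_grad_H1[OF D]] and g' = H1_has_grad[OF has_grad_H1[OF D']]
  have L: "L2 ?U (\<lambda>x. \<phi> x - v x)" "L2 ?U (\<lambda>x. \<phi>' x - v x)" "L2 ?U (grad ?U (\<lambda>x. \<phi> x - v x))" "L2 ?U (grad ?U (\<lambda>x. \<phi>' x - v x))"
    using g g' by (auto simp: has_grad_def)
  have ss: "smooth (\<lambda>x. (\<phi> x - \<phi>' x) $ i)" using smooth_diff[OF s(1) s(2)] by simp
  have "l2_sq ?U (\<lambda>x. (\<phi> x - \<phi>' x) $ i) \<le> l2_sq ?U (\<lambda>x. (\<phi> x - v x) + (-1) *\<^sub>R (\<phi>' x - v x))"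
  proof (rule l2_sq_mono)
    show "L2 ?U (\<lambda>x. (\<phi> x - \<phi>' x) $ i)" by (rule smooth_L2[OF ss U(2,1)])
    show "L2 ?U (\<lambda>x. (\<phi> x - v x) + (-1) *\<^sub>R (\<phi>' x - v x))" by (intro L2_add L2_scaleR L)
  qed (intro AE_I2, simp add: component_le_norm_cart flip: vector_minus_component)
  also have "\<dots> \<le> 2 * l2_sq ?U (\<lambda>x. \<phi> x - v x) + 2 * l2_sq ?U (\<lambda>x. \<phi>' x - v x)"
    using l2_sq_add_le[OF L(1) L2_scaleR[OF L(2), of "-1"]] l2_sq_scaleR[of ?U "-1" "\<lambda>x. \<phi>' x - v x"] by simp
  finally have 1: "l2_sq ?U (\<lambda>x. (\<phi> x - \<phi>' x) $ i) \<le> 2 * l2_sq ?U (\<lambda>x. \<phi> x - v x) + 2 * l2_sq ?U (\<lambda>x. \<phi>' x - v x)" .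
  have "l2_sq ?U (\<lambda>x. \<chi> j. pd j (\<lambda>x. (\<phi> x - \<phi>' x) $ i) x)
      \<le> l2_sq ?U (\<lambda>x. grad ?U (\<lambda>x. \<phi> x - v x) x + (-1) *\<^sub>R grad ?U (\<lambda>x. \<phi>' x - v x) x)"
  proof (rule l2_sq_mono)
    show "L2 ?U (\<lambda>x. \<chi> j. pd j (\<lambda>x. (\<phi> x - \<phi>' x) $ i) x)"
      by (intro L2_vecI) (simp only: vec_lambda_beta, intro smooth_L2[OF smooth_pd[OF ss] U(2,1)])
    show "L2 ?U (\<lambda>x. grad ?U (\<lambda>x. \<phi> x - v x) x + (-1) *\<^sub>R grad ?U (\<lambda>x. \<phi>' x - v x) x)" by (intro L2_add L2_scaleR L)
    have "pd j (\<lambda>x. (\<phi> x - \<phi>' x) $ i) x = pd j (\<lambda>x. \<phi> x $ i) x - pd j (\<lambda>x. \<phi>' x $ i) x" for j x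
      using pd_eqI[OF has_derivative_diff[OF smooth_has_derivative[OF s(1)] smooth_has_derivative[OF s(2)]]]
      by (simp add: inner_axis)
    then have e: "(\<chi> j. pd j (\<lambda>x. (\<phi> x - \<phi>' x) $ i) x) = ((\<chi> i j. pd j (\<lambda>x. \<phi> x $ i) x) - (\<chi> i j. pd j (\<lambda>x. \<phi>' x $ i) x)) $ i" for x
      by (simp add: vec_eq_iff)
    show "AE x in lebesgue_on ?U. norm (\<chi> j. pd j (\<lambda>x. (\<phi> x - \<phi>' x) $ i) x)
        \<le> norm (grad ?U (\<lambda>x. \<phi> x - v x) x + (-1) *\<^sub>R grad ?U (\<lambda>x. \<phi>' x - v x) x)"
      using grad_AE_eq[OF U D] grad_AE_eq[OF U D']
    proof eventually_elim
      case (elim x)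
      then have *: "(\<chi> i j. pd j (\<lambda>x. \<phi> x $ i) x) - (\<chi> i j. pd j (\<lambda>x. \<phi>' x $ i) x)
          = grad ?U (\<lambda>x. \<phi> x - v x) x + (-1) *\<^sub>R grad ?U (\<lambda>x. \<phi>' x - v x) x" by simp
      show ?case unfolding e *[symmetric] by (rule Finite_Cartesian_Product.norm_nth_le)
    qed
  qed
  also have "\<dots> \<le> 2 * l2_sq ?U (grad ?U (\<lambda>x. \<phi> x - v x)) + 2 * l2_sq ?U (grad ?U (\<lambda>x. \<phi>' x - v x))"
    using l2_sq_add_le[OF L(3) L2_scaleR[OF L(4), of "-1"]] l2_sq_scaleR[of ?U "-1" "grad ?U (\<lambda>x. \<phi>' x - v x)"] by simp
  finally show ?thesis using 1 by (simp add: h1_sq_def)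
qed

text \<open>A disc is not contained in a line: if its centre lies on the line through
  \<open>a\<close> and \<open>b\<close>, a small step along the normal leaves it. The determinant
  condition says that the triangle with apex \<open>y\<close> over the edge is not
  degenerate.\<close>

lemma star_shaped_apex:
  fixes a b :: "real^2"
  assumes "r > 0" "star_shaped_wrt S (ball x r)" "a \<noteq> b"
  obtains y where "y \<in> ball x r" "(b - a)$1 * (y - a)$2 - (b - a)$2 * (y - a)$1 \<noteq> 0"
    "\<And>z. z \<in> S \<Longrightarrow> closed_segment y z \<subseteq> S"
proof -
  let ?u = "b - a"
  let ?D = "\<lambda>y. ?u$1 * (y - a)$2 - ?u$2 * (y - a)$1"
  obtain y where "y \<in> ball x r" "?D y \<noteq> 0"
  proof (cases "?D x = 0")
    case False
    then show ?thesis using that[of x] assms(1) by simp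
  next
    case True
    define s where "s = r / (2 * norm (perp ?u) + 1)"
    have np: "norm (perp ?u) \<ge> 0" by simp
    have s: "s > 0" unfolding s_def using assms(1) np by (intro divide_pos_pos) linarith+
    have "s * norm (perp ?u) < r"
    proof -
      have "r * norm (perp ?u) < r * (2 * norm (perp ?u) + 1)"
        using assms(1) np by (intro mult_strict_left_mono) linarith+
      moreover have "2 * norm (perp ?u) + 1 > 0" using np by linarith
      ultimately show ?thesis unfolding s_def using pos_divide_less_eq[of "2 * norm (perp ?u) + 1" "r * norm (perp ?u)" r] by simp
    qed
    then have "x + s *\<^sub>R perp ?u \<in> ball x r" using s by (simp add: dist_norm)
    moreover have "?D (x + s *\<^sub>R perp ?u) = ?D x - s * (?u$1 * ?u$1 + ?u$2 * ?u$2)"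
      by (simp add: perp_def algebra_simps)
    moreover have "?u$1 * ?u$1 + ?u$2 * ?u$2 \<noteq> 0"
      using assms(3) by (auto simp: sum_squares_eq_zero_iff vec_eq_iff forall_2)
    ultimately show ?thesis using that[of "x + s *\<^sub>R perp ?u"] True s by simp
  qed
  then show thesis using that assms(2) unfolding star_shaped_wrt_def by blast
qed

text \<open>
  The triangle spanned by \<open>e\<close> and an apex \<open>y\<close> contains the parallelogram over the part
  \<open>[0, 1 - \<theta>]\<close> of \<open>e\<close> in direction \<open>\<theta>(y - a)\<close>; \<open>\<theta>\<close> tends to 0 afterwards.
\<close>

lemma trace_unique_on_edge:
  assumes E: "simple_polygon E" and r: "r > 0" "star_shaped_wrt (closed_cell E) (ball xE r)"
    and v: "H1 (cell E) v" and g: "has_trace E v g" "continuous_on (bdry E) g"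
    and g': "has_trace E v g'" "continuous_on (bdry E) g'" and e: "e \<in> edges E"
    and \<theta>: "0 < \<theta>" "\<theta> < 1" and t: "0 \<le> t" "t \<le> 1 - \<theta>"
  shows "g (edge_param e t) = g' (edge_param e t)"
proof -
  obtain a b where ab: "e = {a, b}" "a \<noteq> b" "edge_param e = linepath a b" using edge_paramE[OF E e] .
  define u where "u = b - a"
  have \<gamma>: "edge_param e t = a + t *\<^sub>R u" for t
    unfolding ab(3) linepath_def u_def by (simp add: algebra_simps)
  obtain y where y: "u$1 * (y - a)$2 - u$2 * (y - a)$1 \<noteq> 0" "\<And>z. z \<in> closed_cell E \<Longrightarrow> closed_segment y z \<subseteq> closed_cell E"
    using star_shaped_apex[OF r ab(2)] unfolding u_def by blast
  define d where "d = \<theta> *\<^sub>R (y - a)"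
  have det: "u$1 * d$2 - u$2 * d$1 \<noteq> 0"
    using y(1) \<theta> by (simp add: d_def right_diff_distrib[symmetric] mult.left_commute)
  have hull: "a + t *\<^sub>R u \<in> bdry E" if "0 \<le> t" "t \<le> 1" for t
  proof -
    have "a + t *\<^sub>R u = (1 - t) *\<^sub>R a + t *\<^sub>R b" by (simp add: u_def algebra_simps)
    then have "a + t *\<^sub>R u \<in> closed_segment a b" using that by (auto simp: in_segment)
    then show ?thesis using edge_subset_bdry[OF e] by (auto simp: ab(1) segment_convex_hull)
  qed
  have P: "a + t *\<^sub>R u + s *\<^sub>R d \<in> closed_cell E" if "0 \<le> t" "t \<le> 1 - \<theta>" "0 \<le> s" "s \<le> 1" for t s
  proof -
    \<comment> \<open>The point is a convex combination of the apex, with weight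
      \<open>1 - k\<close>, and the base point with parameter \<open>t / k\<close>; since
      \<open>t \<le> 1 - \<theta> \<le> k\<close>, the latter is still on the edge.\<close>
    define k where "k = 1 - s * \<theta>"
    have s\<theta>: "s * \<theta> \<le> \<theta>" using that \<theta> by (simp add: mult_left_le_one_le)
    then have k: "k > 0" "1 - \<theta> \<le> k" "s * \<theta> = 1 - k" using \<theta> s\<theta> unfolding k_def by linarith+
    have tk: "t / k \<le> 1" using that(2) k by simp
    let ?q = "a + (t / k) *\<^sub>R u"
    have "?q \<in> closed_cell E" using hull[of "t / k"] tk that k(1) by (simp add: closed_cell_def)
    moreover have "a + t *\<^sub>R u + s *\<^sub>R d = (1 - k) *\<^sub>R y + k *\<^sub>R ?q"
      using k(1) unfolding d_def scaleR_scaleR k(3) by (simp add: algebra_simps)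
    moreover have "(1 - k) *\<^sub>R y + k *\<^sub>R ?q \<in> closed_segment y ?q"
    proof -
      have "k \<le> 1" using that \<theta> by (simp add: k_def)
      then show ?thesis using k(1) unfolding in_segment by (intro exI[of _ k]) simp
    qed
    ultimately show ?thesis using y(2) by auto
  qed
  obtain c where c: "c \<ge> 0" "\<And>\<psi>. smooth \<psi> \<Longrightarrow>
    (LINT t|lebesgue_on {0..1-\<theta>}. (\<psi> (a + t *\<^sub>R u))\<^sup>2) \<le> c * (l2_sq (cell E) \<psi> + l2_sq (cell E) (\<lambda>x. \<chi> j. pd j \<psi> x))"
    by (rule trace_inequality[OF det P], assumption+, rule that)
  obtain \<phi> where \<phi>: "\<And>n i. smooth (\<lambda>x. \<phi> n x $ i)" "(\<lambda>n. h1_sq (cell E) (\<lambda>x. \<phi> n x - v x)) \<longlonglongrightarrow> 0"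
      "(\<lambda>n. edge_sq e (\<lambda>x. \<phi> n x - g x)) \<longlonglongrightarrow> 0" for n :: nat
    using g(1) e unfolding has_trace_def by blast
  obtain \<phi>' where \<phi>': "\<And>n i. smooth (\<lambda>x. \<phi>' n x $ i)" "(\<lambda>n. h1_sq (cell E) (\<lambda>x. \<phi>' n x - v x)) \<longlonglongrightarrow> 0"
      "(\<lambda>n. edge_sq e (\<lambda>x. \<phi>' n x - g' x)) \<longlonglongrightarrow> 0" for n :: nat
    using g'(1) e unfolding has_trace_def by blast
  have cvec: "continuous_on S f" if "\<And>i. smooth (\<lambda>x. f x $ i)" for f :: "real^2 \<Rightarrow> real^2" and S
    using smooth_continuous[OF that] by (subst continuous_on_componentwise) (auto simp: Basis_real2 inner_axis)
  have c\<gamma>: "continuous_on {0..1} (\<lambda>t. f (a + t *\<^sub>R u))" if "continuous_on (bdry E) f" for f :: "real^2 \<Rightarrow> real^2"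
    by (rule continuous_on_compose2[OF that]) (auto intro!: continuous_intros hull)
  note cg = c\<gamma>[OF g(2)] c\<gamma>[OF g'(2)] and c\<phi> = c\<gamma>[OF cvec[OF \<phi>(1)]] c\<gamma>[OF cvec[OF \<phi>'(1)]]
  have len: "edge_len e > 0" using ab by (simp add: edge_len_eq)
  have sub: "{0..1-\<theta>} \<subseteq> {0..1}" using \<theta> by auto
  have "g (a + t *\<^sub>R u) $ i = g' (a + t *\<^sub>R u) $ i" for i
  proof -
    let ?D = "\<lambda>t. (g (a + t *\<^sub>R u) $ i - g' (a + t *\<^sub>R u) $ i)\<^sup>2"
    define I where "I = (LINT t|lebesgue_on {0..1-\<theta>}. ?D t)"
    have cD: "continuous_on {0..1-\<theta>} ?D"
      by (intro continuous_intros continuous_on_subset[OF cg(1) sub] continuous_on_subset[OF cg(2) sub])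
    have sq: "LINT t|lebesgue_on {0..1-\<theta>}. (norm (f (a + t *\<^sub>R u) - h (a + t *\<^sub>R u)))\<^sup>2 \<le> edge_sq e (\<lambda>x. f x - h x) / edge_len e"
      if "continuous_on {0..1} (\<lambda>t. f (a + t *\<^sub>R u))" "continuous_on {0..1} (\<lambda>t. h (a + t *\<^sub>R u))" for f h :: "real^2 \<Rightarrow> real^2"
    proof -
      let ?k = "\<lambda>t. (norm (f (a + t *\<^sub>R u) - h (a + t *\<^sub>R u)))\<^sup>2"
      have k: "continuous_on {0..1} ?k" by (intro continuous_intros that)
      have "(LINT t|lebesgue_on {0..1-\<theta>}. ?k t) = integral {0..1-\<theta>} ?k"
        by (intro lebesgue_integral_eq_integral continuous_imp_integrable_real continuous_on_subset[OF k sub]) auto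
      also have "\<dots> \<le> integral {0..1} ?k"
        by (intro integral_subset_le sub integrable_continuous_real continuous_on_subset[OF k sub] k) auto
      also have "\<dots> = (LINT t|lebesgue_on {0..1}. ?k t)"
        by (intro lebesgue_integral_eq_integral[symmetric] continuous_imp_integrable_real k) auto
      also have "\<dots> = edge_sq e (\<lambda>x. f x - h x) / edge_len e"
        using len by (simp add: edge_sq_def edge_integral_def \<gamma>)
      finally show ?thesis .
    qed
    have "I \<le> 4 * (edge_sq e (\<lambda>x. \<phi> n x - g x) / edge_len e)
      + 4 * (c * (2 * h1_sq (cell E) (\<lambda>x. \<phi> n x - v x) + 2 * h1_sq (cell E) (\<lambda>x. \<phi>' n x - v x)))
      + 2 * (edge_sq e (\<lambda>x. \<phi>' n x - g' x) / edge_len e)" for n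
    proof -
      let ?x = "\<lambda>t. (norm (\<phi> n (a + t *\<^sub>R u) - g (a + t *\<^sub>R u)))\<^sup>2"
      let ?y = "\<lambda>t. ((\<phi> n (a + t *\<^sub>R u) - \<phi>' n (a + t *\<^sub>R u)) $ i)\<^sup>2"
      let ?z = "\<lambda>t. (norm (\<phi>' n (a + t *\<^sub>R u) - g' (a + t *\<^sub>R u)))\<^sup>2"
      have cx: "continuous_on {0..1-\<theta>} ?x" "continuous_on {0..1-\<theta>} ?y" "continuous_on {0..1-\<theta>} ?z"
        by (intro continuous_intros continuous_on_subset[OF cg(1) sub] continuous_on_subset[OF cg(2) sub]
            continuous_on_subset[OF c\<phi>(1) sub] continuous_on_subset[OF c\<phi>(2) sub])+
      note i = cx[THEN continuous_imp_integrable_real] and iD = cD[THEN continuous_imp_integrable_real]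
      have "I \<le> (LINT t|lebesgue_on {0..1-\<theta>}. 4 * ?x t + 4 * ?y t + 2 * ?z t)"
        unfolding I_def
      proof (rule integral_mono[OF iD])
        show "integrable (lebesgue_on {0..1-\<theta>}) (\<lambda>t. 4 * ?x t + 4 * ?y t + 2 * ?z t)" using i by auto
        fix t
        \<comment> \<open>The difference of the traces is routed through both smooth approximations.
          The outer pieces tend to 0 by the definition of a trace, the middle one by the trace
          inequality.\<close>
        let ?X = "(g (a + t *\<^sub>R u) - \<phi> n (a + t *\<^sub>R u)) $ i" and ?Y = "(\<phi> n (a + t *\<^sub>R u) - \<phi>' n (a + t *\<^sub>R u)) $ i"
          and ?Z = "(\<phi>' n (a + t *\<^sub>R u) - g' (a + t *\<^sub>R u)) $ i"
        have "?D t = (norm (?X + ?Y + ?Z))\<^sup>2" by simp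
        also have "\<dots> \<le> 4 * (norm ?X)\<^sup>2 + 4 * (norm ?Y)\<^sup>2 + 2 * (norm ?Z)\<^sup>2" by (rule norm_add3_power2_le)
        also have "\<dots> \<le> 4 * ?x t + 4 * ?y t + 2 * ?z t"
        proof -
          have "(norm ?X)\<^sup>2 \<le> ?x t" "(norm ?Z)\<^sup>2 \<le> ?z t"
            unfolding norm_minus_commute[of "\<phi> n (a + t *\<^sub>R u)"]
            by (intro power_mono Finite_Cartesian_Product.norm_nth_le norm_ge_zero)+
          then show ?thesis by simp
        qed
        finally show "?D t \<le> 4 * ?x t + 4 * ?y t + 2 * ?z t" .
      qed
      also have "\<dots> = 4 * (LINT t|lebesgue_on {0..1-\<theta>}. ?x t) + 4 * (LINT t|lebesgue_on {0..1-\<theta>}. ?y t) + 2 * (LINT t|lebesgue_on {0..1-\<theta>}. ?z t)"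
        using i by simp
      also have "\<dots> \<le> 4 * (edge_sq e (\<lambda>x. \<phi> n x - g x) / edge_len e)
        + 4 * (c * (2 * h1_sq (cell E) (\<lambda>x. \<phi> n x - v x) + 2 * h1_sq (cell E) (\<lambda>x. \<phi>' n x - v x)))
        + 2 * (edge_sq e (\<lambda>x. \<phi>' n x - g' x) / edge_len e)"
      proof (intro add_mono mult_left_mono sq c\<phi> cg)
        have "smooth (\<lambda>x. (\<phi> n x - \<phi>' n x) $ i)" using smooth_diff[OF \<phi>(1) \<phi>'(1)] by simp
        then have "(LINT t|lebesgue_on {0..1-\<theta>}. ?y t) \<le> c * (l2_sq (cell E) (\<lambda>x. (\<phi> n x - \<phi>' n x) $ i)
            + l2_sq (cell E) (\<lambda>x. \<chi> j. pd j (\<lambda>x. (\<phi> n x - \<phi>' n x) $ i) x))" by (rule c(2))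
        also have "\<dots> \<le> c * (2 * h1_sq (cell E) (\<lambda>x. \<phi> n x - v x) + 2 * h1_sq (cell E) (\<lambda>x. \<phi>' n x - v x))"
          by (intro mult_left_mono has_grad_approximation v \<phi>(1) \<phi>'(1) c(1))
        finally show "(LINT t|lebesgue_on {0..1-\<theta>}. ?y t) \<le> c * (2 * h1_sq (cell E) (\<lambda>x. \<phi> n x - v x) + 2 * h1_sq (cell E) (\<lambda>x. \<phi>' n x - v x))" .
      qed auto
      finally show ?thesis .
    qed
    moreover have "(\<lambda>n. 4 * (edge_sq e (\<lambda>x. \<phi> n x - g x) / edge_len e)
      + 4 * (c * (2 * h1_sq (cell E) (\<lambda>x. \<phi> n x - v x) + 2 * h1_sq (cell E) (\<lambda>x. \<phi>' n x - v x)))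
      + 2 * (edge_sq e (\<lambda>x. \<phi>' n x - g' x) / edge_len e)) \<longlonglongrightarrow> 4 * (0 / edge_len e) + 4 * (c * (2 * 0 + 2 * 0)) + 2 * (0 / edge_len e)"
      using len by (intro tendsto_intros \<phi> \<phi>') auto
    ultimately have "I \<le> 4 * (0 / edge_len e) + 4 * (c * (2 * 0 + 2 * 0)) + 2 * (0 / edge_len e)"
      by (intro LIMSEQ_le_const) auto
    moreover have "I = integral {0..1-\<theta>} ?D" unfolding I_def
      by (intro lebesgue_integral_eq_integral continuous_imp_integrable_real cD) auto
    moreover have "I \<ge> 0" unfolding I_def by (rule integral_nonneg_AE) auto
    ultimately have "integral {0..1-\<theta>} ?D = 0" by simp
    then have "\<forall>t\<in>{0..1-\<theta>}. ?D t = 0"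
      using integral_eq_0_iff[OF cD] \<theta> by auto
    then show ?thesis using t by simp
  qed
  then show ?thesis by (simp add: \<gamma> vec_eq_iff)
qed

lemma trace_unique:
  assumes E: "simple_polygon E" and r: "r > 0" "star_shaped_wrt (closed_cell E) (ball xE r)"
    and v: "H1 (cell E) v" and g: "has_trace E v g" "continuous_on (bdry E) g"
    and g': "has_trace E v g'" "continuous_on (bdry E) g'" and x: "x \<in> set E"
  shows "g x = g' x"
proof -
  obtain e where e: "e \<in> edges E" "x \<in> e" using vertex_in_edge[OF x] by blast
  obtain a b where ab: "e = {a, b}" "a \<noteq> b" "edge_param e = linepath a b" using edge_paramE[OF E e(1)] .
  have in_bdry: "linepath a b t \<in> bdry E" if "t \<in> {0..1}" for t
    using linepath_in_path[OF that, of a b] edge_subset_bdry[OF e(1)] by (auto simp: ab(1) segment_convex_hull)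
  let ?D = "\<lambda>t. g (linepath a b t) - g' (linepath a b t)"
  \<comment> \<open>For \<open>t < 1\<close> the choice \<open>\<theta> = (1 - t) / 2\<close> leaves
    \<open>t\<close> below \<open>1 - \<theta>\<close>; the far end point is then reached by
    continuity.\<close>
  have z: "?D t = 0" if "t \<in> {0..<1}" for t
    using trace_unique_on_edge[OF E r v g g' e(1), of "(1 - t) / 2" t] that by (simp add: ab(3) field_simps)
  have cont: "continuous_on {0..1} ?D"
    by (intro continuous_on_diff continuous_on_compose2[OF g(2)] continuous_on_compose2[OF g'(2)] continuous_on_linepath)
      (use in_bdry in auto)
  have "?D 1 = 0"
  proof (rule continuous_constant_on_closure[of "{0..<1}" ?D 0])
    show "continuous_on (closure {0..<1}) ?D" using cont by simp
  qed (use z in auto)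
  then have "?D 0 = 0 \<and> ?D 1 = 0" using z[of 0] by simp
  then show ?thesis using e(2) ab(1) by (auto simp: linepath_def)
qed

section \<open>Boundary traces of fields shifted by affine maps\<close>

lemma btrace_properties:
  assumes "has_trace E v g" "continuous_on (bdry E) g"
  shows "has_trace E v (btrace E v)" "continuous_on (bdry E) (btrace E v)"
proof -
  have "\<exists>g. has_trace E v g \<and> ((\<exists>g'. has_trace E v g' \<and> continuous_on (bdry E) g') \<longrightarrow> continuous_on (bdry E) g)"
    using assms by blast
  from someI_ex[OF this] show "has_trace E v (btrace E v)" "continuous_on (bdry E) (btrace E v)"
    unfolding btrace_def[symmetric] using assms by blast+
qed

lemma has_trace_diff_affine:
  assumes "has_trace E v g" "P1 p" "simple_polygon E"
  shows "has_trace E (\<lambda>x. v x - p x) (\<lambda>x. g x - p x)"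
proof -
  obtain c A where p: "p = (\<lambda>x. c + A *v x)" using assms(2) by (auto simp: P1_def)
  obtain \<phi> where \<phi>: "\<And>n i. smooth (\<lambda>x. \<phi> n x $ i)" "(\<lambda>n. h1_sq (cell E) (\<lambda>x. \<phi> n x - v x)) \<longlonglongrightarrow> 0"
      "\<And>e. e \<in> edges E \<Longrightarrow> (\<lambda>n. edge_sq e (\<lambda>x. \<phi> n x - g x)) \<longlonglongrightarrow> 0" for n :: nat
    using assms(1) unfolding has_trace_def by blast
  have eq: "(\<lambda>x. (\<phi> n x - p x) - (w x - p x)) = (\<lambda>x. \<phi> n x - w x)" for n and w :: "real^2 \<Rightarrow> real^2" by auto
  show ?thesis unfolding has_trace_def
  proof (intro conjI ballI exI[of _ "\<lambda>n x. \<phi> n x - p x"] allI)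
    show "smooth (\<lambda>x. (\<phi> n x - p x) $ i)" for n i
      using smooth_diff[OF \<phi>(1) smooth_affine[of c A]] by (simp add: p)
    show "(\<lambda>n. h1_sq (cell E) (\<lambda>x. (\<phi> n x - p x) - (v x - p x))) \<longlonglongrightarrow> 0" unfolding eq by (rule \<phi>)
    show "(\<lambda>n. edge_sq e (\<lambda>x. (\<phi> n x - p x) - (g x - p x))) \<longlonglongrightarrow> 0" if "e \<in> edges E" for e
      unfolding eq by (rule \<phi>(3)[OF that])
    fix e assume e: "e \<in> edges E"
    obtain a b where ab: "e = {a, b}" "edge_param e = linepath a b" using edge_paramE[OF assms(3) e] .
    have L: "(\<lambda>t. g (linepath a b t)) \<in> borel_measurable (lebesgue_on {0..1})"
        "integrable (lebesgue_on {0..1}) (\<lambda>t. (norm (g (linepath a b t)))\<^sup>2)"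
      using assms(1) e ab(2) by (auto simp: has_trace_def L2_edge_def)
    have cp: "continuous_on UNIV p" unfolding p by (intro continuous_intros matrix_vector_mult_linear_continuous_on)
    have c: "continuous_on {0..1} (\<lambda>t. p (linepath a b t))"
      by (rule continuous_on_compose2[OF cp continuous_on_linepath]) auto
    have m: "(\<lambda>t. p (linepath a b t)) \<in> borel_measurable (lebesgue_on {0..1})"
      by (rule continuous_imp_measurable_on_sets_lebesgue[OF c]) auto
    have i: "integrable (lebesgue_on {0..1}) (\<lambda>t. 2 * (norm (g (linepath a b t)))\<^sup>2 + 2 * (norm (p (linepath a b t)))\<^sup>2)"
      by (intro Bochner_Integration.integrable_add integrable_mult_right L(2) continuous_imp_integrable_real[of 0 1 "\<lambda>t. (norm (p (linepath a b t)))\<^sup>2"] continuous_intros c)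
    show "L2_edge e (\<lambda>x. g x - p x)"
      unfolding L2_edge_def ab(2)
    proof
      show "(\<lambda>t. g (linepath a b t) - p (linepath a b t)) \<in> borel_measurable (lebesgue_on {0..1})" using L(1) m by simp
      show "integrable (lebesgue_on {0..1}) (\<lambda>t. (norm (g (linepath a b t) - p (linepath a b t)))\<^sup>2)"
        using i
      proof (rule Bochner_Integration.integrable_bound)
        show "AE t in lebesgue_on {0..1}. norm ((norm (g (linepath a b t) - p (linepath a b t)))\<^sup>2)
          \<le> norm (2 * (norm (g (linepath a b t)))\<^sup>2 + 2 * (norm (p (linepath a b t)))\<^sup>2)"
          using norm_add_power2_le[of "g _" "- p _"] by (intro AE_I2) simp
      qed (use L(1) m in measurable)
    qed
  qed
qed

lemma edge_tangent:
  assumes "a \<noteq> b"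
  shows "norm (edge_tangent {a, b}) = 1" "\<exists>r. b - a = r *\<^sub>R edge_tangent {a, b} \<and> \<bar>r\<bar> = dist a b"
proof -
  let ?e = "{a, b}" and ?t = "edge_tangent {a, b}"
  have "\<exists>t. norm t = 1 \<and> (\<forall>a\<in>?e. \<forall>b\<in>?e. \<exists>r. b - a = r *\<^sub>R t)"
  proof (intro exI[of _ "(1 / norm (b - a)) *\<^sub>R (b - a)"] conjI ballI)
    show "norm ((1 / norm (b - a)) *\<^sub>R (b - a)) = 1" using assms by simp
    fix x y assume "x \<in> ?e" "y \<in> ?e"
    then have "\<exists>s. y - x = s *\<^sub>R (b - a)"
      by (auto intro: exI[of _ 0] exI[of _ 1] exI[of _ "-1"])
    then obtain s where "y - x = s *\<^sub>R (b - a)" by blast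
    then have "y - x = (s * norm (b - a)) *\<^sub>R ((1 / norm (b - a)) *\<^sub>R (b - a))" using assms by simp
    then show "\<exists>r. y - x = r *\<^sub>R ((1 / norm (b - a)) *\<^sub>R (b - a))" by blast
  qed
  from someI_ex[OF this] have t: "norm ?t = 1" "\<exists>r. b - a = r *\<^sub>R ?t"
    unfolding edge_tangent_def by blast+
  then obtain r where r: "b - a = r *\<^sub>R ?t" by blast
  then have "dist a b = \<bar>r\<bar>" using t(1) by (metis dist_norm mult.right_neutral norm_minus_commute norm_scaleR)
  then show "norm ?t = 1" "\<exists>r. b - a = r *\<^sub>R ?t \<and> \<bar>r\<bar> = dist a b" using t(1) r by auto
qed

lemma P_edge_affine: "P_edge 1 e (\<lambda>x. (c + A *v x) \<bullet> w)" if e: "e = {a, b}" "a \<noteq> b"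
proof -
  let ?t = "edge_tangent e"
  have t: "norm ?t = 1" using edge_tangent(1) e by simp
  obtain r where r: "b - a = r *\<^sub>R ?t" using edge_tangent(2)[OF e(2)] by (auto simp: e(1))
  have x: "x = a + ((x - a) \<bullet> ?t) *\<^sub>R ?t" if "x \<in> convex hull e" for x
  proof -
    obtain s where "x = a + s *\<^sub>R (b - a)"
      using \<open>x \<in> convex hull e\<close> by (auto simp: e(1) segment_convex_hull[symmetric] in_segment algebra_simps)
    then have x: "x - a = (s * r) *\<^sub>R ?t" using r by simp
    moreover have "?t \<bullet> ?t = 1" using t by (simp add: norm_eq_1)
    ultimately have "(x - a) \<bullet> ?t = s * r" by simp
    then show ?thesis using x by (simp add: algebra_simps)
  qed
  let ?m = "(A *v ?t) \<bullet> w"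
  let ?p = "[:(c + A *v a) \<bullet> w - (a \<bullet> ?t) * ?m, ?m:]"
  have "(c + A *v x) \<bullet> w = poly ?p (x \<bullet> ?t)" if "x \<in> convex hull e" for x
  proof -
    have "(c + A *v x) \<bullet> w = (c + A *v (a + ((x - a) \<bullet> ?t) *\<^sub>R ?t)) \<bullet> w" using x[OF that] by simp
    also have "\<dots> = poly ?p (x \<bullet> ?t)"
      by (simp add: matrix_vector_right_distrib matrix_vector_mult_scaleR inner_add_left inner_diff_left algebra_simps)
    finally show ?thesis .
  qed
  moreover have "degree ?p \<le> 1" by simp
  ultimately show ?thesis unfolding P_edge_def by blast
qed

lemma P_edge_diff:
  assumes "P_edge k e f" "P_edge l e g" "l \<le> k" shows "P_edge k e (\<lambda>x. f x - g x)"
proof -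
  obtain p where p: "degree p \<le> k" "\<And>x. x \<in> convex hull e \<Longrightarrow> f x = poly p (x \<bullet> edge_tangent e)"
    using assms(1) unfolding P_edge_def by blast
  obtain q where q: "degree q \<le> l" "\<And>x. x \<in> convex hull e \<Longrightarrow> g x = poly q (x \<bullet> edge_tangent e)"
    using assms(2) unfolding P_edge_def by blast
  have "degree (p - q) \<le> k" using p(1) q(1) assms(3) by (intro degree_diff_le) auto
  then show ?thesis unfolding P_edge_def using p(2) q(2) by (intro exI[of _ "p - q"]) simp
qed

lemma B1_diff_affine:
  assumes "B1 E g" "P1 p" "simple_polygon E" shows "B1 E (\<lambda>x. g x - p x)"
proof -
  obtain c A where p: "p = (\<lambda>x. c + A *v x)" using assms(2) by (auto simp: P1_def)
  have "continuous_on (bdry E) p" unfolding p by (intro continuous_intros matrix_vector_mult_linear_continuous_on)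
  moreover have "P_edge 1 e (\<lambda>x. p x \<bullet> w)" if "e \<in> edges E" for e w
    using edgeE[OF that] assms(3) P_edge_affine unfolding p by metis
  ultimately show ?thesis
    using assms(1) unfolding B1_def inner_diff_left by (auto intro!: continuous_on_diff P_edge_diff)
qed

section \<open>The disc around an interior edge\<close>

lemma perp_simps: "perp x $ 1 = x $ 2" "perp x $ 2 = - (x $ 1)"
  by (simp_all add: perp_def)

lemma norm_perp: "norm (perp x) = norm x"
  by (simp add: norm_eq_sqrt_inner inner_vec_def sum_2 perp_simps)

text \<open>The sign is left open: the orientation of \<open>edge_normal\<close> is arbitrary,
  whereas later the normal has to point into the first of the two elements.\<close>

definition is_normal :: "real^2 \<Rightarrow> real^2 \<Rightarrow> bool" where
  "is_normal t N \<longleftrightarrow> norm t = 1 \<and> (N = perp t \<or> N = - perp t)"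

lemma is_normal_uminus: "is_normal t N \<Longrightarrow> is_normal t (- N)"
  by (auto simp: is_normal_def)

lemma is_normal_simps:
  assumes "is_normal t N" shows "norm t = 1" "norm N = 1" "t \<bullet> N = 0" "N \<bullet> N = 1" "t \<bullet> t = 1"
  using assms by (auto simp: is_normal_def norm_perp norm_eq_1 inner_vec_def sum_2 perp_simps)

lemma orthonormal_expansion:
  assumes "is_normal t N" shows "x = (x \<bullet> t) *\<^sub>R t + (x \<bullet> N) *\<^sub>R N"
proof -
  have t: "t$1 * t$1 + t$2 * t$2 = 1" using is_normal_simps(5)[OF assms] by (simp add: inner_vec_def sum_2)
  have "x$1 = x$1 * (t$1 * t$1 + t$2 * t$2)" "x$2 = x$2 * (t$1 * t$1 + t$2 * t$2)" by (simp_all add: t)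
  then show ?thesis using assms
    by (auto simp: is_normal_def vec_eq_iff forall_2 inner_vec_def sum_2 perp_simps algebra_simps)
qed

lemma edge_normal: "a \<noteq> b \<Longrightarrow> is_normal (edge_tangent {a, b}) (edge_normal {a, b})"
  by (simp add: is_normal_def edge_tangent edge_normal_def)

text \<open>The line from the apex \<open>y\<close> through \<open>x\<close> hits the line of the
  edge at \<open>m + q t\<close>, where \<open>l = w / d\<close> is the weight of the apex in
  \<open>x\<close>. The condition \<open>r \<le> \<delta> / 2\<close> gives
  \<open>l \<le> 1/2\<close>, the other one bounds the numerator of \<open>q\<close> by
  \<open>L / 4\<close>, so \<open>|q| \<le> L / 2\<close> and the hit is on the edge.\<close>

lemma half_disc_in_triangle:
  fixes m y :: "real^2"
  assumes N: "is_normal t N" and \<delta>: "0 < \<delta>" "\<delta> \<le> (y - m) \<bullet> N" and R: "norm (y - m) \<le> R"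
    and S: "\<And>s. \<bar>s\<bar> \<le> L / 2 \<Longrightarrow> closed_segment y (m + s *\<^sub>R t) \<subseteq> S"
    and r: "r \<le> \<delta> / 2" "r * (1 + R / \<delta>) \<le> L / 4"
    and x: "norm (x - m) \<le> r" "(x - m) \<bullet> N \<ge> 0"
  shows "x \<in> S"
proof -
  define s w \<sigma> d where "s = (x - m) \<bullet> t" and "w = (x - m) \<bullet> N" and "\<sigma> = (y - m) \<bullet> t" and "d = (y - m) \<bullet> N"
  note n = is_normal_simps[OF N]
  have "\<bar>s\<bar> \<le> norm (x - m)" "\<bar>w\<bar> \<le> norm (x - m)" "\<bar>\<sigma>\<bar> \<le> norm (y - m)"
    using Cauchy_Schwarz_ineq2[of "x - m" t] Cauchy_Schwarz_ineq2[of "x - m" N] Cauchy_Schwarz_ineq2[of "y - m" t] n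
    by (simp_all add: s_def w_def \<sigma>_def)
  then have b: "\<bar>s\<bar> \<le> r" "\<bar>w\<bar> \<le> r" "\<bar>\<sigma>\<bar> \<le> R" "0 \<le> w" using x R by (auto simp: w_def)
  have r0: "r \<ge> 0" using b by linarith
  have R0: "R \<ge> 0" using b by linarith
  have d: "d \<ge> \<delta>" "d > 0" using \<delta> by (auto simp: d_def)
  define l where "l = w / d"
  have "w / d \<le> r / \<delta>" using b d \<delta> by (intro frac_le) auto
  moreover have "r / \<delta> \<le> 1 / 2" using r \<delta> by (simp add: field_simps)
  moreover have "0 \<le> w / d" using b d by simp
  ultimately have l: "0 \<le> l" "l \<le> r / \<delta>" "l \<le> 1 / 2" unfolding l_def by linarith+
  have ld: "l * d = w" using d by (simp add: l_def)
  let ?q = "(s - l * \<sigma>) / (1 - l)"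
  have "\<bar>s - l * \<sigma>\<bar> \<le> \<bar>s\<bar> + l * \<bar>\<sigma>\<bar>" using l(1) by (metis abs_mult abs_of_nonneg abs_triangle_ineq4)
  also have "\<dots> \<le> r + (r / \<delta>) * R" using b l r0 \<delta> by (intro add_mono mult_mono) auto
  also have "\<dots> \<le> L / 4" using r(2) by (simp add: algebra_simps)
  finally have q1: "\<bar>s - l * \<sigma>\<bar> \<le> L / 4" .
  have "0 \<le> L / 4" using order_trans[OF abs_ge_zero q1] .
  have "\<bar>?q\<bar> = \<bar>s - l * \<sigma>\<bar> / (1 - l)" using l by simp
  also have "\<dots> \<le> (L / 4) / (1 / 2)" using q1 l \<open>0 \<le> L / 4\<close> by (intro frac_le) auto
  finally have q: "\<bar>?q\<bar> \<le> L / 2" by simp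
  have "x - m = s *\<^sub>R t + w *\<^sub>R N" "y - m = \<sigma> *\<^sub>R t + d *\<^sub>R N"
    unfolding s_def w_def \<sigma>_def d_def by (rule orthonormal_expansion[OF N])+
  then have xy: "x = m + s *\<^sub>R t + w *\<^sub>R N" "y = m + \<sigma> *\<^sub>R t + d *\<^sub>R N" by (simp_all add: algebra_simps)
  have "(1 - l) * ?q = s - l * \<sigma>" using l by simp
  then have "x = l *\<^sub>R y + (1 - l) *\<^sub>R (m + ?q *\<^sub>R t)"
    unfolding xy by (simp only: scaleR_add_right scaleR_scaleR ld) (simp add: algebra_simps)
  moreover have "l *\<^sub>R y + (1 - l) *\<^sub>R (m + ?q *\<^sub>R t) \<in> closed_segment y (m + ?q *\<^sub>R t)"
    unfolding in_segment using l by (intro exI[of _ "1 - l"]) simp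
  ultimately show ?thesis using S[OF q] by auto
qed

text \<open>
  If both apices were on the same side of \<open>e\<close>, the two triangles over \<open>e\<close> would overlap. This
  replaces the Jordan curve theorem.
\<close>

lemma same_side_contradiction:
  assumes disj: "cell E1 \<inter> cell E2 = {}" and N: "is_normal t N" and L: "L > 0"
    and S1: "\<And>s. \<bar>s\<bar> \<le> L / 2 \<Longrightarrow> closed_segment y1 (m + s *\<^sub>R t) \<subseteq> closed_cell E1"
    and S2: "\<And>s. \<bar>s\<bar> \<le> L / 2 \<Longrightarrow> closed_segment y2 (m + s *\<^sub>R t) \<subseteq> closed_cell E2"
    and pos: "(y1 - m) \<bullet> N > 0" "(y2 - m) \<bullet> N > 0"
  shows False
proof -
  define \<delta> where "\<delta> = min ((y1 - m) \<bullet> N) ((y2 - m) \<bullet> N)"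
  define R where "R = max (norm (y1 - m)) (norm (y2 - m))"
  define r where "r = min (\<delta> / 2) (L / 4 / (1 + R / \<delta>))"
  have \<delta>: "0 < \<delta>" "\<delta> \<le> (y1 - m) \<bullet> N" "\<delta> \<le> (y2 - m) \<bullet> N" using pos by (auto simp: \<delta>_def)
  have R: "norm (y1 - m) \<le> R" "norm (y2 - m) \<le> R" by (auto simp: R_def)
  have R0: "R \<ge> 0" using order_trans[OF norm_ge_zero R(1)] .
  then have k: "1 + R / \<delta> > 0" using \<delta> by (simp add: add_pos_nonneg)
  have r: "r > 0" "r \<le> \<delta> / 2"
    using \<delta> L k unfolding r_def by (simp, intro min.cobounded1)
  have "r \<le> L / 4 / (1 + R / \<delta>)" by (simp add: r_def)
  then have r2: "r * (1 + R / \<delta>) \<le> L / 4" using k by (simp only: pos_le_divide_eq)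
  \<comment> \<open>An open half disc. It would lie in both closed cells, hence, the cells being
    disjoint, in the union of the two boundaries, which is a null set.\<close>
  define W where "W = ball m r \<inter> {x. 0 < (x - m) \<bullet> N}"
  have "open W"
  proof -
    have "open {x. 0 < (x - m) \<bullet> N}" by (intro open_Collect_less continuous_intros)
    then show ?thesis unfolding W_def by auto
  qed
  moreover have "m + (r / 2) *\<^sub>R N \<in> W"
    using r is_normal_simps[OF N] by (simp add: W_def dist_norm)
  moreover have "negligible W"
  proof (rule negligible_subset[OF negligible_Un[OF negligible_bdry[of E1] negligible_bdry[of E2]]], rule subsetI)
    fix x assume "x \<in> W"
    then have x: "norm (x - m) \<le> r" "(x - m) \<bullet> N \<ge> 0" by (auto simp: W_def dist_norm norm_minus_commute)
    have "x \<in> closed_cell E1" by (rule half_disc_in_triangle[OF N \<delta>(1,2) R(1) S1 r(2) r2 x])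
    moreover have "x \<in> closed_cell E2" by (rule half_disc_in_triangle[OF N \<delta>(1,3) R(2) S2 r(2) r2 x])
    ultimately show "x \<in> bdry E1 \<union> bdry E2" using disj by (auto simp: closed_cell_def)
  qed
  ultimately show False using open_not_negligible by blast
qed

text \<open>The two radius conditions of \<open>half_disc_in_triangle\<close> for an edge of length
  \<open>L\<close>, with apex height at least \<open>\<rho> L\<close> and apex distance at most
  \<open>L / \<rho>\<close>: the ratio of the latter to the former is
  \<open>1 / \<rho>^2\<close>.\<close>

definition patch_const :: "real \<Rightarrow> real" where
  "patch_const \<rho> = min (\<rho> / 2) (1 / 4 / (1 + 1 / \<rho>\<^sup>2))"

lemma patch_const_pos: "\<rho> > 0 \<Longrightarrow> patch_const \<rho> > 0"
  by (simp add: patch_const_def add_pos_nonneg)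

lemma elem_diam_bounds:
  assumes "x \<in> closed_cell E" "y \<in> closed_cell E" shows "norm (x - y) \<le> elem_diam E"
  unfolding elem_diam_def dist_norm[symmetric] by (rule diameter_bounded_bound[OF bounded_closed_cell assms])

lemma edge_in_closed_cell: "e \<in> edges E \<Longrightarrow> convex hull e \<subseteq> closed_cell E"
  using edge_subset_bdry by (auto simp: closed_cell_def)

text \<open>Each element contains the triangles over \<open>e\<close> with apex in its star ball.
  Since such triangles cannot overlap, the two balls lie on opposite closed sides of the line
  through \<open>e\<close>; both centres are then at least \<open>\<rho> L\<close> away from it and
  serve as apices for the two half discs.\<close>

lemma interior_edge_patch:
  assumes E1: "simple_polygon E1" "e \<in> edges E1" "\<rho> * elem_diam E1 < edge_len e" "x1 \<in> closed_cell E1"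
      "star_shaped_wrt (closed_cell E1) (ball x1 (\<rho> * elem_diam E1))"
    and E2: "e \<in> edges E2" "\<rho> * elem_diam E2 < edge_len e" "x2 \<in> closed_cell E2"
      "star_shaped_wrt (closed_cell E2) (ball x2 (\<rho> * elem_diam E2))"
    and disj: "cell E1 \<inter> cell E2 = {}" and \<rho>: "\<rho> > 0"
  obtains m N where "is_normal (edge_tangent e) N" "N = edge_normal e \<or> N = - edge_normal e"
    "\<And>x. norm (x - m) \<le> patch_const \<rho> * edge_len e \<Longrightarrow> (x - m) \<bullet> N \<ge> 0 \<Longrightarrow> x \<in> closed_cell E1"
    "\<And>x. norm (x - m) \<le> patch_const \<rho> * edge_len e \<Longrightarrow> (x - m) \<bullet> N \<le> 0 \<Longrightarrow> x \<in> closed_cell E2"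
proof -
  obtain a b where ab: "e = {a, b}" "a \<noteq> b" using edgeE[OF E1(2)] E1(1) by metis
  define t where "t = edge_tangent e"
  define m where "m = (1/2) *\<^sub>R (a + b)"
  define L where "L = edge_len e"
  have L: "L = dist a b" "L > 0" using ab by (auto simp: L_def edge_len_eq)
  obtain r where r: "b - a = r *\<^sub>R t" "\<bar>r\<bar> = L" using edge_tangent(2)[OF ab(2)] by (auto simp: t_def ab(1) L(1))
  have N0: "is_normal t (edge_normal e)" using edge_normal[OF ab(2)] by (simp add: t_def ab(1))
  have hull: "m + s *\<^sub>R t \<in> convex hull e" if "\<bar>s\<bar> \<le> L / 2" for s
  proof -
    define k where "k = 1/2 + s / r"
    have rn: "r \<noteq> 0" using r L by auto
    have "\<bar>s / r\<bar> \<le> 1/2" using that r(2) L(2) by (simp add: field_simps)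
    then have k: "0 \<le> k" "k \<le> 1" unfolding k_def by linarith+
    have "s *\<^sub>R t = (s / r) *\<^sub>R (b - a)" using r(1) rn by simp
    moreover have "m = a + (1/2) *\<^sub>R (b - a)" by (simp add: m_def vec_eq_iff field_simps)
    ultimately have "m + s *\<^sub>R t = a + k *\<^sub>R (b - a)" by (simp only: k_def scaleR_add_left add.assoc)
    also have "\<dots> = (1 - k) *\<^sub>R a + k *\<^sub>R b" by (simp add: algebra_simps)
    finally have "m + s *\<^sub>R t \<in> closed_segment a b" using k by (auto simp: in_segment)
    then show ?thesis by (simp add: ab(1) segment_convex_hull)
  qed
  have mhull: "m \<in> convex hull e" using hull[of 0] L by simp
  have seg: "closed_segment y (m + s *\<^sub>R t) \<subseteq> closed_cell E"
    if "star_shaped_wrt (closed_cell E) B" "e \<in> edges E" "y \<in> B" "\<bar>s\<bar> \<le> L / 2" for E y B s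
    using that hull[OF that(4)] edge_in_closed_cell[OF that(2)] unfolding star_shaped_wrt_def by blast
  have h: "L \<le> elem_diam E" "elem_diam E > 0" if "e \<in> edges E" for E
  proof -
    have "a \<in> closed_cell E" "b \<in> closed_cell E"
      using edge_in_closed_cell[OF that] hull_inc[of _ e convex] ab(1) by auto
    then show "L \<le> elem_diam E" using elem_diam_bounds by (simp add: L dist_norm)
    then show "elem_diam E > 0" using L by linarith
  qed
  \<comment> \<open>The centre of a star ball might lie on the line through \<open>e\<close>, where
    it belongs to neither side; some other point of the ball does not.\<close>
  have off: "\<exists>y\<in>ball x (\<rho> * elem_diam E). (y - m) \<bullet> N \<noteq> 0" if "e \<in> edges E" "is_normal t N" for x E N
  proof (cases "(x - m) \<bullet> N = 0")
    case False
    then show ?thesis using h(2)[OF that(1)] \<rho> by (intro bexI[of _ x]) auto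
  next
    case True
    let ?r = "\<rho> * elem_diam E"
    have "?r > 0" using h(2)[OF that(1)] \<rho> by simp
    then show ?thesis using True is_normal_simps[OF that(2)] h(2)[OF that(1)] \<rho>
      by (intro bexI[of _ "x + (?r / 2) *\<^sub>R N"]) (simp_all add: dist_norm inner_diff_left inner_add_left)
  qed
  \<comment> \<open>A ball on one side of a line has its centre at least one radius away; otherwise
    a step against the normal would cross the line inside the ball.\<close>
  have away: "\<rho> * elem_diam E \<le> (x - m) \<bullet> N"
    if "e \<in> edges E" "is_normal t N" "\<And>y. y \<in> ball x (\<rho> * elem_diam E) \<Longrightarrow> 0 \<le> (y - m) \<bullet> N" for x E N
  proof (rule ccontr)
    let ?r = "\<rho> * elem_diam E"
    assume "\<not> ?thesis"
    moreover have "?r > 0" using h(2)[OF that(1)] \<rho> by simp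
    ultimately obtain s where s: "max 0 ((x - m) \<bullet> N) < s" "s < ?r" using dense[of "max 0 ((x - m) \<bullet> N)" ?r] by auto
    have "x - s *\<^sub>R N \<in> ball x ?r" using s is_normal_simps[OF that(2)] by (simp add: dist_norm)
    then have "0 \<le> (x - s *\<^sub>R N - m) \<bullet> N" by (rule that(3))
    also have "\<dots> = (x - m) \<bullet> N - s" using is_normal_simps[OF that(2)] by (simp add: inner_diff_left)
    finally show False using s by simp
  qed
  obtain y2 where y2: "y2 \<in> ball x2 (\<rho> * elem_diam E2)" "(y2 - m) \<bullet> edge_normal e \<noteq> 0" using off[OF E2(1) N0] by blast
  \<comment> \<open>Oriented so that a chosen point of the second star ball lies on the negative
    side. This places the whole first ball on the positive side, and its centre in turn places the
    second ball.\<close>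
  define N where "N = (if (y2 - m) \<bullet> edge_normal e < 0 then edge_normal e else - edge_normal e)"
  have N: "is_normal t N" using N0 is_normal_uminus by (auto simp: N_def)
  note N' = is_normal_uminus[OF N]
  have y2N: "(y2 - m) \<bullet> (- N) > 0" using y2(2) by (auto simp: N_def)
  have side1: "0 \<le> (y - m) \<bullet> N" if "y \<in> ball x1 (\<rho> * elem_diam E1)" for y
  proof (rule ccontr)
    assume "\<not> ?thesis"
    then have "(y - m) \<bullet> (- N) > 0" by simp
    then show False
      using same_side_contradiction[OF disj N' L(2) seg[OF E1(5,2) that] seg[OF E2(4,1) y2(1)]] y2N by blast
  qed
  have d1: "\<rho> * elem_diam E1 \<le> (x1 - m) \<bullet> N" by (rule away[OF E1(2) N side1])
  have r1: "\<rho> * elem_diam E1 > 0" using h(2)[OF E1(2)] \<rho> by simp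
  then have x1N: "(x1 - m) \<bullet> N > 0" using d1 by linarith
  have x1b: "x1 \<in> ball x1 (\<rho> * elem_diam E1)" using r1 by simp
  have side2: "0 \<le> (y - m) \<bullet> (- N)" if "y \<in> ball x2 (\<rho> * elem_diam E2)" for y
  proof (rule ccontr)
    assume "\<not> ?thesis"
    then have "(y - m) \<bullet> N > 0" by simp
    then show False
      using same_side_contradiction[OF disj N L(2) seg[OF E1(5,2) x1b] seg[OF E2(4,1) that]] x1N by blast
  qed
  have d2: "\<rho> * elem_diam E2 \<le> (x2 - m) \<bullet> (- N)" by (rule away[OF E2(1) N' side2])
  have x2b: "x2 \<in> ball x2 (\<rho> * elem_diam E2)" using h(2)[OF E2(1)] \<rho> by simp
  define r0 where "r0 = patch_const \<rho> * L"
  have k: "1 + 1 / \<rho>\<^sup>2 > 0" by (simp add: add_pos_nonneg)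
  have r0: "r0 \<le> (\<rho> * L) / 2" "r0 * (1 + (L / \<rho>) / (\<rho> * L)) \<le> L / 4"
  proof -
    have "patch_const \<rho> \<le> \<rho> / 2" by (simp add: patch_const_def)
    then show "r0 \<le> (\<rho> * L) / 2" unfolding r0_def using L by (simp add: mult_right_mono)
    have "patch_const \<rho> \<le> 1 / 4 / (1 + 1 / \<rho>\<^sup>2)" by (simp add: patch_const_def)
    then have "patch_const \<rho> * (1 + 1 / \<rho>\<^sup>2) \<le> 1 / 4" using k by (simp only: pos_le_divide_eq)
    then have "patch_const \<rho> * (1 + 1 / \<rho>\<^sup>2) * L \<le> 1 / 4 * L" using L by (intro mult_right_mono) auto
    moreover have "(L / \<rho>) / (\<rho> * L) = 1 / \<rho>\<^sup>2" using L \<rho> by (simp add: power2_eq_square)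
    ultimately show "r0 * (1 + (L / \<rho>) / (\<rho> * L)) \<le> L / 4" by (simp add: r0_def mult_ac)
  qed
  have pos: "0 < \<rho> * L" using \<rho> L by simp
  have R: "norm (x - m) \<le> L / \<rho>" if "e \<in> edges E" "\<rho> * elem_diam E < edge_len e" "x \<in> closed_cell E" for x E
  proof -
    have "norm (x - m) \<le> elem_diam E" using that(3) mhull edge_in_closed_cell[OF that(1)] by (intro elem_diam_bounds) auto
    also have "\<dots> \<le> L / \<rho>" using that(2) \<rho> by (simp add: L_def field_simps)
    finally show ?thesis .
  qed
  have \<delta>: "\<rho> * L \<le> (x1 - m) \<bullet> N" "\<rho> * L \<le> (x2 - m) \<bullet> (- N)"
    using d1 d2 mult_left_mono[OF h(1)[OF E1(2)], of \<rho>] mult_left_mono[OF h(1)[OF E2(1)], of \<rho>] \<rho> by linarith+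
  show thesis
  proof (rule that[of N m])
    show "is_normal (edge_tangent e) N" using N by (simp add: t_def)
    show "N = edge_normal e \<or> N = - edge_normal e" by (simp add: N_def)
    fix x assume x: "norm (x - m) \<le> patch_const \<rho> * edge_len e"
    then have x': "norm (x - m) \<le> r0" by (simp add: r0_def L_def)
    show "x \<in> closed_cell E1" if "(x - m) \<bullet> N \<ge> 0"
      by (rule half_disc_in_triangle[OF N pos \<delta>(1) R[OF E1(2,3,4)] seg[OF E1(5,2) x1b] r0 x' that])
    show "x \<in> closed_cell E2" if "(x - m) \<bullet> N \<le> 0"
    proof -
      have *: "(x - m) \<bullet> (- N) \<ge> 0" using that by simp
      show ?thesis
        by (rule half_disc_in_triangle[OF N' pos \<delta>(2) R[OF E2(1,2,3)] seg[OF E2(4,1) x2b] r0 x' *])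
    qed
  qed
qed

section \<open>Testing with a bump\<close>

definition bgrad :: "real^2 \<Rightarrow> real \<Rightarrow> real^2 \<Rightarrow> real^2" where
  "bgrad m r x = (\<chi> j. pd j (radial_bump m r) x)"

lemma bgrad_outside: "x \<notin> ball m r \<Longrightarrow> r > 0 \<Longrightarrow> bgrad m r x = 0"
  using radial_bump_outside[of x m r 1] by (simp add: bgrad_def grad_radial_bump)

lemma norm_bgrad: "r > 0 \<Longrightarrow> norm (bgrad m r x) \<le> 2 * bump_bound / r"
  unfolding bgrad_def by (rule norm_grad_radial_bump)

lemma test_fun_radial_bump_UNIV: "r > 0 \<Longrightarrow> test_fun UNIV (radial_bump m r)"
  by (rule test_fun_radial_bump) auto

lemma continuous_bgrad: "r > 0 \<Longrightarrow> continuous_on S (bgrad m r)"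
  unfolding bgrad_def using test_fun_radial_bump_UNIV[of r m]
  by (intro continuous_intros smooth_continuous smooth_pd) (auto simp: test_fun_def)

lemma bgrad_inner_integrable: "r > 0 \<Longrightarrow> integrable lebesgue (\<lambda>x. bgrad m r x \<bullet> d)"
proof -
  assume r: "r > 0"
  have "integrable lborel (\<lambda>x. pd 1 (radial_bump m r) x * d $ 1 + pd 2 (radial_bump m r) x * d $ 2)"
    by (intro Bochner_Integration.integrable_add integrable_mult_left
        test_fun_integrable_lborel[OF test_fun_pd[OF test_fun_radial_bump_UNIV[OF r]]])
  then show ?thesis
    by (subst integrable_completion) (auto simp: bgrad_def inner_vec_def sum_2 dest: borel_measurable_integrable)
qed

text \<open>
  The integral of the gradient of the bump over the half plane is \<open>flux m N r *\<^sub>R N\<close>.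
\<close>

definition flux :: "real^2 \<Rightarrow> real^2 \<Rightarrow> real \<Rightarrow> real" where
  "flux m N r = (LINT x|lebesgue. indicator {x. 0 < (x - m) \<bullet> N} x * (bgrad m r x \<bullet> N))"

lemma half_plane_borel: "{x. 0 < (x - m) \<bullet> N} \<in> sets (borel :: (real^2) measure)"
  by (intro borel_open open_Collect_less continuous_intros)

text \<open>Half planes are invariant along \<open>t\<close>, so the tangential component of the
  gradient integrates to 0 over each of them. The normal components over the two half planes are
  opposite because the gradient integrates to 0 over the plane. Only the normal part of the jump
  survives.\<close>

lemma jump_identity:
  assumes N: "is_normal t N" and r: "r > 0"
  shows "(LINT x|lebesgue_on (ball m r). (if 0 < (x - m) \<bullet> N then k1 else k2) \<bullet> bgrad m r x)
    = flux m N r * ((k1 - k2) \<bullet> N)"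
proof -
  let ?D = "{x. 0 < (x - m) \<bullet> N}" and ?g = "bgrad m r"
  have D: "?D \<in> sets lebesgue" "- ?D \<in> sets lebesgue" using half_plane_borel[of m N] by auto
  have i: "integrable lebesgue (\<lambda>x. indicator S x * (?g x \<bullet> d))" if "S \<in> sets lebesgue" for S d
    using integrable_mult_indicator[OF that bgrad_inner_integrable[OF r, of m d]] by simp
  have inv: "x + h *\<^sub>R t \<in> ?D \<longleftrightarrow> x \<in> ?D" for x h
    using is_normal_simps(3)[OF N] by (simp add: algebra_simps)
  have z: "(LINT x|lebesgue. indicator S x * (?g x \<bullet> d)) = 0"
    if "S \<in> sets borel" "\<And>x h. x + h *\<^sub>R d \<in> S \<longleftrightarrow> x \<in> S" for S d
    unfolding bgrad_def by (rule integral_directional_derivative_eq_0[OF test_fun_radial_bump_UNIV[OF r] that])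
  have z1: "(LINT x|lebesgue. indicator ?D x * (?g x \<bullet> t)) = 0" "(LINT x|lebesgue. indicator (- ?D) x * (?g x \<bullet> t)) = 0"
    by (intro z; use half_plane_borel[of m N] inv in auto)+
  have "(LINT x|lebesgue. indicator UNIV x * (?g x \<bullet> N)) = 0" by (rule z) auto
  moreover have "(\<lambda>x. indicator UNIV x * (?g x \<bullet> N)) = (\<lambda>x. indicator ?D x * (?g x \<bullet> N) + indicator (- ?D) x * (?g x \<bullet> N))"
    by (auto simp: indicator_def fun_eq_iff)
  ultimately have z2: "(LINT x|lebesgue. indicator (- ?D) x * (?g x \<bullet> N)) = - flux m N r"
    using Bochner_Integration.integral_add[OF i[OF D(1), of N] i[OF D(2), of N]] by (simp add: flux_def)
  have ex: "k \<bullet> y = (k \<bullet> t) * (y \<bullet> t) + (k \<bullet> N) * (y \<bullet> N)" for k y :: "real^2"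
  proof -
    have "k \<bullet> y = ((k \<bullet> t) *\<^sub>R t + (k \<bullet> N) *\<^sub>R N) \<bullet> y"
      using arg_cong[OF orthonormal_expansion[OF N, of k], of "\<lambda>k. k \<bullet> y"] .
    then show ?thesis by (simp only: inner_add_left inner_scaleR_left inner_commute[of t] inner_commute[of N])
  qed
  have "(LINT x|lebesgue_on (ball m r). (if 0 < (x - m) \<bullet> N then k1 else k2) \<bullet> ?g x)
      = (LINT x|lebesgue_on UNIV. (if 0 < (x - m) \<bullet> N then k1 else k2) \<bullet> ?g x)"
    by (rule integral_lebesgue_on_eq[symmetric]) (use bgrad_outside[OF _ r, of _ m] in \<open>auto simp del: mem_ball\<close>)
  also have "\<dots> = (LINT x|lebesgue. (k1 \<bullet> t) * (indicator ?D x * (?g x \<bullet> t)) + (k1 \<bullet> N) * (indicator ?D x * (?g x \<bullet> N))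
     + ((k2 \<bullet> t) * (indicator (- ?D) x * (?g x \<bullet> t)) + (k2 \<bullet> N) * (indicator (- ?D) x * (?g x \<bullet> N))))"
    unfolding lebesgue_on_UNIV_eq
    by (intro Bochner_Integration.integral_cong) (auto simp: indicator_def ex[of k1 "bgrad m r y" for y] ex[of k2 "bgrad m r y" for y])
  also have "\<dots> = (k1 \<bullet> N) * flux m N r - (k2 \<bullet> N) * flux m N r"
    using i[OF D(1)] i[OF D(2)] z1 z2 by (simp add: flux_def)
  finally show ?thesis by (simp add: inner_diff_left algebra_simps)
qed

text \<open>On the disc of radius \<open>r/4\<close> around \<open>m + (r/2) N\<close> one has
  \<open>|x - m|^2 \<le> 9/16 r^2\<close>, so the slope of the profile is at least
  \<open>exp (-16/7)\<close>, while \<open>(x - m) \<bullet> N \<ge> r/4\<close> and the chain rule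
  gives \<open>2 / r^2\<close>. Multiplying by the area \<open>pi r^2 / 16\<close> yields this
  constant times \<open>r\<close>.\<close>

definition flux_const :: real where "flux_const = exp (- (16 / 7)) * pi / 32"

lemma flux_const_pos: "flux_const > 0"
  by (simp add: flux_const_def)

lemma measure_ball2: "r \<ge> 0 \<Longrightarrow> measure lebesgue (ball (m :: real^2) r) = pi * r\<^sup>2"
  using content_ball[of r m] by (simp add: unit_ball_vol_2)

text \<open>The bump decreases away from its centre, so its normal derivative has one sign on the
  half plane; a lower bound on a small disc therefore suffices.\<close>

lemma flux_bound:
  assumes N: "is_normal t N" and r: "r > 0"
  shows "flux_const * r \<le> \<bar>flux m N r\<bar>"
proof -
  let ?D = "{x. 0 < (x - m) \<bullet> N}" and ?g = "bgrad m r"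
  let ?B = "ball (m + (r/2) *\<^sub>R N) (r/4)"
  let ?c = "exp (- (16 / 7)) / (2 * r)"
  note n = is_normal_simps[OF N]
  have D: "?D \<in> sets lebesgue" using half_plane_borel[of m N] by auto
  have le: "?c * indicator ?B x \<le> - (indicator ?D x * (?g x \<bullet> N))" for x
  proof -
    let ?s = "1 - ((x - m) \<bullet> (x - m)) / r\<^sup>2"
    have g: "?g x \<bullet> N = - (bump 1 ?s * (2 / r\<^sup>2) * ((x - m) \<bullet> N))"
      by (simp add: bgrad_def grad_radial_bump)
    have b0: "bump 1 ?s \<ge> 0" by (simp add: bump_1_eq)
    show ?thesis
    proof (cases "x \<in> ?B")
      case True
      define y where "y = x - m - (r/2) *\<^sub>R N"
      have y: "norm y < r / 4" using True by (simp add: y_def dist_norm norm_minus_commute algebra_simps)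
      have xm: "x - m = (r/2) *\<^sub>R N + y" by (simp add: y_def)
      have "\<bar>y \<bullet> N\<bar> \<le> norm y" using Cauchy_Schwarz_ineq2[of y N] n by simp
      moreover have "(x - m) \<bullet> N = r / 2 + y \<bullet> N" unfolding xm using n by (simp add: inner_add_left)
      ultimately have xN: "r / 4 \<le> (x - m) \<bullet> N" using y by linarith
      have "norm (x - m) \<le> norm ((r/2) *\<^sub>R N) + norm y" unfolding xm by (rule norm_triangle_ineq)
      then have "norm (x - m) \<le> 3 / 4 * r" using y n r by simp
      then have "(norm (x - m))\<^sup>2 \<le> (3 / 4 * r)\<^sup>2" by (intro power_mono) auto
      then have "(x - m) \<bullet> (x - m) \<le> 9 / 16 * r\<^sup>2"
        by (simp only: power2_norm_eq_inner power_mult_distrib) (simp add: power2_eq_square)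
      then have "((x - m) \<bullet> (x - m)) / r\<^sup>2 \<le> 9 / 16" using r by (simp add: pos_divide_le_eq)
      moreover have "0 \<le> ((x - m) \<bullet> (x - m)) / r\<^sup>2" by simp
      ultimately have s: "7 / 16 \<le> ?s" "?s \<le> 1" by linarith+
      have "1 / ?s \<le> 1 / (7 / 16)" using s(1) by (intro divide_left_mono) auto
      then have "exp (- (16 / 7)) \<le> exp (- (1 / ?s))" by simp
      moreover have "exp (- (1 / ?s)) \<le> exp (- (1 / ?s)) / ?s\<^sup>2"
      proof -
        have "?s\<^sup>2 \<le> 1" by (intro power_le_one; use s in linarith)
        moreover have "?s\<^sup>2 > 0" using s by (intro zero_less_power) linarith
        ultimately show ?thesis by (simp only: pos_le_divide_eq) (simp add: mult_left_le)
      qed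
      ultimately have "exp (- (16 / 7)) \<le> exp (- (1 / ?s)) / ?s\<^sup>2" by (rule order_trans)
      moreover have "?s > 0" using s by linarith
      ultimately have "exp (- (16 / 7)) \<le> bump 1 ?s" by (simp only: One_nat_def bump_1_eq if_True)
      then have "exp (- (16 / 7)) * (2 / r\<^sup>2) * (r / 4) \<le> bump 1 ?s * (2 / r\<^sup>2) * ((x - m) \<bullet> N)"
        using xN r b0 by (intro mult_mono) auto
      moreover have "exp (- (16 / 7)) * (2 / r\<^sup>2) * (r / 4) = ?c" using r by (simp add: power2_eq_square field_simps)
      moreover have "x \<in> ?D" using xN r by simp
      ultimately show ?thesis using True g by simp
    next
      case False
      then show ?thesis using b0 by (auto simp: g indicator_def)
    qed
  qed
  have "(LINT x|lebesgue. ?c * indicator ?B x) \<le> (LINT x|lebesgue. - (indicator ?D x * (?g x \<bullet> N)))"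
  proof (rule integral_mono[OF _ _ le])
    show "integrable lebesgue (\<lambda>x. ?c * indicator ?B x)"
      using lmeasurable_ball[of "m + (r/2) *\<^sub>R N" "r/4"]
      by (intro integrable_mult_right integrable_real_indicator) (auto simp: fmeasurable_def)
    show "integrable lebesgue (\<lambda>x. - (indicator ?D x * (?g x \<bullet> N)))"
      using integrable_mult_indicator[OF D bgrad_inner_integrable[OF r, of m N]] by simp
  qed
  also have "(LINT x|lebesgue. - (indicator ?D x * (?g x \<bullet> N))) = - flux m N r" by (simp add: flux_def)
  also have "(LINT x|lebesgue. ?c * indicator ?B x) = ?c * measure lebesgue ?B" by simp
  also have "\<dots> = ?c * (pi * (r/4)\<^sup>2)" using r by (subst measure_ball2) auto
  also have "\<dots> = flux_const * r" using r by (simp add: flux_const_def power2_eq_square)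
  finally show ?thesis by linarith
qed

lemma integral_bound_by_norm:
  fixes h :: "real^2 \<Rightarrow> real"
  assumes "L2 B H" "B \<in> lmeasurable" "\<And>x. \<bar>h x\<bar> \<le> M * norm (H x)" "M \<ge> 0"
  shows "\<bar>LINT x|lebesgue_on B. h x\<bar> \<le> M * (LINT x|lebesgue_on B. norm (H x))"
proof (cases "integrable (lebesgue_on B) h")
  case True
  have i: "integrable (lebesgue_on B) (\<lambda>x. M * norm (H x))"
    by (intro integrable_mult_right L2_integrable L2_norm assms)
  have "\<bar>LINT x|lebesgue_on B. h x\<bar> \<le> (LINT x|lebesgue_on B. \<bar>h x\<bar>)" by (rule integral_abs_bound)
  also have "\<dots> \<le> (LINT x|lebesgue_on B. M * norm (H x))"
    using True i assms(3) by (intro integral_mono) auto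
  finally show ?thesis by simp
next
  case False
  \<comment> \<open>A non-integrable function has integral 0 by convention, and the right-hand side
    is nonnegative.\<close>
  then show ?thesis using assms(4) by (simp add: not_integrable_integral_eq integral_nonneg_AE)
qed

lemma transpose_inner: "(transpose A *v x) \<bullet> y = x \<bullet> (A *v y)" for A :: "real^2^2"
  by (simp add: dot_lmul_matrix)

lemma outer_inner: "(A :: real^2^2) \<bullet> (\<chi> i j. w $ i * g $ j) = w \<bullet> (A *v g)"
  by (simp add: inner_vec_def matrix_vector_mult_def sum_2 algebra_simps)

section \<open>Jumps of arbitrary constants across a disc contained in the domain\<close>

context
  fixes U :: "(real^2) set" and u :: "real^2 \<Rightarrow> real^2" and G :: "real^2 \<Rightarrow> real^2^2"
    and p :: "real^2 \<Rightarrow> real" and F :: "real^2 \<Rightarrow> real^2" and \<nu> r :: real and m t N :: "real^2"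
    and A1 A2 :: "real^2^2" and c1 c2 :: real
  assumes U: "open U" "bounded U" and G: "has_grad U u G" and div0: "AE x in lebesgue_on U. trace (G x) = 0"
    and p: "L2 U p" and F: "L2 U F" and \<nu>: "\<nu> > 0"
    and eq: "\<And>\<phi> w. test_fun U \<phi> \<Longrightarrow>
      (LINT x|lebesgue_on U. \<nu> * (G x \<bullet> (\<chi> i j. w $ i * pd j \<phi> x)) + p x * (w \<bullet> (\<chi> j. pd j \<phi> x)))
      = (LINT x|lebesgue_on U. \<phi> x * (F x \<bullet> w))"
    and N: "is_normal t N" and r: "r > 0" and B: "cball m r \<subseteq> U"
begin

abbreviation "ball_B \<equiv> ball m r"
abbreviation "grad_g \<equiv> bgrad m r"
abbreviation "A_pw x \<equiv> (if 0 < (x - m) \<bullet> N then A1 else A2)"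
abbreviation "c_pw x \<equiv> (if 0 < (x - m) \<bullet> N then c1 else c2)"
abbreviation "int_norm H \<equiv> (LINT x|lebesgue_on ball_B. norm (H x))"

lemma ballB: "ball_B \<subseteq> U" "ball_B \<in> sets lebesgue" "ball_B \<in> lmeasurable" "U \<in> sets lebesgue"
  using B ball_subset_cball[of m r] U by auto

lemma L2B: "L2 U f \<Longrightarrow> L2 ball_B f"
  by (rule L2_subset[OF _ ballB(1,2,4)])

lemma L2_pw: "L2 ball_B (\<lambda>x. if 0 < (x - m) \<bullet> N then k1 else k2)"
proof (rule L2_bounded[OF ballB(3), where B = "max (norm k1) (norm k2)"])
  have "(\<lambda>x. if x \<in> {x. 0 < (x - m) \<bullet> N} then k1 else k2) \<in> borel_measurable borel"
    by (rule measurable_If_set) (use half_plane_borel[of m N] in auto)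
  then have "(\<lambda>x. if x \<in> {x. 0 < (x - m) \<bullet> N} then k1 else k2) \<in> borel_measurable lebesgue"
    by (intro measurable_completion) simp
  then show "(\<lambda>x. if 0 < (x - m) \<bullet> N then k1 else k2) \<in> borel_measurable (lebesgue_on ball_B)"
    by (intro measurable_restrict_space1) simp
qed auto

lemma L2_G: "L2 U G" using G by (simp add: has_grad_def)

lemma L2_g: "L2 ball_B grad_g"
  by (rule L2_continuous[OF bounded_ball ballB(2) continuous_bgrad[OF r]])

lemma L2_GA: "L2 ball_B (\<lambda>x. G x - A_pw x)" and L2_pc: "L2 ball_B (\<lambda>x. p x - c_pw x)"
  by (intro L2_diff L2B L2_G p L2_pw)+

lemma L2_transpose_mult: "L2 ball_B H \<Longrightarrow> L2 ball_B (\<lambda>x. transpose (H x :: real^2^2) *v w)"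
proof (rule L2_vecI)
  fix i assume H: "L2 ball_B H"
  have "(\<lambda>x. (transpose (H x) *v w) $ i) = (\<lambda>x. w $ 1 *\<^sub>R H x $ 1 $ i + w $ 2 *\<^sub>R H x $ 2 $ i)"
    by (simp add: fun_eq_iff matrix_vector_mult_def transpose_def sum_2 mult.commute)
  then show "L2 ball_B (\<lambda>x. (transpose (H x) *v w) $ i)"
    by (simp only:) (intro L2_add L2_scaleR L2_grad_component H)
qed

text \<open>Duality: the choice \<open>w = J\<close> turns bounds in all directions into a bound for
  the norm, and the lower bound of the flux replaces the flux itself.\<close>

lemma flux_le_imp:
  assumes "\<And>w. \<bar>flux m N r * (w \<bullet> J)\<bar> \<le> norm w * K" "K \<ge> 0"
  shows "flux_const * r * norm J \<le> K"
proof (cases "J = 0")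
  case False
  have "\<bar>flux m N r\<bar> * (norm J * norm J) \<le> norm J * K"
    using assms(1)[of J] by (simp add: abs_mult power2_eq_square flip: power2_norm_eq_inner)
  then have "\<bar>flux m N r\<bar> * norm J \<le> K" using False by (simp add: mult.left_commute)
  moreover have "flux_const * r * norm J \<le> \<bar>flux m N r\<bar> * norm J"
    by (intro mult_right_mono flux_bound[OF N r]) auto
  ultimately show ?thesis by linarith
qed (use assms(2) in simp)

lemma int_norm_nonneg: "0 \<le> int_norm H"
  by (rule integral_nonneg_AE) auto

text \<open>The test field has gradient \<open>w\<close> tensor \<open>grad_g\<close>, and
  \<open>A\<close> contracted with it is the inner product of \<open>transpose A *v w\<close> with
  \<open>grad_g\<close>. Splitting off the constants \<open>A_pw\<close> and \<open>c_pw\<close>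
  leaves errors of gradient and pressure, and the constants turn into the jump via
  \<open>jump_identity\<close>.\<close>

lemma momentum_jump:
  "flux_const * r * norm ((\<nu> *\<^sub>R (A1 - A2) + (c1 - c2) *\<^sub>R mat 1) *v N)
    \<le> int_norm F + 2 * bump_bound / r * (\<nu> * int_norm (\<lambda>x. G x - A_pw x) + int_norm (\<lambda>x. p x - c_pw x))"
proof (rule flux_le_imp)
  fix w :: "real^2"
  let ?\<phi> = "radial_bump m r"
  let ?k = "\<lambda>A c. \<nu> *\<^sub>R (transpose A *v w) + c *\<^sub>R w"
  have \<phi>: "test_fun U ?\<phi>" by (rule test_fun_radial_bump[OF B r])
  have \<phi>0: "?\<phi> x = 0" if "x \<notin> ball_B" for x
    unfolding radial_bump_def by (rule radial_bump_outside[OF that r])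
  have i1: "integrable (lebesgue_on ball_B) (\<lambda>x. ((transpose (G x - A_pw x)) *v w) \<bullet> grad_g x)"
    by (intro L2_inner_integrable L2_transpose_mult L2_GA L2_g)
  have wg: "L2 ball_B (\<lambda>x. w \<bullet> grad_g x)"
    by (rule L2_continuous[OF bounded_ball ballB(2)]) (intro continuous_intros continuous_bgrad[OF r])
  have i2: "integrable (lebesgue_on ball_B) (\<lambda>x. (p x - c_pw x) * (w \<bullet> grad_g x))"
    by (rule L2_mult_integrable[OF L2_pc wg])
  have i3: "integrable (lebesgue_on ball_B) (\<lambda>x. (if 0 < (x - m) \<bullet> N then ?k A1 c1 else ?k A2 c2) \<bullet> grad_g x)"
    by (rule L2_inner_integrable[OF L2_pw L2_g])
  have "(LINT x|lebesgue_on ball_B. ?\<phi> x * (F x \<bullet> w)) = (LINT x|lebesgue_on U. ?\<phi> x * (F x \<bullet> w))"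
    using \<phi>0 by (intro integral_lebesgue_on_eq[symmetric] ballB) auto
  also have "\<dots> = (LINT x|lebesgue_on U. \<nu> * (G x \<bullet> (\<chi> i j. w $ i * grad_g x $ j)) + p x * (w \<bullet> grad_g x))"
    using eq[OF \<phi>, of w] by (simp add: bgrad_def)
  also have "\<dots> = (LINT x|lebesgue_on ball_B. \<nu> * (G x \<bullet> (\<chi> i j. w $ i * grad_g x $ j)) + p x * (w \<bullet> grad_g x))"
    using bgrad_outside[OF _ r, of _ m] by (intro integral_lebesgue_on_eq ballB) (simp add: zero_vec_def[symmetric])
  also have "\<dots> = (LINT x|lebesgue_on ball_B. \<nu> * (((transpose (G x - A_pw x)) *v w) \<bullet> grad_g x) + (p x - c_pw x) * (w \<bullet> grad_g x)
      + (if 0 < (x - m) \<bullet> N then ?k A1 c1 else ?k A2 c2) \<bullet> grad_g x)"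
    by (intro Bochner_Integration.integral_cong)
      (auto simp: outer_inner dot_lmul_matrix inner_add_left inner_diff_right matrix_vector_mult_diff_rdistrib algebra_simps)
  also have "\<dots> = \<nu> * (LINT x|lebesgue_on ball_B. ((transpose (G x - A_pw x)) *v w) \<bullet> grad_g x)
      + (LINT x|lebesgue_on ball_B. (p x - c_pw x) * (w \<bullet> grad_g x)) + flux m N r * ((?k A1 c1 - ?k A2 c2) \<bullet> N)"
    using i1 i2 i3 by (simp add: jump_identity[OF N r])
  also have "(?k A1 c1 - ?k A2 c2) \<bullet> N = w \<bullet> ((\<nu> *\<^sub>R (A1 - A2) + (c1 - c2) *\<^sub>R mat 1) *v N)"
    by (simp add: inner_diff_left inner_add_left dot_lmul_matrix matrix_vector_mult_diff_rdistrib matrix_vector_mult_add_rdistrib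
        scaleR_matrix_vector_assoc[symmetric] inner_add_right inner_diff_right algebra_simps)
  finally have id: "flux m N r * (w \<bullet> ((\<nu> *\<^sub>R (A1 - A2) + (c1 - c2) *\<^sub>R mat 1) *v N))
     = (LINT x|lebesgue_on ball_B. ?\<phi> x * (F x \<bullet> w)) - \<nu> * (LINT x|lebesgue_on ball_B. ((transpose (G x - A_pw x)) *v w) \<bullet> grad_g x)
      - (LINT x|lebesgue_on ball_B. (p x - c_pw x) * (w \<bullet> grad_g x))" by linarith
  let ?C = "2 * bump_bound / r"
  have C: "?C \<ge> 0" using r bump_bound_nonneg by simp
  have b1: "\<bar>LINT x|lebesgue_on ball_B. ?\<phi> x * (F x \<bullet> w)\<bar> \<le> norm w * int_norm F"
  proof (rule integral_bound_by_norm[OF L2B[OF F] ballB(3)])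
    fix x
    have "\<bar>?\<phi> x\<bar> * \<bar>F x \<bullet> w\<bar> \<le> 1 * (norm (F x) * norm w)"
      using radial_bump_bounds[of m r x] by (intro mult_mono Cauchy_Schwarz_ineq2) auto
    then show "\<bar>?\<phi> x * (F x \<bullet> w)\<bar> \<le> norm w * norm (F x)" by (simp add: abs_mult mult.commute)
  qed simp
  have b2: "\<bar>LINT x|lebesgue_on ball_B. ((transpose (G x - A_pw x)) *v w) \<bullet> grad_g x\<bar> \<le> (norm w * ?C) * int_norm (\<lambda>x. G x - A_pw x)"
  proof (rule integral_bound_by_norm[OF L2_GA ballB(3)])
    fix x
    have "\<bar>w \<bullet> ((G x - A_pw x) *v grad_g x)\<bar> \<le> norm w * norm ((G x - A_pw x) *v grad_g x)" by (rule Cauchy_Schwarz_ineq2)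
    also have "\<dots> \<le> norm w * (norm (G x - A_pw x) * ?C)"
      by (intro mult_left_mono order_trans[OF norm_matrix_vector_le] norm_bgrad[OF r]) auto
    finally show "\<bar>((transpose (G x - A_pw x)) *v w) \<bullet> grad_g x\<bar> \<le> (norm w * ?C) * norm (G x - A_pw x)"
      by (simp only: transpose_inner mult_ac)
  qed (rule mult_nonneg_nonneg[OF norm_ge_zero C])
  have b3: "\<bar>LINT x|lebesgue_on ball_B. (p x - c_pw x) * (w \<bullet> grad_g x)\<bar> \<le> (norm w * ?C) * int_norm (\<lambda>x. p x - c_pw x)"
  proof (rule integral_bound_by_norm[OF L2_pc ballB(3)])
    fix x
    have "\<bar>w \<bullet> grad_g x\<bar> \<le> norm w * ?C"
      by (rule order_trans[OF Cauchy_Schwarz_ineq2]) (intro mult_left_mono norm_bgrad[OF r] norm_ge_zero)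
    then show "\<bar>(p x - c_pw x) * (w \<bullet> grad_g x)\<bar> \<le> (norm w * ?C) * norm (p x - c_pw x)"
      unfolding abs_mult real_norm_def by (subst mult.commute) (intro mult_right_mono, auto)
  qed (rule mult_nonneg_nonneg[OF norm_ge_zero C])
  have "\<bar>flux m N r * (w \<bullet> ((\<nu> *\<^sub>R (A1 - A2) + (c1 - c2) *\<^sub>R mat 1) *v N))\<bar>
    \<le> \<bar>LINT x|lebesgue_on ball_B. ?\<phi> x * (F x \<bullet> w)\<bar> + \<nu> * \<bar>LINT x|lebesgue_on ball_B. ((transpose (G x - A_pw x)) *v w) \<bullet> grad_g x\<bar>
      + \<bar>LINT x|lebesgue_on ball_B. (p x - c_pw x) * (w \<bullet> grad_g x)\<bar>"
  proof -
    have "\<bar>x - \<nu> * y - z\<bar> \<le> \<bar>x\<bar> + \<nu> * \<bar>y\<bar> + \<bar>z\<bar>" for x y z :: real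
    proof -
      have "\<bar>\<nu> * y\<bar> = \<nu> * \<bar>y\<bar>" using \<nu> by (simp add: abs_mult)
      then show ?thesis by linarith
    qed
    then show ?thesis unfolding id .
  qed
  also have "\<dots> \<le> norm w * int_norm F + \<nu> * ((norm w * ?C) * int_norm (\<lambda>x. G x - A_pw x)) + (norm w * ?C) * int_norm (\<lambda>x. p x - c_pw x)"
    using \<nu> by (intro add_mono mult_left_mono b1 b2 b3) auto
  finally show "\<bar>flux m N r * (w \<bullet> ((\<nu> *\<^sub>R (A1 - A2) + (c1 - c2) *\<^sub>R mat 1) *v N))\<bar>
    \<le> norm w * (int_norm F + ?C * (\<nu> * int_norm (\<lambda>x. G x - A_pw x) + int_norm (\<lambda>x. p x - c_pw x)))"
    by (simp add: algebra_simps)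
qed (use \<nu> r bump_bound_nonneg int_norm_nonneg in \<open>auto intro!: add_nonneg_nonneg mult_nonneg_nonneg divide_nonneg_nonneg\<close>)

text \<open>Conformity: the rotated gradient of the bump is divergence free, so it annihilates weak gradients.\<close>

lemma tangential_jump:
  "flux_const * r * norm ((A1 - A2) *v perp N) \<le> 2 * bump_bound / r * int_norm (\<lambda>x. G x - A_pw x)"
proof (rule flux_le_imp)
  fix w :: "real^2"
  let ?\<phi> = "radial_bump m r"
  let ?C = "2 * bump_bound / r"
  \<comment> \<open>The quarter turn is moved from the gradient onto the constant, so that
    \<open>jump_identity\<close> applies; paired with \<open>N\<close> it yields the tangential
    column of the jump.\<close>
  let ?k = "\<lambda>A. - perp (transpose A *v w)"
  have C: "?C \<ge> 0" using r bump_bound_nonneg by simp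
  have \<phi>: "test_fun U ?\<phi>" by (rule test_fun_radial_bump[OF B r])
  have k: "(- perp y) \<bullet> z = y \<bullet> perp z" for y z :: "real^2" by (simp add: inner_vec_def sum_2 perp_simps)
  then have k2: "perp y \<bullet> z = - (y \<bullet> perp z)" for y z :: "real^2" by (simp add: minus_equation_iff[of "perp y \<bullet> z"] eq_commute)
  have LG: "L2 U (\<lambda>x. G x $ i $ j)" for i j by (rule L2_grad_component[OF L2_G])
  have Lpd: "L2 U (pd j ?\<phi>)" for j by (rule test_fun_L2[OF test_fun_pd[OF \<phi>] U(2,1)])
  \<comment> \<open>Both sides are minus the integral of the same component of \<open>u\<close>
    against a mixed second derivative of the bump, in either order.\<close>
  have c: "(LINT x|lebesgue_on U. G x $ i $ 1 * pd 2 ?\<phi> x) = (LINT x|lebesgue_on U. G x $ i $ 2 * pd 1 ?\<phi> x)" for i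
  proof -
    have w: "weak_pd U j (\<lambda>x. u x $ i) (\<lambda>x. G x $ i $ j)" for j using G by (simp add: has_grad_def)
    have "(LINT x|lebesgue_on U. u x $ i * pd 1 (pd 2 ?\<phi>) x) = - (LINT x|lebesgue_on U. G x $ i $ 1 * pd 2 ?\<phi> x)"
      "(LINT x|lebesgue_on U. u x $ i * pd 2 (pd 1 ?\<phi>) x) = - (LINT x|lebesgue_on U. G x $ i $ 2 * pd 1 ?\<phi> x)"
      using w[of 1] w[of 2] test_fun_pd[OF \<phi>] unfolding weak_pd_def by blast+
    then show ?thesis using pd_radial_bump_symmetric[of 1 2 m r] by simp
  qed
  have "(LINT x|lebesgue_on U. (transpose (G x) *v w) \<bullet> perp (grad_g x))
      = (LINT x|lebesgue_on U. w $ 1 * (G x $ 1 $ 1 * pd 2 ?\<phi> x) - w $ 1 * (G x $ 1 $ 2 * pd 1 ?\<phi> x)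
         + (w $ 2 * (G x $ 2 $ 1 * pd 2 ?\<phi> x) - w $ 2 * (G x $ 2 $ 2 * pd 1 ?\<phi> x)))"
    by (simp add: transpose_def inner_vec_def sum_2 matrix_vector_mult_def perp_simps bgrad_def algebra_simps)
  also have "\<dots> = 0" using c LG Lpd by (simp add: L2_mult_integrable)
  finally have z: "(LINT x|lebesgue_on U. (transpose (G x) *v w) \<bullet> perp (grad_g x)) = 0" .
  have p0: "perp 0 = 0" by (simp add: vec_eq_iff forall_2 perp_simps)
  have i1: "integrable (lebesgue_on ball_B) (\<lambda>x. (transpose (G x - A_pw x) *v w) \<bullet> perp (grad_g x))"
  proof (rule L2_inner_integrable[OF L2_transpose_mult[OF L2_GA]])
    show "L2 ball_B (\<lambda>x. perp (grad_g x))"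
    proof (rule L2_vecI)
      show "L2 ball_B (\<lambda>x. perp (grad_g x) $ i)" for i
        using exhaust_2[of i] L2_vec_component[OF L2_g, of 2] L2_scaleR[OF L2_vec_component[OF L2_g, of 1], of "-1"]
        by (auto simp: perp_simps)
    qed
  qed
  have i3: "integrable (lebesgue_on ball_B) (\<lambda>x. (if 0 < (x - m) \<bullet> N then ?k A1 else ?k A2) \<bullet> grad_g x)"
    by (rule L2_inner_integrable[OF L2_pw L2_g])
  have "0 = (LINT x|lebesgue_on ball_B. (transpose (G x) *v w) \<bullet> perp (grad_g x))"
    unfolding z[symmetric] using bgrad_outside[OF _ r, of _ m] by (intro integral_lebesgue_on_eq ballB) (simp add: p0)
  also have "\<dots> = (LINT x|lebesgue_on ball_B. (transpose (G x - A_pw x) *v w) \<bullet> perp (grad_g x)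
      + (if 0 < (x - m) \<bullet> N then ?k A1 else ?k A2) \<bullet> grad_g x)"
    by (intro Bochner_Integration.integral_cong) (auto simp: k2 dot_lmul_matrix matrix_vector_mult_diff_rdistrib inner_diff_right)
  also have "\<dots> = (LINT x|lebesgue_on ball_B. (transpose (G x - A_pw x) *v w) \<bullet> perp (grad_g x)) + flux m N r * ((?k A1 - ?k A2) \<bullet> N)"
    using i1 i3 by (simp add: jump_identity[OF N r])
  also have "(?k A1 - ?k A2) \<bullet> N = w \<bullet> ((A1 - A2) *v perp N)"
    unfolding inner_diff_left k transpose_inner by (simp add: matrix_vector_mult_diff_rdistrib inner_diff_right)
  finally have id: "flux m N r * (w \<bullet> ((A1 - A2) *v perp N)) = - (LINT x|lebesgue_on ball_B. (transpose (G x - A_pw x) *v w) \<bullet> perp (grad_g x))"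
    by linarith
  have "\<bar>LINT x|lebesgue_on ball_B. (transpose (G x - A_pw x) *v w) \<bullet> perp (grad_g x)\<bar> \<le> (norm w * ?C) * int_norm (\<lambda>x. G x - A_pw x)"
  proof (rule integral_bound_by_norm[OF L2_GA ballB(3)])
    fix x
    have "\<bar>w \<bullet> ((G x - A_pw x) *v perp (grad_g x))\<bar> \<le> norm w * norm ((G x - A_pw x) *v perp (grad_g x))" by (rule Cauchy_Schwarz_ineq2)
    also have "\<dots> \<le> norm w * (norm (G x - A_pw x) * ?C)"
      by (intro mult_left_mono order_trans[OF norm_matrix_vector_le]) (simp_all add: norm_perp norm_bgrad[OF r])
    finally show "\<bar>(transpose (G x - A_pw x) *v w) \<bullet> perp (grad_g x)\<bar> \<le> (norm w * ?C) * norm (G x - A_pw x)"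
      by (simp only: transpose_inner mult_ac)
  qed (rule mult_nonneg_nonneg[OF norm_ge_zero C])
  then show "\<bar>flux m N r * (w \<bullet> ((A1 - A2) *v perp N))\<bar> \<le> norm w * (?C * int_norm (\<lambda>x. G x - A_pw x))"
    unfolding id by (simp add: mult.assoc)
qed (use r bump_bound_nonneg int_norm_nonneg in \<open>auto intro!: mult_nonneg_nonneg divide_nonneg_nonneg\<close>)

text \<open>Since \<open>trace (G x)\<close> vanishes almost everywhere, the piecewise constant
  trace equals minus the trace of the gradient error. Multiplying by the normal derivative of the
  bump makes \<open>jump_identity\<close> produce the jump of the trace.\<close>

lemma trace_jump:
  "flux_const * r * \<bar>trace (A1 - A2)\<bar> \<le> 2 * bump_bound / r * (2 * int_norm (\<lambda>x. G x - A_pw x))"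
proof -
  let ?C = "2 * bump_bound / r"
  have C: "?C \<ge> 0" using r bump_bound_nonneg by simp
  have "flux m N r * ((trace A1 *\<^sub>R N - trace A2 *\<^sub>R N) \<bullet> N)
      = (LINT x|lebesgue_on ball_B. (if 0 < (x - m) \<bullet> N then trace A1 *\<^sub>R N else trace A2 *\<^sub>R N) \<bullet> grad_g x)"
    by (rule jump_identity[OF N r, symmetric])
  also have "\<dots> = (LINT x|lebesgue_on ball_B. - trace (G x - A_pw x) * (N \<bullet> grad_g x))"
  proof (rule integral_cong_AE)
    show "(\<lambda>x. (if 0 < (x - m) \<bullet> N then trace A1 *\<^sub>R N else trace A2 *\<^sub>R N) \<bullet> grad_g x) \<in> borel_measurable (lebesgue_on ball_B)"
      by (rule borel_measurable_integrable[OF L2_inner_integrable[OF L2_pw L2_g]])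
    have "L2 ball_B (\<lambda>x. trace (G x - A_pw x))"
      unfolding trace_def sum_2 by (intro L2_add L2_grad_component L2_GA)
    then show "(\<lambda>x. - trace (G x - A_pw x) * (N \<bullet> grad_g x)) \<in> borel_measurable (lebesgue_on ball_B)"
      using L2D(1)[OF L2_g] by (intro borel_measurable_times borel_measurable_uminus borel_measurable_inner) (auto dest: L2D(1))
    show "AE x in lebesgue_on ball_B. (if 0 < (x - m) \<bullet> N then trace A1 *\<^sub>R N else trace A2 *\<^sub>R N) \<bullet> grad_g x
        = - trace (G x - A_pw x) * (N \<bullet> grad_g x)"
      using AE_lebesgue_on_subset[OF div0 ballB(1,2,4)]
      by eventually_elim (auto simp: trace_sub)
  qed
  finally have *: "flux m N r * ((trace A1 *\<^sub>R N - trace A2 *\<^sub>R N) \<bullet> N)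
     = (LINT x|lebesgue_on ball_B. - trace (G x - A_pw x) * (N \<bullet> grad_g x))" .
  have "(trace A1 *\<^sub>R N - trace A2 *\<^sub>R N) \<bullet> N = trace (A1 - A2)"
    using is_normal_simps[OF N] by (simp add: inner_diff_left trace_sub)
  then have "\<bar>flux m N r\<bar> * \<bar>trace (A1 - A2)\<bar> = \<bar>LINT x|lebesgue_on ball_B. - trace (G x - A_pw x) * (N \<bullet> grad_g x)\<bar>"
    unfolding *[symmetric] by (simp only: abs_mult)
  also have "\<dots> \<le> (2 * ?C) * int_norm (\<lambda>x. G x - A_pw x)"
  proof (rule integral_bound_by_norm[OF L2_GA ballB(3)])
    fix x
    have "\<bar>N \<bullet> grad_g x\<bar> \<le> ?C"
      using order_trans[OF Cauchy_Schwarz_ineq2[of N "grad_g x"]] norm_bgrad[OF r, of m x] is_normal_simps[OF N] by simp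
    then have "\<bar>trace (G x - A_pw x)\<bar> * \<bar>N \<bullet> grad_g x\<bar> \<le> (2 * norm (G x - A_pw x)) * ?C"
      by (intro mult_mono abs_trace_le) auto
    then show "\<bar>- trace (G x - A_pw x) * (N \<bullet> grad_g x)\<bar> \<le> (2 * ?C) * norm (G x - A_pw x)"
      by (simp add: abs_mult mult_ac)
  qed (use C in simp)
  finally have "\<bar>flux m N r\<bar> * \<bar>trace (A1 - A2)\<bar> \<le> ?C * (2 * int_norm (\<lambda>x. G x - A_pw x))" by (simp add: mult_ac)
  moreover have "flux_const * r * \<bar>trace (A1 - A2)\<bar> \<le> \<bar>flux m N r\<bar> * \<bar>trace (A1 - A2)\<bar>"
    by (intro mult_right_mono flux_bound[OF N r]) auto
  ultimately show ?thesis by linarith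
qed

text \<open>
  The estimator carries \<open>- p_h\<close>, whereas the momentum residual controls the jump with \<open>+ p_h\<close>. The
  normal-normal part of the velocity gradient jump is controlled separately, as trace minus
  tangential-tangential part, which makes the sign of the pressure irrelevant.
\<close>

lemma stress_jump_le:
  "norm ((\<nu> *\<^sub>R (A1 - A2) - (c1 - c2) *\<^sub>R mat 1) *v N)
    \<le> 3 * norm ((\<nu> *\<^sub>R (A1 - A2) + (c1 - c2) *\<^sub>R mat 1) *v N)
      + 2 * \<nu> * \<bar>trace (A1 - A2)\<bar> + 2 * \<nu> * norm ((A1 - A2) *v perp N)"
proof -
  define A where "A = A1 - A2"
  define c where "c = c1 - c2"
  define J where "J = (\<nu> *\<^sub>R A + c *\<^sub>R mat 1) *v N"
  note n = is_normal_simps[OF N]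
  have n1: "N$1 * N$1 + N$2 * N$2 = 1" using n(4) by (simp add: inner_vec_def sum_2)
  have J: "J = \<nu> *\<^sub>R (A *v N) + c *\<^sub>R N" by (simp add: J_def matrix_vector_mult_add_rdistrib scaleR_matrix_vector_assoc[symmetric])
  \<comment> \<open>Reversing the sign of the pressure jump changes the vector by
    \<open>2 c N\<close>. Since \<open>c\<close> itself costs one \<open>J\<close>, the momentum
    part appears with the factor 3 = 1 + 2.\<close>
  have J': "(\<nu> *\<^sub>R A - c *\<^sub>R mat 1) *v N = J - (2 * c) *\<^sub>R N"
  proof -
    have "(2 * c) *\<^sub>R N = c *\<^sub>R N + c *\<^sub>R N" by (simp flip: scaleR_left_distrib)
    then show ?thesis unfolding J
      by (simp add: matrix_vector_mult_diff_rdistrib scaleR_matrix_vector_assoc[symmetric])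
  qed
  have tr: "trace A = N \<bullet> (A *v N) + perp N \<bullet> (A *v perp N)"
  proof -
    have "N \<bullet> (A *v N) + perp N \<bullet> (A *v perp N) = (A$1$1 + A$2$2) * (N$1 * N$1 + N$2 * N$2)"
      by (simp add: inner_vec_def matrix_vector_mult_def sum_2 perp_simps algebra_simps)
    then show ?thesis by (simp add: n1 trace_def sum_2)
  qed
  have "J \<bullet> N = \<nu> * (N \<bullet> (A *v N)) + c" 
  proof -
    have "J \<bullet> N = N \<bullet> J" by (rule inner_commute)
    also have "\<dots> = \<nu> * (N \<bullet> (A *v N)) + c" unfolding J using n(4) by (simp add: inner_add_right)
    finally show ?thesis .
  qed
  then have "c = J \<bullet> N - \<nu> * trace A + \<nu> * (perp N \<bullet> (A *v perp N))" unfolding tr by (simp add: algebra_simps)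
  moreover have "\<bar>J \<bullet> N\<bar> \<le> norm J" "\<bar>perp N \<bullet> (A *v perp N)\<bar> \<le> norm (A *v perp N)"
    using Cauchy_Schwarz_ineq2[of J N] Cauchy_Schwarz_ineq2[of "perp N" "A *v perp N"] n by (simp_all add: norm_perp)
  moreover have "\<bar>\<nu> * trace A\<bar> = \<nu> * \<bar>trace A\<bar>" "\<bar>\<nu> * (perp N \<bullet> (A *v perp N))\<bar> \<le> \<nu> * norm (A *v perp N)"
    using \<nu> calculation(3) by (simp_all add: abs_mult)
  ultimately have "\<bar>c\<bar> \<le> norm J + \<nu> * \<bar>trace A\<bar> + \<nu> * norm (A *v perp N)" by linarith
  moreover have "norm (J - (2 * c) *\<^sub>R N) \<le> norm J + 2 * \<bar>c\<bar>"
    using norm_triangle_ineq4[of J "(2 * c) *\<^sub>R N"] n by (simp add: abs_mult)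
  ultimately show ?thesis unfolding A_def[symmetric] c_def[symmetric] J' J_def[symmetric] by linarith
qed

lemma int_norm_sq: "L2 ball_B H \<Longrightarrow> (int_norm H)\<^sup>2 \<le> pi * r\<^sup>2 * l2_sq ball_B H"
  using L1_le_L2[OF _ ballB(3), of H] measure_ball2[of r m] r by simp

text \<open>The flux supplies one factor \<open>r\<close> on the left. On the right Cauchy-Schwarz
  over the disc supplies \<open>sqrt pi * r\<close>, which cancels the \<open>1 / r\<close> of the
  bump gradient in the error terms and survives only in front of the source.\<close>

lemma stress_jump_bound:
  "flux_const\<^sup>2 * r\<^sup>2 * (norm ((\<nu> *\<^sub>R (A1 - A2) - (c1 - c2) *\<^sub>R mat 1) *v N))\<^sup>2
    \<le> 36 * pi * (r\<^sup>2 * l2_sq ball_B F + 64 * (1 + bump_bound)\<^sup>2 * (\<nu>\<^sup>2 * l2_sq ball_B (\<lambda>x. G x - A_pw x) + l2_sq ball_B (\<lambda>x. p x - c_pw x)))"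
proof -
  define C where "C = 2 * bump_bound / r"
  define a b d where "a = int_norm F" and "b = int_norm (\<lambda>x. G x - A_pw x)" and "d = int_norm (\<lambda>x. p x - c_pw x)"
  have nn: "a \<ge> 0" "b \<ge> 0" "d \<ge> 0" unfolding a_def b_def d_def by (rule int_norm_nonneg)+
  have fr: "flux_const * r > 0" using flux_const_pos r by simp
  let ?J = "norm ((\<nu> *\<^sub>R (A1 - A2) - (c1 - c2) *\<^sub>R mat 1) *v N)"
  have "(flux_const * r) * ?J \<le> (flux_const * r) * (3 * norm ((\<nu> *\<^sub>R (A1 - A2) + (c1 - c2) *\<^sub>R mat 1) *v N)
      + 2 * \<nu> * \<bar>trace (A1 - A2)\<bar> + 2 * \<nu> * norm ((A1 - A2) *v perp N))"
    using fr by (intro mult_left_mono stress_jump_le) auto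
  also have "\<dots> = 3 * (flux_const * r * norm ((\<nu> *\<^sub>R (A1 - A2) + (c1 - c2) *\<^sub>R mat 1) *v N))
      + 2 * \<nu> * (flux_const * r * \<bar>trace (A1 - A2)\<bar>) + 2 * \<nu> * (flux_const * r * norm ((A1 - A2) *v perp N))"
    by (simp add: algebra_simps)
  also have "\<dots> \<le> 3 * (a + C * (\<nu> * b + d)) + 2 * \<nu> * (C * (2 * b)) + 2 * \<nu> * (C * b)"
    using momentum_jump[folded C_def] trace_jump[folded C_def] tangential_jump[folded C_def] \<nu> unfolding a_def b_def d_def by (intro add_mono mult_left_mono) auto
  \<comment> \<open>For the gradient error, 9 = 3 + 4 + 2 collects the momentum, trace and
    tangential contributions.\<close>
  also have "\<dots> = 3 * a + C * (9 * (\<nu> * b)) + C * (3 * d)" by (simp add: algebra_simps add_divide_distrib)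
  finally have 1: "(flux_const * r) * ?J \<le> 3 * a + C * (9 * (\<nu> * b)) + C * (3 * d)" .
  have "((flux_const * r) * ?J)\<^sup>2 \<le> (norm (3 * a + C * (9 * (\<nu> * b)) + C * (3 * d)))\<^sup>2"
    using 1 fr by (intro power_mono) auto
  also have "\<dots> \<le> 4 * (norm (3 * a))\<^sup>2 + 4 * (norm (C * (9 * (\<nu> * b))))\<^sup>2 + 2 * (norm (C * (3 * d)))\<^sup>2"
    by (rule norm_add3_power2_le)
  also have "\<dots> = 36 * a\<^sup>2 + C\<^sup>2 * (324 * (\<nu>\<^sup>2 * b\<^sup>2) + 18 * d\<^sup>2)"
    by (simp only: real_norm_def power2_abs power_mult_distrib) (simp add: algebra_simps)
  \<comment> \<open>Both coefficients are enlarged to 576 = 36 * 16, so that all terms share the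
    prefactor 36.\<close>
  also have "\<dots> \<le> 36 * a\<^sup>2 + C\<^sup>2 * (576 * (\<nu>\<^sup>2 * b\<^sup>2) + 576 * d\<^sup>2)"
    by (intro add_mono mult_left_mono) auto
  also have "\<dots> \<le> 36 * (pi * r\<^sup>2 * l2_sq ball_B F) + C\<^sup>2 * (576 * (\<nu>\<^sup>2 * (pi * r\<^sup>2 * l2_sq ball_B (\<lambda>x. G x - A_pw x)))
      + 576 * (pi * r\<^sup>2 * l2_sq ball_B (\<lambda>x. p x - c_pw x)))"
    using int_norm_sq[OF L2B[OF F]] int_norm_sq[OF L2_GA] int_norm_sq[OF L2_pc]
    unfolding a_def b_def d_def by (intro add_mono mult_left_mono) auto
  also have "\<dots> = 36 * pi * (r\<^sup>2 * l2_sq ball_B F + (C * r)\<^sup>2 * 16 * (\<nu>\<^sup>2 * l2_sq ball_B (\<lambda>x. G x - A_pw x) + l2_sq ball_B (\<lambda>x. p x - c_pw x)))"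
    by (simp add: power_mult_distrib algebra_simps)
  also have "(C * r)\<^sup>2 * 16 = 64 * bump_bound\<^sup>2" using r by (simp add: C_def power_mult_distrib)
  also have "36 * pi * (r\<^sup>2 * l2_sq ball_B F + 64 * bump_bound\<^sup>2 * (\<nu>\<^sup>2 * l2_sq ball_B (\<lambda>x. G x - A_pw x) + l2_sq ball_B (\<lambda>x. p x - c_pw x)))
     \<le> 36 * pi * (r\<^sup>2 * l2_sq ball_B F + 64 * (1 + bump_bound)\<^sup>2 * (\<nu>\<^sup>2 * l2_sq ball_B (\<lambda>x. G x - A_pw x) + l2_sq ball_B (\<lambda>x. p x - c_pw x)))"
    using bump_bound_nonneg by (intro mult_left_mono add_mono mult_right_mono power_mono) auto
  finally show ?thesis by (simp add: power_mult_distrib mult_ac)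
qed

end

section \<open>The virtual element space\<close>

lemma has_derivative_vector_components:
  fixes \<phi> :: "real^2 \<Rightarrow> real^2"
  assumes "\<And>i. smooth (\<lambda>x. \<phi> x $ i)"
  shows "(\<phi> has_derivative (\<lambda>h. (\<chi> i j. pd j (\<lambda>y. \<phi> y $ i) x) *v h)) (at x)"
  unfolding has_derivative_componentwise_within[of \<phi>] Basis_real2
proof
  fix b :: "real^2" assume "b \<in> {axis 1 1, axis 2 1}"
  then obtain i where b: "b = axis i 1" by blast
  show "((\<lambda>x. \<phi> x \<bullet> b) has_derivative (\<lambda>h. ((\<chi> i j. pd j (\<lambda>y. \<phi> y $ i) x) *v h) \<bullet> b)) (at x)"
  proof -
    have "(\<lambda>x. \<phi> x \<bullet> b) = (\<lambda>x. \<phi> x $ i)" by (simp add: b inner_axis)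
    moreover have "((\<chi> i j. pd j (\<lambda>y. \<phi> y $ i) x) *v h) \<bullet> b = (\<chi> j. pd j (\<lambda>y. \<phi> y $ i) x) \<bullet> h" for h
      by (simp only: b inner_axis) (simp add: matrix_vector_mult_def inner_vec_def)
    ultimately show ?thesis using smooth_has_derivative[OF assms, of i x] by simp
  qed
qed

lemma jacobian_eq: "(\<phi> has_derivative (\<lambda>h. A *v h)) (at x) \<Longrightarrow> jacobian \<phi> (at x) = A" for A :: "real^2^2"
  using frechet_derivative_at[of \<phi> "\<lambda>h. A *v h" x] unfolding jacobian_def by (metis matrix_of_matrix_vector_mul)

lemma jacobian_affine: "jacobian (\<lambda>x. c + A *v x) (at x) = A" for A :: "real^2^2"
proof (rule jacobian_eq)
  show "((\<lambda>x. c + A *v x) has_derivative (\<lambda>h. A *v h)) (at x)"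
    by (rule has_derivative_eq_rhs[OF has_derivative_add[OF has_derivative_const bounded_linear_imp_has_derivative[OF matrix_vector_mul_bounded_linear]]]) simp
qed

text \<open>Derivatives of test functions integrate to 0, so a constant gradient is invisible to
  them. Subtracting an affine field thus preserves the distributional Stokes condition in
  \<open>U_hat\<close> with the same \<open>s\<close>.\<close>

lemma integral_const_jacobian:
  fixes \<phi> :: "real^2 \<Rightarrow> real^2"
  assumes "open U" "bounded U" "\<And>i. test_fun U (\<lambda>x. \<phi> x $ i)"
  shows "l2_inner U (\<lambda>x. A) (\<lambda>x. jacobian \<phi> (at x)) = 0" "L2 U (\<lambda>x. jacobian \<phi> (at x))"
proof -
  have s: "\<And>i. smooth (\<lambda>x. \<phi> x $ i)" using assms(3) by (simp add: test_fun_def)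
  have j: "(\<lambda>x. jacobian \<phi> (at x)) = (\<lambda>x. \<chi> i j. pd j (\<lambda>y. \<phi> y $ i) x)"
    using jacobian_eq[OF has_derivative_vector_components[OF s]] by blast
  have i: "integrable (lebesgue_on U) (pd j (\<lambda>y. \<phi> y $ i))" for i j
    using assms by (intro L2_integrable test_fun_L2[OF test_fun_pd[OF assms(3)]] bounded_set_imp_lmeasurable) auto
  have z: "(LINT x|lebesgue_on U. pd j (\<lambda>y. \<phi> y $ i) x) = 0" for i j
    using assms by (intro integral_pd_eq_0) auto
  show "l2_inner U (\<lambda>x. A) (\<lambda>x. jacobian \<phi> (at x)) = 0"
    unfolding j l2_inner_def using i z by (simp add: inner_vec_def sum_2)
  show "L2 U (\<lambda>x. jacobian \<phi> (at x))"
    unfolding j using has_grad_smooth[OF assms(1,2) s] by (simp add: has_grad_def)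
qed

locale star_polygon =
  fixes E :: polygon and x0 :: "real^2" and r :: real
  assumes simple: "simple_polygon E" and r_pos: "r > 0" and center: "x0 \<in> closed_cell E"
    and star: "star_shaped_wrt (closed_cell E) (ball x0 r)"
begin

lemma vertices_nonempty: "E \<noteq> []"
  using simple by (auto simp: simple_polygon_def)

text \<open>\<open>cell\<close> is defined topologically as the inside of the boundary, so this
  needs an argument: the star ball lies in the closed cell and cannot fit into the boundary, a null
  set.\<close>

lemma cell_nonempty: "cell E \<noteq> {}"
proof
  assume "cell E = {}"
  have "ball x0 r \<subseteq> closed_cell E"
    using star center ends_in_segment(1) unfolding star_shaped_wrt_def by blast
  then have "ball x0 r \<subseteq> bdry E" using \<open>cell E = {}\<close> by (simp add: closed_cell_def)
  then have "negligible (ball x0 r)" using negligible_bdry negligible_subset by blast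
  then show False using open_not_negligible[of "ball x0 r"] r_pos by simp
qed

lemmas cell_open_bounded = open_cell[of E] bounded_cell[of E]

lemma cell_measure: "measure lebesgue (cell E) \<noteq> 0"
  using open_not_negligible[OF open_cell cell_nonempty] negligible_iff_measure0[OF cell_lmeasurable] by blast

lemma U_hat_diff:
  assumes v: "U_hat E v" and p: "P1 p" shows "U_hat E (\<lambda>x. v x - p x)"
proof -
  obtain c A where cA: "p = (\<lambda>x. c + A *v x)" using p by (auto simp: P1_def)
  have H: "H1 (cell E) v" using v by (simp add: U_hat_def)
  note D = has_grad_diff[OF cell_open_bounded H1_has_grad[OF H] has_grad_affine[OF cell_open_bounded, of c A]]
  have aeg: "AE x in lebesgue_on (cell E). grad (cell E) (\<lambda>x. v x - p x) x = grad (cell E) v x - A"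
    unfolding cA by (rule grad_AE_eq[OF cell_open_bounded D])
  show ?thesis unfolding U_hat_def
  proof (intro conjI)
    show "H1 (cell E) (\<lambda>x. v x - p x)" unfolding cA by (rule has_grad_H1[OF D])
    obtain g where "has_trace E v g" "B1 E g" using v by (auto simp: U_hat_def)
    then show "\<exists>g. has_trace E (\<lambda>x. v x - p x) g \<and> B1 E g"
      using has_trace_diff_affine[OF _ p simple] B1_diff_affine[OF _ p simple] by blast
    obtain d where "ae_const (cell E) (divg (cell E) v) d" using v by (auto simp: U_hat_def)
    then have "AE x in lebesgue_on (cell E). divg (cell E) v x = d" by (simp add: ae_const_def)
    then have "AE x in lebesgue_on (cell E). divg (cell E) (\<lambda>x. v x - p x) x = d - trace A"
      using aeg by eventually_elim (simp add: divg_def trace_sub)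
    then show "\<exists>d. ae_const (cell E) (divg (cell E) (\<lambda>x. v x - p x)) d" unfolding ae_const_def by blast
    obtain s d where s: "L2 (cell E) s" "\<And>\<phi>. (\<And>i. test_fun (cell E) (\<lambda>x. \<phi> x $ i)) \<Longrightarrow>
          - l2_inner (cell E) (grad (cell E) v) (\<lambda>x. jacobian \<phi> (at x))
            + l2_inner (cell E) s (\<lambda>x. trace (jacobian \<phi> (at x)))
          = l2_inner (cell E) (\<lambda>x. d *\<^sub>R perp x) \<phi>"
      using v unfolding U_hat_def by blast
    have "l2_inner (cell E) (grad (cell E) (\<lambda>x. v x - p x)) (\<lambda>x. jacobian \<phi> (at x))
        = l2_inner (cell E) (grad (cell E) v) (\<lambda>x. jacobian \<phi> (at x))"
      if t: "\<And>i. test_fun (cell E) (\<lambda>x. \<phi> x $ i)" for \<phi>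
    proof -
      note j = integral_const_jacobian[OF cell_open_bounded t]
      have G: "L2 (cell E) (grad (cell E) v)" "L2 (cell E) (grad (cell E) (\<lambda>x. v x - p x))" "L2 (cell E) (\<lambda>x. grad (cell E) v x - A)"
        using H1_has_grad[OF H] H1_has_grad[OF has_grad_H1[OF D]] D unfolding cA has_grad_def by blast+
      have "l2_inner (cell E) (grad (cell E) (\<lambda>x. v x - p x)) (\<lambda>x. jacobian \<phi> (at x))
          = l2_inner (cell E) (\<lambda>x. grad (cell E) v x - A) (\<lambda>x. jacobian \<phi> (at x))"
        unfolding l2_inner_def
      proof (rule integral_cong_AE)
        show "(\<lambda>x. grad (cell E) (\<lambda>x. v x - p x) x \<bullet> jacobian \<phi> (at x)) \<in> borel_measurable (lebesgue_on (cell E))"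
          by (rule borel_measurable_integrable[OF L2_inner_integrable[OF G(2) j(2)]])
        show "(\<lambda>x. (grad (cell E) v x - A) \<bullet> jacobian \<phi> (at x)) \<in> borel_measurable (lebesgue_on (cell E))"
          by (rule borel_measurable_integrable[OF L2_inner_integrable[OF G(3) j(2)]])
      qed (use aeg in \<open>eventually_elim, simp\<close>)
      then show ?thesis
        using l2_inner_diff_left[OF G(1) L2_const[OF cell_lmeasurable] j(2), of A] j(1) by simp
    qed
    then show "\<exists>s. L2 (cell E) s \<and> (\<exists>c. \<forall>\<phi>. (\<forall>i. test_fun (cell E) (\<lambda>x. \<phi> x $ i)) \<longrightarrow>
          - l2_inner (cell E) (grad (cell E) (\<lambda>x. v x - p x)) (\<lambda>x. jacobian \<phi> (at x))
            + l2_inner (cell E) s (\<lambda>x. trace (jacobian \<phi> (at x)))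
          = l2_inner (cell E) (\<lambda>x. c *\<^sub>R perp x) \<phi>)"
      using s by (intro exI[of _ s] conjI exI[of _ d] allI impI) simp_all
  qed
qed

text \<open>\<open>btrace\<close> is a choice, so even this compatibility rests on uniqueness: both
  sides are values of continuous traces of the same field.\<close>

lemma btrace_diff:
  assumes v: "U_hat E v" and p: "P1 p" and x: "x \<in> set E"
  shows "btrace E (\<lambda>x. v x - p x) x = btrace E v x - p x"
proof -
  have *: "has_trace E w (btrace E w)" "continuous_on (bdry E) (btrace E w)" if "U_hat E w" for w
    using that btrace_properties unfolding U_hat_def B1_def by blast+
  have cp: "continuous_on (bdry E) p"
    using p by (auto simp: P1_def intro!: continuous_intros matrix_vector_mult_linear_continuous_on)
  note vp = U_hat_diff[OF v p]
  have "H1 (cell E) (\<lambda>x. v x - p x)" using vp by (simp add: U_hat_def)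
  then show ?thesis
    by (rule trace_unique[OF simple r_pos star _ *[OF vp] has_trace_diff_affine[OF *(1)[OF v] p simple]
          continuous_on_diff[OF *(2)[OF v] cp] x])
qed

definition slope :: "(real^2 \<Rightarrow> real^2) \<Rightarrow> real^2^2" where
  "slope v = mean_matrix (cell E) (grad (cell E) v)"

lemma proj_grad_affine: "H1 (cell E) v \<Longrightarrow> \<exists>c. proj_grad E v = (\<lambda>x. c + slope v *v x)"
  using proj_grad_eq[OF cell_open_bounded cell_nonempty H1_has_grad vertices_nonempty, of v] unfolding slope_def by blast

lemma proj_grad_diff:
  assumes v: "U_hat E v" and p: "P1 p"
  shows "proj_grad E (\<lambda>x. v x - p x) = (\<lambda>x. proj_grad E v x - p x)"
proof -
  obtain c A where cA: "p = (\<lambda>x. c + A *v x)" using p by (auto simp: P1_def)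
  have H: "H1 (cell E) v" using v by (simp add: U_hat_def)
  note G = H1_has_grad[OF H]
  note D = has_grad_diff[OF cell_open_bounded G has_grad_affine[OF cell_open_bounded, of c A]]
  note eq = proj_grad_eq[OF cell_open_bounded cell_nonempty _ vertices_nonempty]
  have m: "mean_matrix (cell E) (\<lambda>x. grad (cell E) v x - A) = mean_matrix (cell E) (grad (cell E) v) - A"
    using G by (intro mean_matrix_diff cell_lmeasurable cell_measure) (simp add: has_grad_def)
  have vm: "vertex_mean E (btrace E (\<lambda>x. v x - p x)) = vertex_mean E (btrace E v) - vertex_mean E p"
    by (rule vertex_mean_diff) (rule btrace_diff[OF v p])
  have vp: "vertex_mean E p = c + A *v vertex_mean E (\<lambda>x. x)"
    unfolding cA by (rule vertex_mean_affine[OF vertices_nonempty])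
  have "proj_grad E (\<lambda>x. v x - p x) = (\<lambda>x. vertex_mean E (btrace E (\<lambda>x. v x - p x))
      - mean_matrix (cell E) (\<lambda>x. grad (cell E) v x - A) *v vertex_mean E (\<lambda>x. x)
      + mean_matrix (cell E) (\<lambda>x. grad (cell E) v x - A) *v x)"
    using eq[OF D] unfolding cA .
  also have "\<dots> = (\<lambda>x. proj_grad E v x - p x)"
    unfolding vm vp m eq[OF G] by (simp add: cA matrix_vector_mult_diff_rdistrib fun_eq_iff algebra_simps)
  finally show ?thesis .
qed

lemma VE_diff: "VE E v \<Longrightarrow> P1 p \<Longrightarrow> VE E (\<lambda>x. v x - p x)"
  unfolding VE_def using U_hat_diff proj_grad_diff by simp

text \<open>The stabilizer is coercive only on members of the local space with vanishing projection;
  these two facts make the residual such a member.\<close>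

lemma VE_proj_grad_residual:
  assumes "VE E v"
  shows "VE E (\<lambda>x. v x - proj_grad E v x)" "proj_grad E (\<lambda>x. v x - proj_grad E v x) = (\<lambda>x. 0)"
proof -
  have H: "H1 (cell E) v" "U_hat E v" using assms by (simp_all add: VE_def U_hat_def)
  then have p: "P1 (proj_grad E v)" using proj_grad_affine P1_affine by metis
  show "VE E (\<lambda>x. v x - proj_grad E v x)" by (rule VE_diff[OF assms p])
  show "proj_grad E (\<lambda>x. v x - proj_grad E v x) = (\<lambda>x. 0)" using proj_grad_diff[OF H(2) p] by simp
qed

lemma VE_H1: "VE E v \<Longrightarrow> H1 (cell E) v"
  by (simp add: VE_def U_hat_def)

lemma VE_L2: "VE E v \<Longrightarrow> L2 (cell E) v"
  using H1_has_grad[OF VE_H1] by (simp add: has_grad_def)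

lemma VE_proj_L2_residual:
  assumes "VE E v"
  shows "VE E (\<lambda>x. v x - proj_L2 E v x)" "proj_L2 E (\<lambda>x. v x - proj_L2 E v x) = (\<lambda>x. 0)" "P1 (proj_L2 E v)"
  using VE_diff[OF assms] proj_L2_properties[OF cell_open_bounded cell_nonempty VE_L2[OF assms]] by blast+

lemma l2_sq_slope_residual:
  assumes "VE E v"
  shows "l2_sq (cell E) (\<lambda>x. grad (cell E) v x - slope v) = l2_sq (cell E) (grad (cell E) (\<lambda>x. v x - proj_grad E v x))"
proof -
  note G = H1_has_grad[OF VE_H1[OF assms]]
  obtain c where c: "proj_grad E v = (\<lambda>x. c + slope v *v x)" using proj_grad_affine[OF VE_H1[OF assms]] by blast
  note D = has_grad_diff[OF cell_open_bounded G has_grad_affine[OF cell_open_bounded, of c "slope v"]]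
  have D': "has_grad (cell E) (\<lambda>x. v x - proj_grad E v x) (\<lambda>x. grad (cell E) v x - slope v)" using D unfolding c .
  show ?thesis
    using D' H1_has_grad[OF has_grad_H1[OF D']] grad_AE_eq[OF cell_open_bounded D']
    by (intro l2_sq_cong_AE) (auto simp: has_grad_def elim: eventually_mono)
qed

lemma jacobian_proj_grad: "H1 (cell E) v \<Longrightarrow> jacobian (proj_grad E v) (at x) = slope v"
  using proj_grad_affine jacobian_affine by metis

lemma cell_value_eq: "ae_const (cell E) q c \<Longrightarrow> cell_value E q = c"
  unfolding cell_value_def
proof (rule the_equality)
  fix d assume "ae_const (cell E) q c" "ae_const (cell E) q d"
  then have "AE x in lebesgue_on (cell E). (c - d) = 0" unfolding ae_const_def by eventually_elim simp
  then have "c - d = 0" using AE_zero_imp_zero[OF open_cell, of E "\<lambda>x. c - d"] cell_nonempty by auto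
  then show "d = c" by simp
qed

end

section \<open>Efficiency of the estimator\<close>

text \<open>\<open>P\<close> decides which of two elements contains a point of the disc, up to a
  null set; a piecewise error on the disc is passed on to the whole elements.\<close>

lemma l2_sq_piecewise_le:
  fixes h1 h2 :: "real^2 \<Rightarrow> 'a::euclidean_space"
  assumes S: "B \<in> sets lebesgue" "C1 \<in> sets lebesgue" "C2 \<in> sets lebesgue"
    and ae: "AE x in lebesgue. x \<in> B \<longrightarrow> (if P x then x \<in> C1 else x \<in> C2)"
    and L: "L2 C1 h1" "L2 C2 h2" "L2 B (\<lambda>x. if P x then h1 x else h2 x)"
  shows "l2_sq B (\<lambda>x. if P x then h1 x else h2 x) \<le> l2_sq C1 h1 + l2_sq C2 h2"
proof -
  have i: "integrable lebesgue (\<lambda>x. indicator S x *\<^sub>R (norm (h x))\<^sup>2)" if "L2 S h" "S \<in> sets lebesgue" for S and h :: "real^2 \<Rightarrow> 'a"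
    using L2D(2)[OF that(1)] that(2) by (simp add: integrable_restrict_space)
  have l: "l2_sq S h = (LINT x|lebesgue. indicator S x *\<^sub>R (norm (h x))\<^sup>2)" if "S \<in> sets lebesgue" for S and h :: "real^2 \<Rightarrow> 'a"
    unfolding l2_sq_def using that by (simp add: integral_restrict_space)
  have "l2_sq B (\<lambda>x. if P x then h1 x else h2 x)
      \<le> (LINT x|lebesgue. indicator C1 x *\<^sub>R (norm (h1 x))\<^sup>2 + indicator C2 x *\<^sub>R (norm (h2 x))\<^sup>2)"
    unfolding l[OF S(1)]
  proof (rule integral_mono_AE)
    show "AE x in lebesgue. indicator B x *\<^sub>R (norm (if P x then h1 x else h2 x))\<^sup>2
      \<le> indicator C1 x *\<^sub>R (norm (h1 x))\<^sup>2 + indicator C2 x *\<^sub>R (norm (h2 x))\<^sup>2"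
      using ae by eventually_elim (auto simp: indicator_def split: if_splits)
  qed (use i[OF L(1) S(2)] i[OF L(2) S(3)] i[OF L(3) S(1)] in auto)
  also have "\<dots> = l2_sq C1 h1 + l2_sq C2 h2"
    using i[OF L(1) S(2)] i[OF L(2) S(3)] l[OF S(2)] l[OF S(3)] by simp
  finally show ?thesis .
qed

lemma inv_sqrt_twice: "spd A \<Longrightarrow> inv_sqrt A *v (inv_sqrt A *v x) = matrix_inv A *v x"
  by (simp add: matrix_vector_mul_assoc inv_sqrt_properties)

text \<open>Multiplication by the inverse permeability is applied as its square root twice. One
  factor is absorbed by the essential bound, the other one remains as the weight in the energy norm
  and in the mass stabilization.\<close>

lemma permeability_L2:
  assumes \<kappa>: "permeability \<Omega> \<kappa>" and B: "AE x in lebesgue_on \<Omega>. norm (inv_sqrt (\<kappa> x)) \<le> B" "B \<ge> 0"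
    and S: "V \<subseteq> \<Omega>" "V \<in> sets lebesgue" "\<Omega> \<in> sets lebesgue" and w: "L2 V w"
  shows "L2 V (\<lambda>x. inv_sqrt (\<kappa> x) *v w x)" "l2_sq V (\<lambda>x. inv_sqrt (\<kappa> x) *v w x) \<le> B\<^sup>2 * l2_sq V w"
    "L2 V (\<lambda>x. matrix_inv (\<kappa> x) *v w x)"
proof -
  have m: "(\<lambda>x. inv_sqrt (\<kappa> x)) \<in> borel_measurable (lebesgue_on V)"
    by (rule measurable_lebesgue_on_subset[OF permeability_inv_sqrt(1)[OF \<kappa>] S(1)])
  have *: "L2 V (\<lambda>x. inv_sqrt (\<kappa> x) *v w x) \<and> l2_sq V (\<lambda>x. inv_sqrt (\<kappa> x) *v w x) \<le> B\<^sup>2 * l2_sq V w" if w: "L2 V w" for w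
  proof
    have ae: "AE x in lebesgue_on V. norm (inv_sqrt (\<kappa> x) *v w x) \<le> norm (B *\<^sub>R w x)"
      using AE_lebesgue_on_subset[OF B(1) S]
    proof eventually_elim
      case (elim x)
      have "norm (inv_sqrt (\<kappa> x) *v w x) \<le> norm (inv_sqrt (\<kappa> x)) * norm (w x)" by (rule norm_matrix_vector_le)
      also have "\<dots> \<le> B * norm (w x)" using elim by (rule mult_right_mono) simp
      finally show ?case using B(2) by simp
    qed
    have L: "L2 V (\<lambda>x. B *\<^sub>R w x)" by (rule L2_scaleR[OF w])
    show 1: "L2 V (\<lambda>x. inv_sqrt (\<kappa> x) *v w x)"
    proof (rule L2_bound_AE[OF borel_measurable_matrix_vector_mult[OF m L2D(1)[OF w]] L2D(2)[OF L]])
      show "AE x in lebesgue_on V. (norm (inv_sqrt (\<kappa> x) *v w x))\<^sup>2 \<le> (norm (B *\<^sub>R w x))\<^sup>2"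
        using ae by eventually_elim (intro power_mono norm_ge_zero)
    qed
    show "l2_sq V (\<lambda>x. inv_sqrt (\<kappa> x) *v w x) \<le> B\<^sup>2 * l2_sq V w"
      using l2_sq_mono[OF 1 L ae] by (simp add: l2_sq_scaleR)
  qed
  show "L2 V (\<lambda>x. inv_sqrt (\<kappa> x) *v w x)" "l2_sq V (\<lambda>x. inv_sqrt (\<kappa> x) *v w x) \<le> B\<^sup>2 * l2_sq V w"
    using *[OF w] by blast+
  have L: "L2 V (\<lambda>x. inv_sqrt (\<kappa> x) *v (inv_sqrt (\<kappa> x) *v w x))" using * w by blast
  show "L2 V (\<lambda>x. matrix_inv (\<kappa> x) *v w x)"
  proof (rule L2_cong_AE(1)[OF L])
    have "spd (\<kappa> x)" if "x \<in> V" for x using \<kappa> S(1) that by (auto simp: permeability_def)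
    then show "AE x in lebesgue_on V. inv_sqrt (\<kappa> x) *v (inv_sqrt (\<kappa> x) *v w x) = matrix_inv (\<kappa> x) *v w x"
      by (intro AE_I2) (simp add: inv_sqrt_twice space_restrict_space)
    show "(\<lambda>x. matrix_inv (\<kappa> x) *v w x) \<in> borel_measurable (lebesgue_on V)"
      by (intro borel_measurable_matrix_vector_mult L2D(1)[OF w] measurable_lebesgue_on_subset[OF permeability_inv_sqrt(2)[OF \<kappa>] S(1)])
  qed
qed

lemma edge_sq_const: "edge_sq e (\<lambda>x. k) = edge_len e * (norm k)\<^sup>2"
  unfolding edge_sq_def edge_integral_def by (simp add: measure_restrict_space space_restrict_space)

locale efficiency =
  fixes \<Omega> :: "(real^2) set" and \<kappa> :: "real^2 \<Rightarrow> real^2^2" and M :: "polygon set"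
    and Tri :: "polygon \<Rightarrow> (real^2) set set" and S1 S0 :: stab_form
    and \<rho> C1g C2g C1m C2m Bk \<nu> :: real and f u uh :: "real^2 \<Rightarrow> real^2" and p ph :: "real^2 \<Rightarrow> real"
  assumes dom: "convex_polygonal_domain \<Omega>" and \<kappa>: "permeability \<Omega> \<kappa>"
    and mesh: "polygonal_mesh \<Omega> M Tri" and \<rho>: "\<rho> > 0" and reg: "mesh_regular \<rho> M"
    and C1g: "C1g > 0" and S1: "grad_stabilizer C1g C2g M S1"
    and C1m: "C1m > 0" and S0: "mass_stabilizer \<kappa> C1m C2m M S0"
    and Bk: "Bk \<ge> 0" "AE x in lebesgue_on \<Omega>. norm (inv_sqrt (\<kappa> x)) \<le> Bk"
    and \<nu>: "\<nu> > 0" and f: "L2 \<Omega> f" and sol: "continuous_solution \<Omega> \<kappa> \<nu> f u p"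
    and uh: "Vh \<Omega> M uh" and ph: "Qh \<Omega> M ph"
begin

definition err :: "polygon \<Rightarrow> real" where
  "err E = \<nu>\<^sup>2 * energy_sq \<kappa> (cell E) (\<lambda>x. u x - uh x) + l2_sq (cell E) (\<lambda>x. p x - ph x)
     + eta_S_sq S1 S0 \<nu> uh E + eta_f_sq f E + eta_kappa_sq \<kappa> \<nu> uh E"

text \<open>Convexity gives \<open>interior (closure \<Omega>) = \<Omega>\<close>: an open set known
  to lie in the closure lies in \<Omega>. Cells and discs are placed inside the domain this
  way.\<close>

lemma domain: "open \<Omega>" "bounded \<Omega>" "\<Omega> \<in> sets lebesgue" "\<Omega> \<in> lmeasurable" "interior (closure \<Omega>) = \<Omega>" "bounded (closure \<Omega>)"
proof -
  show o: "open \<Omega>" using dom by (simp add: convex_polygonal_domain_def)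
  show "bounded (closure \<Omega>)" using dom by (simp add: convex_polygonal_domain_def polytope_imp_bounded)
  then show b: "bounded \<Omega>" using closure_subset bounded_subset by blast
  show "\<Omega> \<in> sets lebesgue" using o by simp
  then show "\<Omega> \<in> lmeasurable" using b by (rule bounded_set_imp_lmeasurable[rotated])
  show "interior (closure \<Omega>) = \<Omega>"
    using dom o by (simp add: convex_polygonal_domain_def convex_interior_closure interior_open)
qed

lemma element:
  assumes "E \<in> M"
  shows "simple_polygon E" "closed_cell E \<subseteq> closure \<Omega>" "cell E \<subseteq> \<Omega>" "cell E \<in> sets lebesgue"
    "elem_diam E > 0" "\<And>e. e \<in> edges E \<Longrightarrow> \<rho> * elem_diam E < edge_len e" "\<And>e. e \<in> edges E \<Longrightarrow> edge_len e \<le> elem_diam E"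
    "edges E \<noteq> {}" "elem_diam E \<le> diameter (closure \<Omega>)" "\<exists>x0. star_polygon E x0 (\<rho> * elem_diam E)"
proof -
  show s: "simple_polygon E" and c: "closed_cell E \<subseteq> closure \<Omega>"
    using mesh assms by (auto simp: polygonal_mesh_def)
  have "cell E \<subseteq> interior (closure \<Omega>)"
    by (rule interior_maximal[OF _ open_cell]) (use c in \<open>auto simp: closed_cell_def\<close>)
  then show "cell E \<subseteq> \<Omega>" by (simp add: domain)
  show "cell E \<in> sets lebesgue" using open_cell by simp
  have "length E > 0" using s unfolding simple_polygon_def by linarith
  then show ne: "edges E \<noteq> {}" by (auto simp: edges_def)
  have len: "edge_len e \<le> elem_diam E" "edge_len e > 0" if e: "e \<in> edges E" for e
  proof -
    obtain a b where ab: "e = {a, b}" "a \<noteq> b" using edgeE[OF e] s by metis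
    have "a \<in> closed_cell E" "b \<in> closed_cell E" using edge_in_closed_cell[OF e] hull_inc[of _ e convex] ab by auto
    then show "edge_len e \<le> elem_diam E" using elem_diam_bounds by (simp add: ab(1) edge_len_eq dist_norm)
    show "edge_len e > 0" using ab by (simp add: edge_len_eq)
  qed
  show "\<And>e. e \<in> edges E \<Longrightarrow> edge_len e \<le> elem_diam E" by (rule len)
  show d: "elem_diam E > 0" using ne len by (meson ex_in_conv less_le_trans)
  show "\<rho> * elem_diam E < edge_len e" if "e \<in> edges E" for e
  proof -
    have "\<rho> < Min (edge_len ` edges E) / elem_diam E" using reg assms by (simp add: mesh_regular_def)
    then have "\<rho> * elem_diam E < Min (edge_len ` edges E)" using d by (simp add: pos_less_divide_eq)
    also have "\<dots> \<le> edge_len e" using finite_edges that by (intro Min_le) auto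
    finally show ?thesis .
  qed
  show "elem_diam E \<le> diameter (closure \<Omega>)"
    unfolding elem_diam_def by (rule diameter_subset[OF c domain(6)])
  obtain x0 where "x0 \<in> closed_cell E" "star_shaped_wrt (closed_cell E) (ball x0 (\<rho> * elem_diam E))"
    using reg assms unfolding mesh_regular_def by blast
  then have "star_polygon E x0 (\<rho> * elem_diam E)" using s d \<rho> by unfold_locales auto
  then show "\<exists>x0. star_polygon E x0 (\<rho> * elem_diam E)" by blast
qed

lemma u_facts: "H1 \<Omega> u" "H10 \<Omega> u" "has_grad \<Omega> u (grad \<Omega> u)" "L2 \<Omega> u" "L2 \<Omega> (grad \<Omega> u)" "L2 \<Omega> p" "L2 \<Omega> ph"
proof -
  show "H10 \<Omega> u" using sol by (simp add: continuous_solution_def)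
  then show H: "H1 \<Omega> u" by (simp add: H10_def)
  show "has_grad \<Omega> u (grad \<Omega> u)" "L2 \<Omega> u" "L2 \<Omega> (grad \<Omega> u)" using H1_has_grad[OF H] by (auto simp: has_grad_def)
  show "L2 \<Omega> p" "L2 \<Omega> ph" using sol ph by (auto simp: continuous_solution_def L20_def Qh_def)
qed

text \<open>The divergence has mean zero because \<open>u\<close> vanishes on the boundary, so it
  may be inserted as the test pressure, and the constraint becomes the vanishing of its squared
  norm.\<close>

lemma divergence_free: "AE x in lebesgue_on \<Omega>. trace (grad \<Omega> u x) = 0"
proof -
  have "L20 \<Omega> (divg \<Omega> u)"
    unfolding L20_def using L2_divg[OF u_facts(1)] H10_integral_divg[OF domain(1,2) u_facts(2)] by blast
  then have "b_form \<Omega> u (divg \<Omega> u) = 0" using sol by (simp add: continuous_solution_def)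
  then have "l2_sq \<Omega> (divg \<Omega> u) = 0" by (simp add: b_form_def l2_sq_def power2_eq_square)
  then have "AE x in lebesgue_on \<Omega>. divg \<Omega> u x = 0" by (rule l2_sq_eq_0_AE[OF L2_divg[OF u_facts(1)]])
  then show ?thesis by (simp add: divg_def)
qed

text \<open>The reaction term is moved to the right-hand side, so that the momentum equation takes
  the form of a Stokes equation with this source.\<close>

definition force :: "real^2 \<Rightarrow> real^2" where
  "force x = f x - \<nu> *\<^sub>R (matrix_inv (\<kappa> x) *v u x)"

lemma L2_kappa_u: "L2 \<Omega> (\<lambda>x. matrix_inv (\<kappa> x) *v u x)"
  by (rule permeability_L2(3)[OF \<kappa> Bk(2,1) subset_refl domain(3,3) u_facts(4)])

lemma L2_force: "L2 \<Omega> force"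
  unfolding force_def by (intro L2_diff L2_scaleR f L2_kappa_u)

lemma momentum_equation:
  assumes \<phi>: "test_fun \<Omega> \<phi>"
  shows "(LINT x|lebesgue_on \<Omega>. \<nu> * (grad \<Omega> u x \<bullet> (\<chi> i j. w $ i * pd j \<phi> x)) + p x * (w \<bullet> (\<chi> j. pd j \<phi> x)))
      = (LINT x|lebesgue_on \<Omega>. \<phi> x * (force x \<bullet> w))"
proof -
  let ?v = "\<lambda>x. \<phi> x *\<^sub>R w"
  let ?O = "\<lambda>x. (\<chi> i j. w $ i * pd j \<phi> x) :: real^2^2"
  have s: "smooth \<phi>" using \<phi> by (simp add: test_fun_def)
  have vi: "test_fun \<Omega> (\<lambda>x. ?v x $ i)" for i using test_fun_mult[OF \<phi> smooth_const, of "w $ i"] by simp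
  have pd: "pd j (\<lambda>x. ?v x $ i) x = w $ i * pd j \<phi> x" for i j x
    using pd_mult[OF smooth_differentiable[OF s] smooth_differentiable[OF smooth_const], of j "w $ i" x]
    by (simp add: pd_const mult.commute)
  have g: "has_grad \<Omega> ?v ?O"
    using has_grad_smooth[OF domain(1,2), of ?v] vi unfolding pd by (auto simp: test_fun_def)
  have Lv: "L2 \<Omega> ?v" "L2 \<Omega> ?O" using g by (auto simp: has_grad_def)
  have tr: "trace (?O x) = w \<bullet> (\<chi> j. pd j \<phi> x)" for x by (simp add: trace_def inner_vec_def)
  have Lt: "L2 \<Omega> (\<lambda>x. w \<bullet> (\<chi> j. pd j \<phi> x))"
    unfolding tr[symmetric] trace_def sum_2 by (intro L2_add L2_grad_component Lv)
  note i = L2_inner_integrable[OF u_facts(5) Lv(2)] L2_inner_integrable[OF L2_kappa_u Lv(1)] L2_mult_integrable[OF u_facts(6) Lt]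
    L2_inner_integrable[OF f Lv(1)]
  have Lg: "L2 \<Omega> (grad \<Omega> ?v)" "L2 \<Omega> (divg \<Omega> ?v)"
    using H1_has_grad[OF has_grad_H1[OF g]] L2_divg[OF has_grad_H1[OF g]] by (auto simp: has_grad_def)
  have a: "a_form \<Omega> \<kappa> u ?v = (LINT x|lebesgue_on \<Omega>. grad \<Omega> u x \<bullet> ?O x) + (LINT x|lebesgue_on \<Omega>. (matrix_inv (\<kappa> x) *v u x) \<bullet> ?v x)"
  proof -
    have "a_form \<Omega> \<kappa> u ?v = (LINT x|lebesgue_on \<Omega>. grad \<Omega> u x \<bullet> ?O x + (matrix_inv (\<kappa> x) *v u x) \<bullet> ?v x)"
      unfolding a_form_def
    proof (rule integral_cong_AE)
      show "AE x in lebesgue_on \<Omega>. grad \<Omega> u x \<bullet> grad \<Omega> ?v x + (matrix_inv (\<kappa> x) *v u x) \<bullet> ?v x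
          = grad \<Omega> u x \<bullet> ?O x + (matrix_inv (\<kappa> x) *v u x) \<bullet> ?v x"
        using grad_AE_eq[OF domain(1,2) g] by eventually_elim simp
    qed (use i L2_inner_integrable[OF u_facts(5) Lg(1)] in \<open>auto intro!: borel_measurable_add dest: borel_measurable_integrable\<close>)
    then show ?thesis using i by simp
  qed
  have b: "b_form \<Omega> ?v p = (LINT x|lebesgue_on \<Omega>. p x * (w \<bullet> (\<chi> j. pd j \<phi> x)))"
    unfolding b_form_def
  proof (rule integral_cong_AE)
    show "AE x in lebesgue_on \<Omega>. p x * divg \<Omega> ?v x = p x * (w \<bullet> (\<chi> j. pd j \<phi> x))"
      using divg_AE_eq[OF domain(1,2) g] by eventually_elim (simp only: tr)
  qed (use i L2_mult_integrable[OF u_facts(6) Lg(2)] in \<open>auto dest: borel_measurable_integrable\<close>)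
  have "H10 \<Omega> ?v" by (rule H10_test_fun[OF domain(1,2) vi])
  then have e: "\<nu> * a_form \<Omega> \<kappa> u ?v + b_form \<Omega> ?v p = l2_inner \<Omega> f ?v" using sol by (simp add: continuous_solution_def)
  have "(LINT x|lebesgue_on \<Omega>. \<nu> * (grad \<Omega> u x \<bullet> ?O x) + p x * (w \<bullet> (\<chi> j. pd j \<phi> x)))
      = \<nu> * (LINT x|lebesgue_on \<Omega>. grad \<Omega> u x \<bullet> ?O x) + (LINT x|lebesgue_on \<Omega>. p x * (w \<bullet> (\<chi> j. pd j \<phi> x)))"
    using i by simp
  also have "\<dots> = (LINT x|lebesgue_on \<Omega>. f x \<bullet> ?v x) - \<nu> * (LINT x|lebesgue_on \<Omega>. (matrix_inv (\<kappa> x) *v u x) \<bullet> ?v x)"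
    using e unfolding a b l2_inner_def by (simp add: algebra_simps)
  also have "\<dots> = (LINT x|lebesgue_on \<Omega>. f x \<bullet> ?v x - \<nu> * ((matrix_inv (\<kappa> x) *v u x) \<bullet> ?v x))"
    using i(2,4) by simp
  also have "\<dots> = (LINT x|lebesgue_on \<Omega>. \<phi> x * (force x \<bullet> w))"
    by (intro Bochner_Integration.integral_cong refl) (simp add: force_def inner_diff_left algebra_simps)
  finally show ?thesis .
qed

text \<open>The 6 is 2 for \<open>f\<close> plus 4 for the projected part of the reaction term. The
  rest bounds the parts of \<open>u - uh\<close> and \<open>uh - proj_L2 E uh\<close>, each with
  coefficient \<open>8 Bk^2\<close> and the squared diameter in place of \<open>r^2\<close>; the
  second costs \<open>1 / C1m\<close> through the stabilizer.\<close>

definition force_const :: real where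
  "force_const = 6 + 8 * Bk\<^sup>2 * (diameter (closure \<Omega>))\<^sup>2 * (1 + 1 / C1m)"

lemma force_const_nonneg: "force_const \<ge> 0"
  unfolding force_const_def using C1m by (intro add_nonneg_nonneg mult_nonneg_nonneg) auto

section \<open>Local errors on a single element\<close>

context
  fixes E assumes E: "E \<in> M"
begin

lemma star: "\<exists>x0. star_polygon E x0 (\<rho> * elem_diam E)" by (rule element(10)[OF E])

lemma VE_uh: "VE E uh" using uh E by (simp add: Vh_def)

lemma L2_cell: "L2 \<Omega> g \<Longrightarrow> L2 (cell E) g"
  by (rule L2_subset[OF _ element(3,4)[OF E] domain(3)])

lemma S1_bound:
  "C1g * l2_sq (cell E) (\<lambda>x. grad (cell E) uh x - mean_matrix (cell E) (grad (cell E) uh))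
    \<le> S1 E (\<lambda>x. uh x - proj_grad E uh x) (\<lambda>x. uh x - proj_grad E uh x)"
proof -
  obtain x0 where "star_polygon E x0 (\<rho> * elem_diam E)" using star by blast
  then interpret star_polygon E x0 "\<rho> * elem_diam E" .
  show ?thesis
    using S1 E VE_proj_grad_residual[OF VE_uh] l2_sq_slope_residual[OF VE_uh]
    by (simp add: grad_stabilizer_def slope_def)
qed

lemma S0_bound:
  "C1m * l2_sq (cell E) (\<lambda>x. inv_sqrt (\<kappa> x) *v (uh x - proj_L2 E uh x))
    \<le> S0 E (\<lambda>x. uh x - proj_L2 E uh x) (\<lambda>x. uh x - proj_L2 E uh x)"
proof -
  obtain x0 where "star_polygon E x0 (\<rho> * elem_diam E)" using star by blast
  then interpret star_polygon E x0 "\<rho> * elem_diam E" .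
  show ?thesis using S0 E VE_proj_L2_residual[OF VE_uh] by (simp add: mass_stabilizer_def)
qed

lemma S_nonneg:
  "0 \<le> S1 E (\<lambda>x. uh x - proj_grad E uh x) (\<lambda>x. uh x - proj_grad E uh x)"
  "0 \<le> S0 E (\<lambda>x. uh x - proj_L2 E uh x) (\<lambda>x. uh x - proj_L2 E uh x)"
  using S1_bound S0_bound C1g C1m by (meson l2_sq_nonneg less_imp_le mult_nonneg_nonneg order_trans)+

lemma err_parts:
  "\<nu>\<^sup>2 * l2_sq (cell E) (grad (cell E) (\<lambda>x. u x - uh x)) \<le> err E"
  "\<nu>\<^sup>2 * l2_sq (cell E) (\<lambda>x. inv_sqrt (\<kappa> x) *v (u x - uh x)) \<le> err E"
  "l2_sq (cell E) (\<lambda>x. p x - ph x) \<le> err E"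
  "\<nu>\<^sup>2 * S1 E (\<lambda>x. uh x - proj_grad E uh x) (\<lambda>x. uh x - proj_grad E uh x) \<le> err E"
  "\<nu>\<^sup>2 * S0 E (\<lambda>x. uh x - proj_L2 E uh x) (\<lambda>x. uh x - proj_L2 E uh x) \<le> err E"
  "eta_f_sq f E \<le> err E" "eta_kappa_sq \<kappa> \<nu> uh E \<le> err E" "0 \<le> err E"
proof -
  have "0 \<le> \<nu>\<^sup>2 * l2_sq (cell E) (grad (cell E) (\<lambda>x. u x - uh x))"
    "0 \<le> \<nu>\<^sup>2 * l2_sq (cell E) (\<lambda>x. inv_sqrt (\<kappa> x) *v (u x - uh x))"
    "0 \<le> l2_sq (cell E) (\<lambda>x. p x - ph x)"
    "0 \<le> \<nu>\<^sup>2 * S1 E (\<lambda>x. uh x - proj_grad E uh x) (\<lambda>x. uh x - proj_grad E uh x)"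
    "0 \<le> \<nu>\<^sup>2 * S0 E (\<lambda>x. uh x - proj_L2 E uh x) (\<lambda>x. uh x - proj_L2 E uh x)"
    "0 \<le> eta_f_sq f E" "0 \<le> eta_kappa_sq \<kappa> \<nu> uh E"
    using S_nonneg by (simp_all add: eta_f_sq_def eta_kappa_sq_def)
  moreover have "err E = \<nu>\<^sup>2 * l2_sq (cell E) (grad (cell E) (\<lambda>x. u x - uh x))
    + \<nu>\<^sup>2 * l2_sq (cell E) (\<lambda>x. inv_sqrt (\<kappa> x) *v (u x - uh x)) + l2_sq (cell E) (\<lambda>x. p x - ph x)
    + \<nu>\<^sup>2 * S1 E (\<lambda>x. uh x - proj_grad E uh x) (\<lambda>x. uh x - proj_grad E uh x)
    + \<nu>\<^sup>2 * S0 E (\<lambda>x. uh x - proj_L2 E uh x) (\<lambda>x. uh x - proj_L2 E uh x) + eta_f_sq f E + eta_kappa_sq \<kappa> \<nu> uh E"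
    by (simp add: err_def energy_sq_def eta_S_sq_def distrib_left)
  ultimately show "\<nu>\<^sup>2 * l2_sq (cell E) (grad (cell E) (\<lambda>x. u x - uh x)) \<le> err E"
    "\<nu>\<^sup>2 * l2_sq (cell E) (\<lambda>x. inv_sqrt (\<kappa> x) *v (u x - uh x)) \<le> err E"
    "l2_sq (cell E) (\<lambda>x. p x - ph x) \<le> err E"
    "\<nu>\<^sup>2 * S1 E (\<lambda>x. uh x - proj_grad E uh x) (\<lambda>x. uh x - proj_grad E uh x) \<le> err E"
    "\<nu>\<^sup>2 * S0 E (\<lambda>x. uh x - proj_L2 E uh x) (\<lambda>x. uh x - proj_L2 E uh x) \<le> err E"
    "eta_f_sq f E \<le> err E" "eta_kappa_sq \<kappa> \<nu> uh E \<le> err E" "0 \<le> err E"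
    by linarith+
qed

text \<open>The intermediate term is the gradient of \<open>uh\<close> on the cell: the first
  difference belongs to the energy error, the second is controlled by the gradient stabilizer at the
  price of \<open>1 / C1g\<close>.\<close>

lemma gradient_error:
  "\<nu>\<^sup>2 * l2_sq (cell E) (\<lambda>x. grad \<Omega> u x - mean_matrix (cell E) (grad (cell E) uh)) \<le> (2 + 2 / C1g) * err E"
proof -
  let ?A = "mean_matrix (cell E) (grad (cell E) uh)" and ?U = "cell E"
  note U = open_cell[of E] bounded_cell[of E]
  have H: "H1 ?U uh" using VE_uh by (simp add: VE_def U_hat_def)
  note G = has_grad_subset[OF u_facts(3) U(1) element(3)[OF E] domain(1)] and Gh = H1_has_grad[OF H]
  note D = has_grad_diff[OF U G Gh]
  have L: "L2 ?U (grad \<Omega> u)" "L2 ?U (grad ?U uh)" "L2 ?U (grad ?U (\<lambda>x. u x - uh x))" "L2 ?U (\<lambda>x. ?A)"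
    using G Gh H1_has_grad[OF has_grad_H1[OF D]] L2_const[OF cell_lmeasurable] by (auto simp: has_grad_def)
  have "l2_sq ?U (\<lambda>x. grad \<Omega> u x - ?A) = l2_sq ?U (\<lambda>x. grad ?U (\<lambda>x. u x - uh x) x + (grad ?U uh x - ?A))"
  proof (rule l2_sq_cong_AE)
    show "AE x in lebesgue_on ?U. grad \<Omega> u x - ?A = grad ?U (\<lambda>x. u x - uh x) x + (grad ?U uh x - ?A)"
      using grad_AE_eq[OF U D] by eventually_elim simp
  qed (intro L2_diff L2_add L)+
  also have "\<dots> \<le> 2 * l2_sq ?U (grad ?U (\<lambda>x. u x - uh x)) + 2 * l2_sq ?U (\<lambda>x. grad ?U uh x - ?A)"
    by (intro l2_sq_add_le L2_diff L)
  finally have "\<nu>\<^sup>2 * l2_sq ?U (\<lambda>x. grad \<Omega> u x - ?A)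
      \<le> \<nu>\<^sup>2 * (2 * l2_sq ?U (grad ?U (\<lambda>x. u x - uh x)) + 2 * l2_sq ?U (\<lambda>x. grad ?U uh x - ?A))"
    by (rule mult_left_mono) simp
  also have "\<dots> = 2 * (\<nu>\<^sup>2 * l2_sq ?U (grad ?U (\<lambda>x. u x - uh x))) + 2 * (\<nu>\<^sup>2 * l2_sq ?U (\<lambda>x. grad ?U uh x - ?A))"
    by (simp add: algebra_simps)
  also have "\<dots> \<le> 2 * err E + 2 * (err E / C1g)"
  proof (intro add_mono mult_left_mono err_parts(1))
    have "\<nu>\<^sup>2 * (C1g * l2_sq ?U (\<lambda>x. grad ?U uh x - ?A)) \<le> \<nu>\<^sup>2 * S1 E (\<lambda>x. uh x - proj_grad E uh x) (\<lambda>x. uh x - proj_grad E uh x)"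
      by (intro mult_left_mono S1_bound) simp
    also have "\<dots> \<le> err E" by (rule err_parts)
    finally show "\<nu>\<^sup>2 * l2_sq ?U (\<lambda>x. grad ?U uh x - ?A) \<le> err E / C1g" using C1g by (simp add: pos_le_divide_eq mult_ac)
  qed auto
  finally show ?thesis by (simp add: algebra_simps)
qed

lemma pressure_error: "l2_sq (cell E) (\<lambda>x. p x - cell_value E ph) \<le> err E"
proof -
  obtain x0 where "star_polygon E x0 (\<rho> * elem_diam E)" using star by blast
  then interpret star_polygon E x0 "\<rho> * elem_diam E" .
  obtain c where c: "ae_const (cell E) ph c" using ph E by (auto simp: Qh_def)
  then have cv: "cell_value E ph = c" by (rule cell_value_eq)
  have "AE x in lebesgue_on (cell E). ph x = c" using c by (simp add: ae_const_def)
  then have "AE x in lebesgue_on (cell E). p x - c = p x - ph x" by eventually_elim simp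
  then have "l2_sq (cell E) (\<lambda>x. p x - c) = l2_sq (cell E) (\<lambda>x. p x - ph x)"
    by (intro l2_sq_cong_AE L2_diff L2_cell u_facts L2_const cell_lmeasurable)
  then show ?thesis using err_parts(3) cv by simp
qed

text \<open>The reaction term is split along \<open>u - uh\<close>, \<open>uh - P\<close> and
  \<open>P\<close>, with \<open>P\<close> the \<open>L2\<close> projection of \<open>uh\<close>. For
  \<open>f\<close> and \<open>P\<close> the bound \<open>r \<le> elem_diam E\<close> reproduces the
  weights of the data and permeability estimators. The other two parts carry no mesh weight on the
  right, so \<open>r\<close> is bounded by the diameter of the domain.\<close>

lemma force_error:
  assumes r: "0 \<le> r" "r \<le> elem_diam E"
  shows "r\<^sup>2 * l2_sq (cell E) force \<le> force_const * err E"
proof -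
  let ?U = "cell E" and ?D = "diameter (closure \<Omega>)"
  obtain x0 where "star_polygon E x0 (\<rho> * elem_diam E)" using star by blast
  then interpret star_polygon E x0 "\<rho> * elem_diam E" .
  note kap = permeability_L2[OF \<kappa> Bk(2,1) element(3,4)[OF E] domain(3)]
  define P where "P = proj_L2 E uh"
  have P: "P1 P" unfolding P_def by (rule VE_proj_L2_residual[OF VE_uh])
  have Lu: "L2 ?U u" "L2 ?U uh" "L2 ?U P" using L2_cell[OF u_facts(4)] VE_L2[OF VE_uh] P1_L2[OF P cell_open_bounded] by auto
  let ?a = "\<lambda>x. inv_sqrt (\<kappa> x) *v (inv_sqrt (\<kappa> x) *v (u x - uh x))"
    and ?b = "\<lambda>x. inv_sqrt (\<kappa> x) *v (inv_sqrt (\<kappa> x) *v (uh x - P x))"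
    and ?c = "\<lambda>x. matrix_inv (\<kappa> x) *v P x"
  define a b where "a = l2_sq ?U (\<lambda>x. inv_sqrt (\<kappa> x) *v (u x - uh x))" and "b = l2_sq ?U (\<lambda>x. inv_sqrt (\<kappa> x) *v (uh x - P x))"
  have La: "L2 ?U ?a" "l2_sq ?U ?a \<le> Bk\<^sup>2 * a" and Lb: "L2 ?U ?b" "l2_sq ?U ?b \<le> Bk\<^sup>2 * b" and Lc: "L2 ?U ?c"
    unfolding a_def b_def by (intro kap L2_diff Lu)+
  have spd: "spd (\<kappa> x)" if "x \<in> ?U" for x using \<kappa> element(3)[OF E] that by (auto simp: permeability_def)
  have "l2_sq ?U (\<lambda>x. matrix_inv (\<kappa> x) *v u x) = l2_sq ?U (\<lambda>x. (?a x + ?b x) + ?c x)"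
  proof (rule l2_sq_cong_AE)
    show "L2 ?U (\<lambda>x. matrix_inv (\<kappa> x) *v u x)" by (rule L2_cell[OF L2_kappa_u])
    show "L2 ?U (\<lambda>x. (?a x + ?b x) + ?c x)" by (intro L2_add La Lb Lc)
    show "AE x in lebesgue_on ?U. matrix_inv (\<kappa> x) *v u x = (?a x + ?b x) + ?c x"
      using spd by (intro AE_I2) (simp add: space_restrict_space inv_sqrt_twice flip: matrix_vector_right_distrib)
  qed
  also have "\<dots> \<le> 2 * l2_sq ?U (\<lambda>x. ?a x + ?b x) + 2 * l2_sq ?U ?c" by (intro l2_sq_add_le L2_add La Lb Lc)
  also have "\<dots> \<le> 2 * (2 * (Bk\<^sup>2 * a) + 2 * (Bk\<^sup>2 * b)) + 2 * l2_sq ?U ?c"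
  proof (intro add_mono mult_left_mono order_refl)
    show "l2_sq ?U (\<lambda>x. ?a x + ?b x) \<le> 2 * (Bk\<^sup>2 * a) + 2 * (Bk\<^sup>2 * b)"
      by (rule order_trans[OF l2_sq_add_le[OF La(1) Lb(1)]]) (intro add_mono mult_left_mono La(2) Lb(2), auto)
  qed auto
  finally have k: "l2_sq ?U (\<lambda>x. matrix_inv (\<kappa> x) *v u x) \<le> 4 * (Bk\<^sup>2 * a) + 4 * (Bk\<^sup>2 * b) + 2 * l2_sq ?U ?c" by simp
  have "l2_sq ?U force \<le> 2 * l2_sq ?U f + 2 * l2_sq ?U (\<lambda>x. (- \<nu>) *\<^sub>R (matrix_inv (\<kappa> x) *v u x))"
    using l2_sq_add_le[OF L2_cell[OF f] L2_scaleR[OF L2_cell[OF L2_kappa_u], of "- \<nu>"]] by (simp add: force_def[abs_def])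
  also have "\<dots> = 2 * l2_sq ?U f + 2 * \<nu>\<^sup>2 * l2_sq ?U (\<lambda>x. matrix_inv (\<kappa> x) *v u x)" by (simp only: l2_sq_scaleR power2_minus mult.assoc)
  also have "\<dots> \<le> 2 * l2_sq ?U f + 2 * \<nu>\<^sup>2 * (4 * (Bk\<^sup>2 * a) + 4 * (Bk\<^sup>2 * b) + 2 * l2_sq ?U ?c)"
    by (intro add_mono mult_left_mono k) auto
  finally have "r\<^sup>2 * l2_sq ?U force \<le> r\<^sup>2 * (2 * l2_sq ?U f + 2 * \<nu>\<^sup>2 * (4 * (Bk\<^sup>2 * a) + 4 * (Bk\<^sup>2 * b) + 2 * l2_sq ?U ?c))"
    by (rule mult_left_mono) simp
  also have "\<dots> = 2 * (r\<^sup>2 * l2_sq ?U f) + r\<^sup>2 * (8 * Bk\<^sup>2 * (\<nu>\<^sup>2 * a)) + r\<^sup>2 * (8 * Bk\<^sup>2 * (\<nu>\<^sup>2 * b)) + 4 * (\<nu>\<^sup>2 * r\<^sup>2 * l2_sq ?U ?c)"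
    by (simp add: algebra_simps)
  also have "\<dots> \<le> 2 * err E + ?D\<^sup>2 * (8 * Bk\<^sup>2 * err E) + ?D\<^sup>2 * (8 * Bk\<^sup>2 * (err E / C1m)) + 4 * err E"
  proof -
    have r2: "r\<^sup>2 \<le> (elem_diam E)\<^sup>2" using r by (intro power_mono) auto
    have rD: "r\<^sup>2 \<le> ?D\<^sup>2" using r element(9)[OF E] by (intro power_mono) auto
    have 1: "r\<^sup>2 * l2_sq ?U f \<le> err E"
      using mult_right_mono[OF r2 l2_sq_nonneg[of ?U f]] err_parts(6) by (simp add: eta_f_sq_def)
    have "r\<^sup>2 * (\<nu>\<^sup>2 * l2_sq ?U ?c) \<le> (elem_diam E)\<^sup>2 * (\<nu>\<^sup>2 * l2_sq ?U ?c)"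
      by (intro mult_right_mono r2 mult_nonneg_nonneg) auto
    then have 4: "\<nu>\<^sup>2 * r\<^sup>2 * l2_sq ?U ?c \<le> err E"
      using err_parts(7) by (simp add: eta_kappa_sq_def P_def mult_ac)
    have 2: "\<nu>\<^sup>2 * a \<le> err E" unfolding a_def by (rule err_parts(2))
    have "\<nu>\<^sup>2 * (C1m * b) \<le> \<nu>\<^sup>2 * S0 E (\<lambda>x. uh x - proj_L2 E uh x) (\<lambda>x. uh x - proj_L2 E uh x)"
      unfolding b_def P_def by (intro mult_left_mono S0_bound) simp
    also have "\<dots> \<le> err E" by (rule err_parts)
    finally have 3: "\<nu>\<^sup>2 * b \<le> err E / C1m" using C1m by (simp add: pos_le_divide_eq mult_ac)
    have ab: "a \<ge> 0" "b \<ge> 0" by (simp_all add: a_def b_def)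
    show ?thesis
      using 1 2 3 4 rD ab by (intro add_mono mult_mono mult_left_mono) auto
  qed
  also have "\<dots> = force_const * err E" by (simp add: force_const_def algebra_simps)
  finally show ?thesis .
qed

end

text \<open>The disc has radius \<open>r = patch_const \<rho> * L / 2\<close>, hence
  \<open>L^2 = 4 r^2 / (patch_const \<rho>)^2\<close>; \<open>flux_const\<close> is divided out of
  \<open>stress_jump_bound\<close>. The last factor is \<open>2 + 2 / C1g\<close> from the gradient
  plus 1 from the pressure.\<close>

definition jump_const :: real where
  "jump_const = 4 / ((patch_const \<rho>)\<^sup>2 * flux_const\<^sup>2) * (36 * pi * (force_const + 64 * (1 + bump_bound)\<^sup>2 * (3 + 2 / C1g)))"

text \<open>The choice of the ordered pair depends on the edge only, so a single order serves all
  fields and all points.\<close>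

lemma normal_jump_eq:
  assumes "e \<in> interior_edges M"
  obtains E E' where "E \<noteq> E'" "elems_at M e = {E, E'}" "\<And>F x. normal_jump M F e x = (F E x - F E' x) *v edge_normal e"
proof -
  let ?P = "\<lambda>(E, E'). E \<noteq> E' \<and> elems_at M e = {E, E'}"
  have "\<exists>E E'. E \<noteq> E' \<and> elems_at M e = {E, E'}"
    using assms by (auto simp: interior_edges_def card_2_iff)
  then have "\<exists>q. ?P q" by auto
  then have P: "?P (SOME q. ?P q)" by (rule someI_ex)
  obtain E E' where q: "(SOME q. ?P q) = (E, E')" by (cases "SOME q. ?P q") auto
  show thesis
  proof (rule that[of E E'])
    show "E \<noteq> E'" "elems_at M e = {E, E'}" using P unfolding q by auto
    show "normal_jump M F e x = (F E x - F E' x) *v edge_normal e" for F x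
      unfolding normal_jump_def q by simp
  qed
qed

text \<open>The stress is constant on either side, so the left-hand side is \<open>L^2\<close> times
  the squared norm of one vector. \<open>stress_jump_bound\<close> controls it by norms over a disc,
  which are distributed over the two elements.\<close>

lemma edge_jump_bound:
  assumes e: "e \<in> interior_edges M"
  shows "edge_len e * edge_sq e (normal_jump M (stress \<nu> uh ph) e) \<le> jump_const * (\<Sum>E\<in>elems_at M e. err E)"
proof -
  obtain E1 E2 where E12: "E1 \<noteq> E2" "elems_at M e = {E1, E2}"
    and nj: "\<And>F x. normal_jump M F e x = (F E1 x - F E2 x) *v edge_normal e"
    using normal_jump_eq[OF e] by blast
  have E: "E1 \<in> M" "E2 \<in> M" "e \<in> edges E1" "e \<in> edges E2" using E12(2) by (auto simp: elems_at_def)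
  have disj: "cell E1 \<inter> cell E2 = {}" using mesh E(1,2) E12(1) by (simp add: polygonal_mesh_def)
  obtain x1 where st1: "star_polygon E1 x1 (\<rho> * elem_diam E1)" using element(10)[OF E(1)] by blast
  obtain x2 where st2: "star_polygon E2 x2 (\<rho> * elem_diam E2)" using element(10)[OF E(2)] by blast
  interpret s1: star_polygon E1 x1 "\<rho> * elem_diam E1" by (rule st1)
  interpret s2: star_polygon E2 x2 "\<rho> * elem_diam E2" by (rule st2)
  define A1 A2 c1 c2 where "A1 = mean_matrix (cell E1) (grad (cell E1) uh)" and "A2 = mean_matrix (cell E2) (grad (cell E2) uh)"
    and "c1 = cell_value E1 ph" and "c2 = cell_value E2 ph"
  define L where "L = edge_len e"
  have L: "L > 0"
  proof -
    obtain a b where "e = {a, b}" "a \<noteq> b" using edgeE[OF E(3)] s1.simple by metis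
    then show ?thesis by (simp add: L_def edge_len_eq)
  qed
  obtain m N where N: "is_normal (edge_tangent e) N" "N = edge_normal e \<or> N = - edge_normal e"
    and m1: "\<And>x. norm (x - m) \<le> patch_const \<rho> * edge_len e \<Longrightarrow> (x - m) \<bullet> N \<ge> 0 \<Longrightarrow> x \<in> closed_cell E1"
    and m2: "\<And>x. norm (x - m) \<le> patch_const \<rho> * edge_len e \<Longrightarrow> (x - m) \<bullet> N \<le> 0 \<Longrightarrow> x \<in> closed_cell E2"
    by (rule interior_edge_patch[OF s1.simple E(3) element(6)[OF E(1,3)] s1.center s1.star E(4) element(6)[OF E(2,4)] s2.center s2.star disj \<rho>], rule that)
  \<comment> \<open>Half the admissible radius: the closed disc then sits in an open disc contained
    in the closure of the domain, hence in the domain itself, as the bump requires.\<close>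
  define r where "r = patch_const \<rho> * L / 2"
  have pc: "patch_const \<rho> > 0" by (rule patch_const_pos[OF \<rho>])
  have pc4: "patch_const \<rho> \<le> 1 / 4"
  proof -
    have "1 \<le> 1 + 1 / \<rho>\<^sup>2" by simp
    then have "1 / 4 / (1 + 1 / \<rho>\<^sup>2) \<le> 1 / 4 / 1" by (intro frac_le) auto
    then show ?thesis unfolding patch_const_def by linarith
  qed
  have r: "r > 0" "r < patch_const \<rho> * edge_len e" using pc L by (simp_all add: r_def L_def)
  have "patch_const \<rho> * L \<le> 1 / 4 * L" using pc4 L by (intro mult_right_mono) auto
  then have rL: "r \<le> L" using L unfolding r_def by linarith
  have rE: "r \<le> elem_diam E1" "r \<le> elem_diam E2"
    using rL element(7)[OF E(1,3)] element(7)[OF E(2,4)] unfolding L_def by linarith+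
  have cb: "cball m r \<subseteq> \<Omega>"
  proof -
    have "ball m (patch_const \<rho> * edge_len e) \<subseteq> closure \<Omega>"
    proof
      fix x assume "x \<in> ball m (patch_const \<rho> * edge_len e)"
      then have "norm (x - m) \<le> patch_const \<rho> * edge_len e" by (simp add: dist_norm norm_minus_commute)
      then have "x \<in> closed_cell E1 \<or> x \<in> closed_cell E2" using m1 m2 by (meson linear)
      then show "x \<in> closure \<Omega>" using element(2)[OF E(1)] element(2)[OF E(2)] by blast
    qed
    then have "ball m (patch_const \<rho> * edge_len e) \<subseteq> interior (closure \<Omega>)" by (simp add: interior_maximal)
    then show ?thesis unfolding domain(5) using r by (auto simp: subset_iff)
  qed
  let ?B = "ball m r" and ?P = "\<lambda>x. 0 < (x - m) \<bullet> N"
  note bound = stress_jump_bound[OF domain(1,2) u_facts(3) divergence_free u_facts(6) L2_force \<nu> momentum_equation N(1) r(1) cb, of A1 A2 c1 c2]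
  note pw = L2_pw[OF domain(1,2) u_facts(3) divergence_free u_facts(6) L2_force \<nu> momentum_equation N(1) r(1) cb]
  have ae: "AE x in lebesgue. x \<in> ?B \<longrightarrow> (if ?P x then x \<in> cell E1 else x \<in> cell E2)"
    using AE_closed_cell[of E1] AE_closed_cell[of E2]
  proof eventually_elim
    case (elim x)
    show ?case
    proof
      assume "x \<in> ?B"
      then have "norm (x - m) \<le> patch_const \<rho> * edge_len e" using r by (simp add: dist_norm norm_minus_commute)
      then show "if ?P x then x \<in> cell E1 else x \<in> cell E2" using m1[of x] m2[of x] elim by auto
    qed
  qed
  have Bs: "?B \<subseteq> \<Omega>" "?B \<in> sets lebesgue" using cb ball_subset_cball[of m r] by auto
  note sets = Bs(2) element(4)[OF E(1)] element(4)[OF E(2)]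
  have LB: "L2 ?B g" if "L2 \<Omega> g" for g :: "real^2 \<Rightarrow> 'a::euclidean_space" by (rule L2_subset[OF that Bs domain(3)])
  have pF: "r\<^sup>2 * l2_sq ?B force \<le> force_const * (err E1 + err E2)"
  proof -
    have "l2_sq ?B force \<le> l2_sq (cell E1) force + l2_sq (cell E2) force"
      using l2_sq_piecewise_le[OF sets ae L2_cell[OF E(1) L2_force] L2_cell[OF E(2) L2_force]] LB[OF L2_force] by simp
    then have "r\<^sup>2 * l2_sq ?B force \<le> r\<^sup>2 * (l2_sq (cell E1) force + l2_sq (cell E2) force)" by (rule mult_left_mono) simp
    also have "\<dots> \<le> force_const * (err E1 + err E2)"
      using force_error[OF E(1) _ rE(1)] force_error[OF E(2) _ rE(2)] r by (simp add: distrib_left)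
    finally show ?thesis .
  qed
  have pG: "\<nu>\<^sup>2 * l2_sq ?B (\<lambda>x. grad \<Omega> u x - (if ?P x then A1 else A2)) \<le> (2 + 2 / C1g) * (err E1 + err E2)"
  proof -
    have eq: "(\<lambda>x. grad \<Omega> u x - (if ?P x then A1 else A2)) = (\<lambda>x. if ?P x then grad \<Omega> u x - A1 else grad \<Omega> u x - A2)" by auto
    have "L2 ?B (\<lambda>x. grad \<Omega> u x - (if ?P x then A1 else A2))" by (rule L2_diff[OF LB[OF u_facts(5)] pw])
    then have "l2_sq ?B (\<lambda>x. grad \<Omega> u x - (if ?P x then A1 else A2))
        \<le> l2_sq (cell E1) (\<lambda>x. grad \<Omega> u x - A1) + l2_sq (cell E2) (\<lambda>x. grad \<Omega> u x - A2)"
      unfolding eq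
      by (intro l2_sq_piecewise_le[OF sets ae] L2_diff L2_cell[OF E(1)] L2_cell[OF E(2)] u_facts L2_const cell_lmeasurable)
    then have "\<nu>\<^sup>2 * l2_sq ?B (\<lambda>x. grad \<Omega> u x - (if ?P x then A1 else A2))
        \<le> \<nu>\<^sup>2 * (l2_sq (cell E1) (\<lambda>x. grad \<Omega> u x - A1) + l2_sq (cell E2) (\<lambda>x. grad \<Omega> u x - A2))" by (rule mult_left_mono) simp
    also have "\<dots> \<le> (2 + 2 / C1g) * err E1 + (2 + 2 / C1g) * err E2"
      unfolding distrib_left[of "\<nu>\<^sup>2"] A1_def A2_def by (rule add_mono[OF gradient_error[OF E(1)] gradient_error[OF E(2)]])
    finally show ?thesis by (simp only: distrib_left)
  qed
  have pp: "l2_sq ?B (\<lambda>x. p x - (if ?P x then c1 else c2)) \<le> err E1 + err E2"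
  proof -
    have eq: "(\<lambda>x. p x - (if ?P x then c1 else c2)) = (\<lambda>x. if ?P x then p x - c1 else p x - c2)" by auto
    have "L2 ?B (\<lambda>x. p x - (if ?P x then c1 else c2))" by (rule L2_diff[OF LB[OF u_facts(6)] pw])
    then have "l2_sq ?B (\<lambda>x. p x - (if ?P x then c1 else c2))
        \<le> l2_sq (cell E1) (\<lambda>x. p x - c1) + l2_sq (cell E2) (\<lambda>x. p x - c2)"
      unfolding eq
      by (intro l2_sq_piecewise_le[OF sets ae] L2_diff L2_cell[OF E(1)] L2_cell[OF E(2)] u_facts L2_const cell_lmeasurable)
    also have "\<dots> \<le> err E1 + err E2"
      unfolding c1_def c2_def by (rule add_mono[OF pressure_error[OF E(1)] pressure_error[OF E(2)]])
    finally show ?thesis .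
  qed
  let ?J = "(\<nu> *\<^sub>R (A1 - A2) - (c1 - c2) *\<^sub>R mat 1) *v N" and ?T = "err E1 + err E2"
  let ?K = "36 * pi * (force_const + 64 * (1 + bump_bound)\<^sup>2 * (3 + 2 / C1g))"
  have "flux_const\<^sup>2 * r\<^sup>2 * (norm ?J)\<^sup>2 \<le> 36 * pi * (r\<^sup>2 * l2_sq ?B force + 64 * (1 + bump_bound)\<^sup>2 *
      (\<nu>\<^sup>2 * l2_sq ?B (\<lambda>x. grad \<Omega> u x - (if ?P x then A1 else A2)) + l2_sq ?B (\<lambda>x. p x - (if ?P x then c1 else c2))))"
    by (rule bound)
  also have "\<dots> \<le> 36 * pi * (force_const * ?T + 64 * (1 + bump_bound)\<^sup>2 * ((2 + 2 / C1g) * ?T + ?T))"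
    by (intro mult_left_mono add_mono pF pG pp) auto
  also have "\<dots> = ?K * ?T" by (simp add: algebra_simps add_divide_distrib)
  finally have K: "flux_const\<^sup>2 * r\<^sup>2 * (norm ?J)\<^sup>2 \<le> ?K * ?T" .
  have "normal_jump M (stress \<nu> uh ph) e x = (\<nu> *\<^sub>R (A1 - A2) - (c1 - c2) *\<^sub>R mat 1) *v edge_normal e" for x
  proof -
    have "stress \<nu> uh ph E1 x - stress \<nu> uh ph E2 x = \<nu> *\<^sub>R (A1 - A2) - (c1 - c2) *\<^sub>R mat 1"
      using s1.jacobian_proj_grad[OF s1.VE_H1[OF VE_uh[OF E(1)]]] s2.jacobian_proj_grad[OF s2.VE_H1[OF VE_uh[OF E(2)]]]
      by (simp add: stress_def s1.slope_def s2.slope_def A1_def A2_def c1_def c2_def scaleR_right_diff_distrib scaleR_left_diff_distrib)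
    then show ?thesis by (simp add: nj)
  qed
  then have "normal_jump M (stress \<nu> uh ph) e = (\<lambda>x. (\<nu> *\<^sub>R (A1 - A2) - (c1 - c2) *\<^sub>R mat 1) *v edge_normal e)" by blast
  moreover have "norm ((\<nu> *\<^sub>R (A1 - A2) - (c1 - c2) *\<^sub>R mat 1) *v edge_normal e) = norm ?J"
    using N(2) matrix_vector_mult_scaleR[of "\<nu> *\<^sub>R (A1 - A2) - (c1 - c2) *\<^sub>R mat 1" "-1" "edge_normal e"] by auto
  ultimately have "edge_len e * edge_sq e (normal_jump M (stress \<nu> uh ph) e) = L\<^sup>2 * (norm ?J)\<^sup>2"
    by (simp add: edge_sq_const L_def power2_eq_square)
  also have "\<dots> = 4 / ((patch_const \<rho>)\<^sup>2 * flux_const\<^sup>2) * (flux_const\<^sup>2 * r\<^sup>2 * (norm ?J)\<^sup>2)"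
    using pc flux_const_pos by (simp add: r_def power_mult_distrib power_divide)
  also have "\<dots> \<le> 4 / ((patch_const \<rho>)\<^sup>2 * flux_const\<^sup>2) * (?K * ?T)"
    by (rule mult_left_mono[OF K]) simp
  also have "\<dots> = jump_const * ?T" by (simp add: jump_const_def mult.assoc)
  also have "?T = (\<Sum>E\<in>elems_at M e. err E)" using E12 by simp
  finally show ?thesis .
qed

lemma jump_const_nonneg: "jump_const \<ge> 0"
  unfolding jump_const_def using C1g force_const_nonneg by (intro mult_nonneg_nonneg add_nonneg_nonneg divide_nonneg_nonneg) auto

theorem estimator_bound:
  assumes E: "E \<in> M"
  shows "eta_r_sq \<kappa> M \<nu> uh ph E \<le> (1 + jump_const) * (\<Sum>e\<in>edges E. \<Sum>E'\<in>elems_at M e. err E')"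
proof -
  let ?S = "\<lambda>e. \<Sum>E'\<in>elems_at M e. err E'"
  have finM: "finite M" using mesh by (simp add: polygonal_mesh_def)
  have fe: "finite (elems_at M e)" for e using finM by (simp add: elems_at_def)
  have nn: "0 \<le> ?S e" for e by (intro sum_nonneg) (auto simp: elems_at_def err_parts(8))
  \<comment> \<open>The permeability part of the estimator is a summand of \<open>err E\<close>, and
    \<open>E\<close> is among the elements at each of its own edges; a single edge is
    enough.\<close>
  obtain e0 where e0: "e0 \<in> edges E" using element(8)[OF E] by blast
  have "err E \<le> ?S e0" using E e0 by (intro member_le_sum fe) (auto simp: elems_at_def err_parts(8))
  also have "\<dots> \<le> (\<Sum>e\<in>edges E. ?S e)" using e0 nn by (intro member_le_sum finite_edges) auto
  finally have 1: "eta_kappa_sq \<kappa> \<nu> uh E \<le> (\<Sum>e\<in>edges E. ?S e)" using err_parts(7)[OF E] by linarith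
  have "(\<Sum>e\<in>interior_edges M \<inter> edges E. edge_len e * edge_sq e (normal_jump M (stress \<nu> uh ph) e))
      \<le> (\<Sum>e\<in>interior_edges M \<inter> edges E. jump_const * ?S e)"
    by (intro sum_mono edge_jump_bound) auto
  also have "\<dots> \<le> (\<Sum>e\<in>edges E. jump_const * ?S e)"
    using nn jump_const_nonneg by (intro sum_mono2 finite_edges mult_nonneg_nonneg) auto
  also have "\<dots> = jump_const * (\<Sum>e\<in>edges E. ?S e)" by (simp add: sum_distrib_left)
  finally have 2: "(\<Sum>e\<in>interior_edges M \<inter> edges E. edge_len e * edge_sq e (normal_jump M (stress \<nu> uh ph) e))
      \<le> jump_const * (\<Sum>e\<in>edges E. ?S e)" .
  \<comment> \<open>Nonnegativity allows the factor 1/2 of the estimator to be dropped.\<close>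
  have "0 \<le> jump_const * (\<Sum>e\<in>edges E. ?S e)" by (rule mult_nonneg_nonneg[OF jump_const_nonneg sum_nonneg[OF nn]])
  then have "eta_r_sq \<kappa> M \<nu> uh ph E \<le> (\<Sum>e\<in>edges E. ?S e) + jump_const * (\<Sum>e\<in>edges E. ?S e)"
    unfolding eta_r_sq_def using 1 2 by linarith
  then show ?thesis by (simp add: distrib_right)
qed

end

theorem theorem5p2:
  fixes \<Omega> :: "(real^2) set"
    and \<kappa> :: "real^2 \<Rightarrow> real^2^2"
    and M :: "nat \<Rightarrow> polygon set"
    and Tri :: "nat \<Rightarrow> polygon \<Rightarrow> (real^2) set set"
    and S1 S0 :: "nat \<Rightarrow> stab_form"
    and \<rho> \<sigma> C1_grad C2_grad C1_mass C2_mass :: real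
  assumes "convex_polygonal_domain \<Omega>"
    and "permeability \<Omega> \<kappa>"
    and "\<And>n. polygonal_mesh \<Omega> (M n) (Tri n)"
    and "\<rho> > 0" and "\<And>n. mesh_regular \<rho> (M n)"
    and "\<sigma> > 0" and "\<And>n. shape_regular \<sigma> (\<Union>E\<in>M n. Tri n E)"
    and "C1_grad > 0" and "C2_grad > 0" and "\<And>n. grad_stabilizer C1_grad C2_grad (M n) (S1 n)"
    and "C1_mass > 0" and "C2_mass > 0" and "\<And>n. mass_stabilizer \<kappa> C1_mass C2_mass (M n) (S0 n)"
  shows "\<exists>C_r>0. \<forall>(\<nu>::real) f u p.
    \<nu> > 0 \<longrightarrow> L2 \<Omega> f \<longrightarrow> continuous_solution \<Omega> \<kappa> \<nu> f u p \<longrightarrow>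
    (\<forall>n uh ph. discrete_solution \<Omega> \<kappa> (M n) (Tri n) (S1 n) (S0 n) \<nu> f uh ph \<longrightarrow>
      (\<forall>E\<in>M n. eta_r_sq \<kappa> (M n) \<nu> uh ph E
        \<le> C_r * (\<Sum>e\<in>edges E. \<Sum>E'\<in>elems_at (M n) e.
             \<nu>\<^sup>2 * energy_sq \<kappa> (cell E') (\<lambda>x. u x - uh x)
             + l2_sq (cell E') (\<lambda>x. p x - ph x)
             + eta_S_sq (S1 n) (S0 n) \<nu> uh E'
             + eta_f_sq f E'
             + eta_kappa_sq \<kappa> \<nu> uh E')))"
proof -
  obtain B where "AE x in lebesgue_on \<Omega>. norm (inv_sqrt (\<kappa> x)) \<le> B"
    using assms(2) unfolding permeability_def by blast
  then have B: "AE x in lebesgue_on \<Omega>. norm (inv_sqrt (\<kappa> x)) \<le> max B 0" by eventually_elim simp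
  \<comment> \<open>Built from \<open>\<rho>\<close>, the domain, the bound on the permeability, the
    lower stabilization constants and absolute constants, so it is fixed before the viscosity, the
    data, the mesh and the element.\<close>
  define K where "K = 4 / ((patch_const \<rho>)\<^sup>2 * flux_const\<^sup>2) * (36 * pi *
    (6 + 8 * (max B 0)\<^sup>2 * (diameter (closure \<Omega>))\<^sup>2 * (1 + 1 / C1_mass) + 64 * (1 + bump_bound)\<^sup>2 * (3 + 2 / C1_grad)))"
  have K0: "K \<ge> 0"
    unfolding K_def using assms(8,11) by (intro mult_nonneg_nonneg add_nonneg_nonneg divide_nonneg_nonneg) auto
  show ?thesis
  proof (intro exI[of _ "1 + K"] conjI allI impI ballI)
    show "1 + K > 0" using K0 by simp
    fix \<nu> :: real and f u p n uh ph E
    assume *: "\<nu> > 0" "L2 \<Omega> f" "continuous_solution \<Omega> \<kappa> \<nu> f u p"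
      "discrete_solution \<Omega> \<kappa> (M n) (Tri n) (S1 n) (S0 n) \<nu> f uh ph" "E \<in> M n"
    interpret efficiency \<Omega> \<kappa> "M n" "Tri n" "S1 n" "S0 n" \<rho> C1_grad C2_grad C1_mass C2_mass "max B 0" \<nu> f u uh p ph
      by unfold_locales (use assms(1-5,8-13) * B in \<open>auto simp: discrete_solution_def\<close>)
    have "jump_const = K" unfolding jump_const_def force_const_def K_def ..
    then show "eta_r_sq \<kappa> (M n) \<nu> uh ph E
        \<le> (1 + K) * (\<Sum>e\<in>edges E. \<Sum>E'\<in>elems_at (M n) e.
             \<nu>\<^sup>2 * energy_sq \<kappa> (cell E') (\<lambda>x. u x - uh x)
             + l2_sq (cell E') (\<lambda>x. p x - ph x)
             + eta_S_sq (S1 n) (S0 n) \<nu> uh E'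
             + eta_f_sq f E'
             + eta_kappa_sq \<kappa> \<nu> uh E')"
      using estimator_bound[OF *(5)] by (simp add: err_def)
  qed
qed

end
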